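(* Let $\Delta(x)=\sum_{d}\delta_dx^d/d!$ be a polynomial with nonnegative coefficients, $\operatorname{Support}(\Delta)=\{d:\delta_d>0\}$, and assume $\Delta$ is aperiodic: $\gcd\{d_1-d_2:\delta_{d_1}\ne0,\delta_{d_2}\ne0\}=1$. Let $n\to\infty$ and $m=m(n)\to\infty$ be such that $2m/n$ has a limit in the open interval $(\min\operatorname{Support}(\Delta),\max\operatorname{Support}(\Delta))$, let $\chi$ be the unique positive solution of $\chi\Delta'(\chi)/\Delta(\chi)=\lim_{n\to\infty}2m/n$, and let $G$ be a random $(n,m,\Delta)$-multigraph. Then: (i) any fixed connected multigraph that is neither a tree nor a unicycle is asymptotically almost surely not (isomorphic to) a subgraph of $G$; (ii) for a tree $T$ with $k$ vertices and $\operatorname{aut}(T)$ automorphisms, the expected number of $T$-subgraphs of $G$ is asymptotically \[ \frac{1}{\operatorname{aut}(T)}\frac{n^k}{(2m)^{k-1}}\prod_{v\in V(T)}\frac{\chi^{\deg(v)}\Delta^{(\deg(v))}(\chi)}{\Delta(\chi)}; \] (iii) if $C_\ell$ denotes a cycle of length $\ell$, then $G[C_\ell]$ follows asymptotically a Poisson law of mean \[ \frac{1}{2\ell}\left(\frac nm\,\frac{\chi^2\Delta''(\chi)}{\Delta(\chi)}\right)^{\ell}. \]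
   Context: A multigraph has vertices labeled by distinct integers and edges given as triples $(v,w,e)$ (oriented from $v$ to $w$, loops and multiple edges allowed, $e$ a distinct integer edge label). An $(n,m)$-multigraph has vertex labels $1,\dots,n$ and edge labels $1,\dots,m$. $\deg(v)$ counts edge endpoints at $v$ (loops twice); in (ii) $\deg(v)$ is the degree in $T$. For nonnegative weights $\delta_d$, $\omega_\Delta(G)=\prod_v\delta_{\deg(v)}$, and a random $(n,m,\Delta)$-multigraph is an $(n,m)$-multigraph chosen with probability proportional to $\omega_\Delta$. For a multigraph $F$, $G[F]$ (number of $F$-subgraphs) is the number of subgraphs of $G$ isomorphic to $F$ (isomorphism ignores labels). A unicycle is a connected multigraph with as many edges as vertices.
   Formalization: In (iii) the Poisson mean is proved with n/(2m) in place of the printed n/m; the printed mean is too large by a factor 2^ℓ whenever Δ'' ≠ 0 (for ℓ=1 the expected number of loops is asymptotically (n/(4m))χ²Δ''(χ)/Δ(χ)). *)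

theory Defs
  imports
    "HOL-Probability.Probability"
    "HOL-Computational_Algebra.Polynomial"
    "HOL-Combinatorics.Permutations"
    "HOL-Library.Landau_Symbols"
begin

text \<open>An edge \<open>(v, w, e)\<close> is oriented from \<open>v\<close> to \<open>w\<close> and carries the label \<open>e\<close>.\<close>

type_synonym edge = "int \<times> int \<times> int"

record multigraph =
  mverts :: "int set"
  medges :: "edge set"

definition edge_source :: "edge \<Rightarrow> int" where
  "edge_source x = fst x"

definition edge_target :: "edge \<Rightarrow> int" where
  "edge_target x = fst (snd x)"

definition edge_label :: "edge \<Rightarrow> int" where
  "edge_label x = snd (snd x)"

definition edge_ends :: "edge \<Rightarrow> int set" where
  "edge_ends x = {edge_source x, edge_target x}"

definition wf_multigraph :: "multigraph \<Rightarrow> bool" where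
  "wf_multigraph G \<longleftrightarrow>
     finite (mverts G) \<and> finite (medges G) \<and>
     (\<forall>x\<in>medges G. edge_ends x \<subseteq> mverts G) \<and>
     inj_on edge_label (medges G)"

definition nm_multigraphs :: "nat \<Rightarrow> nat \<Rightarrow> multigraph set" where
  "nm_multigraphs n m =
     {G. wf_multigraph G \<and> mverts G = {1..int n} \<and> edge_label ` medges G = {1..int m}}"

definition mdegree :: "multigraph \<Rightarrow> int \<Rightarrow> nat" where
  "mdegree G v = card {x \<in> medges G. edge_source x = v} + card {x \<in> medges G. edge_target x = v}"

definition weight :: "(nat \<Rightarrow> real) \<Rightarrow> multigraph \<Rightarrow> real" where
  "weight \<delta> G = (\<Prod>v\<in>mverts G. \<delta> (mdegree G v))"

text \<open>
  This is the intended distribution when the total weight of the \<open>(n, m)\<close>-multigraphs is positive,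
  and an unspecified one otherwise.
\<close>

definition random_multigraph :: "(nat \<Rightarrow> real) \<Rightarrow> nat \<Rightarrow> nat \<Rightarrow> multigraph pmf" where
  "random_multigraph \<delta> n m = embed_pmf (\<lambda>G.
     if G \<in> nm_multigraphs n m then weight \<delta> G / (\<Sum>H\<in>nm_multigraphs n m. weight \<delta> H) else 0)"

definition submultigraph :: "multigraph \<Rightarrow> multigraph \<Rightarrow> bool" where
  "submultigraph H G \<longleftrightarrow>
     wf_multigraph H \<and> mverts H \<subseteq> mverts G \<and> medges H \<subseteq> medges G"

text \<open>
  Isomorphisms disregard the labels and also the orientation of the edges, which is part of the
  labelling. For instance, a multigraph on the vertices \<open>1, 2\<close> whose only edge is \<open>(1, 2, 1)\<close>
  has two automorphisms.
\<close>

definition multigraph_iso ::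
  "(int \<Rightarrow> int) \<Rightarrow> (edge \<Rightarrow> edge) \<Rightarrow> multigraph \<Rightarrow> multigraph \<Rightarrow> bool" where
  "multigraph_iso f g F H \<longleftrightarrow>
     bij_betw f (mverts F) (mverts H) \<and> bij_betw g (medges F) (medges H) \<and>
     (\<forall>x\<in>medges F. edge_ends (g x) = f ` edge_ends x)"

definition isomorphic :: "multigraph \<Rightarrow> multigraph \<Rightarrow> bool" where
  "isomorphic F H \<longleftrightarrow> (\<exists>f g. multigraph_iso f g F H)"

definition aut :: "multigraph \<Rightarrow> nat" where
  "aut F = card {(f, g). f permutes mverts F \<and> g permutes medges F \<and> multigraph_iso f g F F}"

definition copies :: "multigraph \<Rightarrow> multigraph \<Rightarrow> multigraph set" where
  "copies F G = {H. submultigraph H G \<and> isomorphic F H}"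

definition subgraph_count :: "multigraph \<Rightarrow> multigraph \<Rightarrow> nat" where
  "subgraph_count F G = card (copies F G)"

definition connected_multigraph :: "multigraph \<Rightarrow> bool" where
  "connected_multigraph G \<longleftrightarrow>
     wf_multigraph G \<and> mverts G \<noteq> {} \<and>
     (\<forall>u\<in>mverts G. \<forall>v\<in>mverts G. (u, v) \<in> {(a, b). \<exists>x\<in>medges G. edge_ends x = {a, b}}\<^sup>*)"

text \<open>For \<open>l = 1\<close> the cycle is a loop, and for \<open>l = 2\<close> it is a double edge.\<close>

definition cycle_multigraph :: "nat \<Rightarrow> multigraph" where
  "cycle_multigraph l =
     \<lparr>mverts = {1..int l}, medges = (\<lambda>i. (i, i mod int l + 1, i)) ` {1..int l}\<rparr>"

definition tree_multigraph :: "multigraph \<Rightarrow> bool" where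
  "tree_multigraph G \<longleftrightarrow>
     connected_multigraph G \<and> (\<forall>l\<ge>1. copies (cycle_multigraph l) G = {})"

definition unicycle :: "multigraph \<Rightarrow> bool" where
  "unicycle G \<longleftrightarrow> connected_multigraph G \<and> card (medges G) = card (mverts G)"

definition support :: "(nat \<Rightarrow> real) \<Rightarrow> nat set" where
  "support \<delta> = {d. \<delta> d > 0}"

definition aperiodic :: "(nat \<Rightarrow> real) \<Rightarrow> bool" where
  "aperiodic \<delta> \<longleftrightarrow> Gcd {int d1 - int d2 | d1 d2. \<delta> d1 \<noteq> 0 \<and> \<delta> d2 \<noteq> 0} = 1"

text \<open>
  The library's \<open>poisson_pmf\<close> needs a positive rate. The rate \<open>0\<close>, where this is the point mass
  at \<open>0\<close>, occurs when no degree above \<open>1\<close> has positive weight.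

  The number of cycles of length \<open>l\<close> has asymptotic mean
  \<open>(n / (2 m) * chi^2 \<Delta>''(chi) / \<Delta>(chi)) ^ l / (2 l)\<close>, and this is the mean used for the limit law.
  The source prints \<open>n / m\<close> in place of \<open>n / (2 m)\<close>, which is too large by a factor \<open>2 ^ l\<close>:
  for \<open>l = 1\<close>, the expected number of loops is asymptotically \<open>(1 / 2) (n / (2 m)) chi^2 \<Delta>''(chi) / \<Delta>(chi)\<close>,
  because two given half-edges are paired with probability \<open>1 / (2 m - 1)\<close>.
\<close>

definition poisson_mass :: "real \<Rightarrow> nat \<Rightarrow> real" where
  "poisson_mass r j = r ^ j / fact j * exp (- r)"

end

theory Submission
  imports Defs
begin

text \<open>
  An \<open>(n, m)\<close>-multigraph is a map from the \<open>2 m\<close> half-edges to the vertices, and its weight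
  depends only on the sizes of the fibres. Rescaling \<open>\<delta>\<^sub>d\<close> by \<open>chi\<^sup>d / \<Delta>(chi)\<close>
  does not change the distribution, and makes the degrees independent variables with
  probability generating function \<open>P(x) = \<Delta>(chi x) / \<Delta>(chi)\<close>, conditioned on their sum being
  \<open>2 m\<close>. No local limit theorem is needed: the conditioning event has probability at least
  \<open>exp (- \<epsilon> n)\<close> for every \<open>\<epsilon> > 0\<close> and large \<open>n\<close>, and the exponential decay in the
  Chernoff bound for averages over the degrees absorbs this factor, so these averages concentrate.

  Given the degrees, the half-edges are exchangeable. Hence the expected number of embeddings of a
  pattern with \<open>k\<close> vertices and \<open>s\<close> edges is, up to a factor tending to 1,
  \<open>n\<^sup>k / (2 m)\<^sup>s\<close> times the product of the factorial moments of the degree law. Patterns with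
  more edges than vertices therefore disappear. Two distinct cycles that meet form such a pattern, so
  the factorial moments of the number of cycles come from disjoint tuples of cycles, and they
  converge to those of a Poisson variable.
\<close>

section \<open>Counting maps with prescribed fibre sizes\<close>

text \<open>The lower bound for the conditioning event comes from splitting the vertices. All but a
  small proportion \<open>\<theta>\<close> of them have a degree sum near its mean. The other
  \<open>r\<close> vertices steer the sum to the exact value \<open>2 * m n\<close>, each at the
  cost of at most a factor \<open>c\<close>, the least positive coefficient of \<open>P\<close>.
  Aperiodicity and the strict bounds on \<open>L\<close> make every remainder that occurs
  attainable, and a small \<open>\<theta>\<close> makes \<open>c ^ r\<close> only slightly
  exponential.

  Copies are counted through embeddings whose edge map takes values in darts, that is, edges with a
  direction of traversal. Each copy of \<open>F\<close> then carries as many embeddings as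
  \<open>F\<close> has into itself. This number is \<open>aut F\<close> if \<open>F\<close> has no
  loops, and \<open>2 * l\<close> for a cycle of any length \<open>l\<close>: the loop has two such
  embeddings although its \<open>aut\<close> is 1, so \<open>l = 1\<close> is no exception.

  The Poisson limit is read off the Bonferroni inequalities. Their error term is itself a factorial
  moment, so convergence of these moments controls both the main term and the error.\<close>

definition ffac :: "nat \<Rightarrow> nat \<Rightarrow> nat" where
  "ffac N k = (\<Prod>i<k. N - i)"

lemma card_inj_funcset:
  assumes "finite A" "finite C"
  shows "card {f \<in> A \<rightarrow>\<^sub>E C. inj_on f A} = ffac (card C) (card A)"
  using card_inj_on_subset_funcset[OF assms order_refl]
  by (simp add: ffac_def atLeast0LessThan)

lemma ffac_0 [simp]: "ffac N 0 = 1"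
  by (simp add: ffac_def)

lemma ffac_Suc: "ffac N (Suc k) = ffac N k * (N - k)"
  by (simp add: ffac_def)

lemma ffac_eq_0: "N < k \<Longrightarrow> ffac N k = 0"
  unfolding ffac_def by (rule prod_zero) auto

lemma ffac_pos: "k \<le> N \<Longrightarrow> ffac N k > 0"
  unfolding ffac_def by (rule prod_pos) auto

lemma ffac_le_power: "ffac N k \<le> N ^ k"
  unfolding ffac_def using prod_mono[of "{..<k}" "\<lambda>i. N - i" "\<lambda>_. N"] by simp

lemma ffac_fact: "k \<le> N \<Longrightarrow> ffac N k * fact (N - k) = fact N"
proof (induction k)
  case (Suc k)
  have "fact (N - k) = (N - k) * fact (N - Suc k)"
    using Suc.prems by (metis Suc_diff_Suc Suc_le_lessD fact_Suc of_nat_id)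
  then show ?case using Suc by (simp add: ffac_Suc mult.assoc)
qed simp

lemma ffac_eq_fact_binomial: "ffac N k = fact k * (N choose k)"
proof (cases "k \<le> N")
  case True
  have "ffac N k * fact (N - k) = fact k * (N choose k) * fact (N - k)"
    using ffac_fact[OF True] binomial_fact_lemma[OF True] by (simp add: ac_simps)
  then show ?thesis by simp
qed (simp add: ffac_eq_0)

lemma sum_Pow_card:
  fixes g :: "nat \<Rightarrow> real"
  assumes "finite A"
  shows "(\<Sum>S\<in>Pow A. g (card S)) = (\<Sum>k\<le>card A. real (card A choose k) * g k)"
proof -
  have "(\<Sum>S\<in>Pow A. g (card S)) = (\<Sum>k\<le>card A. \<Sum>S\<in>{S\<in>Pow A. card S = k}. g (card S))"
    using assms by (intro sum.group[symmetric]) (auto intro: card_mono)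
  also have "\<dots> = (\<Sum>k\<le>card A. real (card A choose k) * g k)"
    using assms by (intro sum.cong) (auto simp: n_subsets)
  finally show ?thesis .
qed

text \<open>Splits off the fibre \<open>S\<close> over the new point \<open>v\<close>; what is left
  is an arbitrary map of the complement into \<open>V\<close>.\<close>

lemma sum_PiE_insert_target:
  fixes F :: "('a \<Rightarrow> 'v) \<Rightarrow> real"
  assumes "finite A" "finite V" "v \<notin> V"
  shows "(\<Sum>h\<in>A \<rightarrow>\<^sub>E insert v V. F h)
    = (\<Sum>S\<in>Pow A. \<Sum>h\<in>(A - S) \<rightarrow>\<^sub>E V. F (\<lambda>a. if a \<in> S then v else h a))"
proof -
  have "(\<Sum>S\<in>Pow A. \<Sum>h\<in>(A - S) \<rightarrow>\<^sub>E V. F (\<lambda>a. if a \<in> S then v else h a))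
    = (\<Sum>(S, h)\<in>(SIGMA S:Pow A. (A - S) \<rightarrow>\<^sub>E V). F (\<lambda>a. if a \<in> S then v else h a))"
    using assms by (intro sum.Sigma) (auto intro: finite_PiE)
  also have "\<dots> = (\<Sum>h\<in>A \<rightarrow>\<^sub>E insert v V. F h)"
  proof (rule sum.reindex_bij_witness[where
      j = "\<lambda>(S, h) a. if a \<in> S then v else h a" and
      i = "\<lambda>h. ({a\<in>A. h a = v}, restrict h (A - {a\<in>A. h a = v}))"], goal_cases)
    case (1 x)
    obtain S h where x: "x = (S, h)" by force
    with 1 have S: "S \<subseteq> A" and h: "h \<in> (A - S) \<rightarrow>\<^sub>E V" by auto
    have e: "{a\<in>A. (if a \<in> S then v else h a) = v} = S" using S h assms(3) by force
    have "restrict (\<lambda>a. if a \<in> S then v else h a) (A - S) = h"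
      using S h by (auto simp: fun_eq_iff restrict_def PiE_def extensional_def)
    then show ?case unfolding x prod.case e by simp
  next
    case (2 x)
    then show ?case by (auto simp: PiE_def extensional_def Pi_def split: if_splits)
  next
    case (3 h)
    then show ?case by (auto simp: PiE_def extensional_def fun_eq_iff)
  next
    case (4 h)
    then show ?case by (auto simp: PiE_def Pi_def extensional_def)
  qed auto
  finally show ?thesis by simp
qed

text \<open>Fibre sizes d_v are realised by a multinomial number of maps, so the sum is a
  coefficient of a product of exponential generating functions. The induction splits off one fibre;
  grouping it by size gives the binomial convolution.\<close>

lemma sum_PiE_degrees:
  fixes \<phi> :: "'v \<Rightarrow> nat \<Rightarrow> real"
  assumes "finite V" "finite A"
  shows "(\<Sum>h\<in>A \<rightarrow>\<^sub>E V. \<Prod>v\<in>V. \<phi> v (card {a\<in>A. h a = v}))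
    = fact (card A) * fps_nth (\<Prod>v\<in>V. Abs_fps (\<lambda>d. \<phi> v d / fact d)) (card A)"
  using assms
proof (induction V arbitrary: A rule: finite_induct)
  case empty
  show ?case
    by (cases "A = {}") (use empty in \<open>auto simp: PiE_eq_empty_iff card_eq_0_iff\<close>)
next
  case (insert v V A)
  let ?N = "card A"
  let ?C = "\<lambda>k. fps_nth (\<Prod>v\<in>V. Abs_fps (\<lambda>d. \<phi> v d / fact d)) k"
  have "(\<Sum>h\<in>A \<rightarrow>\<^sub>E insert v V. \<Prod>u\<in>insert v V. \<phi> u (card {a\<in>A. h a = u}))
    = (\<Sum>S\<in>Pow A. \<Sum>h\<in>(A - S) \<rightarrow>\<^sub>E V.
        \<Prod>u\<in>insert v V. \<phi> u (card {a\<in>A. (if a \<in> S then v else h a) = u}))"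
    using insert by (subst sum_PiE_insert_target) auto
  also have "\<dots> = (\<Sum>S\<in>Pow A. \<Sum>h\<in>(A - S) \<rightarrow>\<^sub>E V.
      \<phi> v (card S) * (\<Prod>u\<in>V. \<phi> u (card {a\<in>A - S. h a = u})))"
  proof (intro sum.cong refl)
    fix S h assume S: "S \<in> Pow A" and h: "h \<in> (A - S) \<rightarrow>\<^sub>E V"
    have 1: "{a\<in>A. (if a \<in> S then v else h a) = v} = S" using S h insert.hyps by force
    have 2: "{a\<in>A. (if a \<in> S then v else h a) = u} = {a\<in>A - S. h a = u}" if "u \<in> V" for u
      using that insert.hyps by auto
    show "(\<Prod>u\<in>insert v V. \<phi> u (card {a\<in>A. (if a \<in> S then v else h a) = u}))
      = \<phi> v (card S) * (\<Prod>u\<in>V. \<phi> u (card {a\<in>A - S. h a = u}))"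
      using insert.hyps by (simp add: 1 2)
  qed
  also have "\<dots> = (\<Sum>S\<in>Pow A. \<phi> v (card S) * (fact (?N - card S) * ?C (?N - card S)))"
  proof (intro sum.cong refl)
    fix S assume S: "S \<in> Pow A"
    have "finite (A - S)" "card (A - S) = ?N - card S"
      using S insert.prems by (auto simp: card_Diff_subset finite_subset)
    with insert.IH[of "A - S"]
    show "(\<Sum>h\<in>(A - S) \<rightarrow>\<^sub>E V. \<phi> v (card S) * (\<Prod>u\<in>V. \<phi> u (card {a\<in>A - S. h a = u})))
        = \<phi> v (card S) * (fact (?N - card S) * ?C (?N - card S))"
      by (simp add: sum_distrib_left[symmetric])
  qed
  also have "\<dots> = (\<Sum>k\<le>?N. real (?N choose k) * (\<phi> v k * (fact (?N - k) * ?C (?N - k))))"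
    using insert.prems by (rule sum_Pow_card)
  also have "\<dots> = fact ?N * (\<Sum>k\<le>?N. \<phi> v k / fact k * ?C (?N - k))"
    unfolding sum_distrib_left
    by (intro sum.cong refl) (simp add: binomial_fact field_simps)
  also have "\<dots> = fact ?N * fps_nth (\<Prod>v\<in>insert v V. Abs_fps (\<lambda>d. \<phi> v d / fact d)) ?N"
    using insert.hyps by (simp add: fps_mult_nth atLeast0AtMost)
  finally show ?case .
qed

text \<open>Exchangeability of the elements of \<open>A\<close> in exact form. The restricted sum is
  the same for each of the \<open>ffac (card A) (card B)\<close> injections of \<open>B\<close> into
  \<open>A\<close>, and a given \<open>h\<close> is compatible with as many injections as the
  product of falling factorials says. The proof compares generating functions: the factor
  \<open>ffac d (c v)\<close> shifts the series of \<open>v\<close> by \<open>c v\<close>, which is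
  also the effect of fixing \<open>c v\<close> elements of its fibre.\<close>

lemma sum_PiE_prescribed:
  fixes \<phi> :: "'v \<Rightarrow> nat \<Rightarrow> real"
  assumes V: "finite V" and A: "finite A" and B: "finite B"
    and \<iota>: "inj_on \<iota> B" "\<iota> ` B \<subseteq> A" and y: "y ` B \<subseteq> V"
  shows "real (ffac (card A) (card B)) *
      (\<Sum>h\<in>{h \<in> A \<rightarrow>\<^sub>E V. \<forall>z\<in>B. h (\<iota> z) = y z}. \<Prod>v\<in>V. \<phi> v (card {a\<in>A. h a = v}))
    = (\<Sum>h\<in>A \<rightarrow>\<^sub>E V. \<Prod>v\<in>V. \<phi> v (card {a\<in>A. h a = v}) *
        real (ffac (card {a\<in>A. h a = v}) (card {z\<in>B. y z = v})))"
proof -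
  let ?N = "card A" and ?b = "card B"
  define c where "c v = card {z\<in>B. y z = v}" for v
  define Q where "Q v = Abs_fps (\<lambda>d. \<phi> v (d + c v) / fact d)" for v
  have cb: "card (\<iota> ` B) = ?b" using \<iota> by (simp add: card_image)
  have bN: "?b \<le> ?N" using cb \<iota>(2) A by (metis card_mono)
  have cAB: "card (A - \<iota> ` B) = ?N - ?b"
    using \<iota>(2) A cb by (metis card_Diff_subset finite_subset)
  define j where "j = inv_into B \<iota>"
  have j: "j (\<iota> z) = z" if "z \<in> B" for z using that \<iota>(1) by (simp add: j_def)
  have deg: "card {a\<in>A. (if a \<in> \<iota> ` B then y (j a) else h a) = v}
      = card {a\<in>A - \<iota> ` B. h a = v} + c v" for h :: "'a \<Rightarrow> 'v" and v
  proof -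
    have "{a\<in>A. (if a \<in> \<iota> ` B then y (j a) else h a) = v}
      = {a\<in>A - \<iota> ` B. h a = v} \<union> \<iota> ` {z\<in>B. y z = v}" using \<iota>(2) j by auto (metis j)
    moreover have "card ({a\<in>A - \<iota> ` B. h a = v} \<union> \<iota> ` {z\<in>B. y z = v})
      = card {a\<in>A - \<iota> ` B. h a = v} + card (\<iota> ` {z\<in>B. y z = v})"
      using A B by (intro card_Un_disjoint) auto
    moreover have "card (\<iota> ` {z\<in>B. y z = v}) = c v"
      unfolding c_def by (intro card_image inj_on_subset[OF \<iota>(1)]) auto
    ultimately show ?thesis by simp
  qed
  have "(\<Sum>h\<in>{h \<in> A \<rightarrow>\<^sub>E V. \<forall>z\<in>B. h (\<iota> z) = y z}. \<Prod>v\<in>V. \<phi> v (card {a\<in>A. h a = v}))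
    = (\<Sum>h\<in>(A - \<iota> ` B) \<rightarrow>\<^sub>E V. \<Prod>v\<in>V. \<phi> v (card {a\<in>A - \<iota> ` B. h a = v} + c v))"
  proof (rule sum.reindex_bij_witness[where
      i = "\<lambda>h a. if a \<in> \<iota> ` B then y (j a) else h a" and
      j = "\<lambda>h. restrict h (A - \<iota> ` B)"], goal_cases)
    case (1 h)
    then show ?case using \<iota>(2) j by (auto simp: PiE_def extensional_def fun_eq_iff restrict_def)
  next
    case (2 h)
    then show ?case by (auto simp: PiE_def)
  next
    case (3 h)
    then show ?case by (auto simp: PiE_def extensional_def fun_eq_iff restrict_def)
  next
    case (4 h)
    then show ?case using \<iota>(2) y j
      by (auto simp: PiE_def extensional_def Pi_def image_subset_iff)
  next
    case (5 h)
    let ?r = "restrict h (A - \<iota> ` B)"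
    have e: "(if a \<in> \<iota> ` B then y (j a) else ?r a) = h a" for a
      using 5 j by (auto simp: PiE_def extensional_def fun_eq_iff restrict_def)
    have "card {a\<in>A. h a = v} = card {a\<in>A - \<iota> ` B. ?r a = v} + c v" for v
      using deg[of ?r v] unfolding e .
    then show ?case by simp
  qed
  also have "\<dots> = fact (?N - ?b) * fps_nth (\<Prod>v\<in>V. Q v) (?N - ?b)"
    using sum_PiE_degrees[of V "A - \<iota> ` B" "\<lambda>v d. \<phi> v (d + c v)"] V A cAB by (simp add: Q_def)
  finally have L: "(\<Sum>h\<in>{h \<in> A \<rightarrow>\<^sub>E V. \<forall>z\<in>B. h (\<iota> z) = y z}. \<Prod>v\<in>V. \<phi> v (card {a\<in>A. h a = v}))
    = fact (?N - ?b) * fps_nth (\<Prod>v\<in>V. Q v) (?N - ?b)" .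
  have Qc: "Abs_fps (\<lambda>d. \<phi> v d * real (ffac d (c v)) / fact d) = fps_X ^ c v * Q v" for v
  proof (rule fps_ext)
    fix d
    show "fps_nth (Abs_fps (\<lambda>d. \<phi> v d * real (ffac d (c v)) / fact d)) d = fps_nth (fps_X ^ c v * Q v) d"
    proof (cases "c v \<le> d")
      case True
      have "real (ffac d (c v)) * fact (d - c v) = fact d"
        using ffac_fact[OF True] by (metis of_nat_fact of_nat_mult)
      then have "real (ffac d (c v)) / fact d = 1 / fact (d - c v)"
        by (simp add: field_simps)
      then show ?thesis using True
        by (simp add: fps_X_power_mult_nth Q_def) (metis times_divide_eq_right mult.right_neutral)
    qed (simp add: fps_X_power_mult_nth ffac_eq_0)
  qed
  have sc: "(\<Sum>v\<in>V. c v) = ?b"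
  proof -
    have "(\<Sum>v\<in>V. \<Sum>z\<in>{z\<in>B. y z = v}. 1) = (\<Sum>z\<in>B. 1::nat)"
      using B V y by (intro sum.group) auto
    then show ?thesis by (simp add: c_def)
  qed
  have "(\<Sum>h\<in>A \<rightarrow>\<^sub>E V. \<Prod>v\<in>V. \<phi> v (card {a\<in>A. h a = v}) * real (ffac (card {a\<in>A. h a = v}) (c v)))
    = fact ?N * fps_nth (\<Prod>v\<in>V. fps_X ^ c v * Q v) ?N"
    using sum_PiE_degrees[OF V A, of "\<lambda>v d. \<phi> v d * real (ffac d (c v))"] by (simp add: Qc)
  also have "(\<Prod>v\<in>V. fps_X ^ c v * Q v) = fps_X ^ ?b * (\<Prod>v\<in>V. Q v)"
    by (simp add: prod.distrib power_sum[symmetric] sc)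
  also have "fact ?N * fps_nth (fps_X ^ ?b * (\<Prod>v\<in>V. Q v)) ?N = fact ?N * fps_nth (\<Prod>v\<in>V. Q v) (?N - ?b)"
    using bN by (simp add: fps_X_power_mult_nth)
  also have "fact ?N = real (ffac ?N ?b) * fact (?N - ?b)"
    using ffac_fact[OF bN] by (metis of_nat_fact of_nat_mult)
  finally show ?thesis unfolding L c_def by (simp add: mult.assoc)
qed

section \<open>A lower bound for coefficients of powers\<close>

lemma exp_le_quadratic:
  fixes x :: real
  assumes "\<bar>x\<bar> \<le> 1"
  shows "exp x \<le> 1 + x + x\<^sup>2"
proof (cases "x \<ge> 0")
  case True
  with assms show ?thesis by (intro exp_bound) auto
next
  case False
  define y where "y = - x"
  have y: "0 < y" "y \<le> 1" using False assms by (auto simp: y_def)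
  \<comment> \<open>The product is \<open>1 + y ^ 3\<close>.\<close>
  have "1 \<le> (1 + y) * (1 - y + y\<^sup>2)"
    using y by (simp add: algebra_simps power2_eq_square)
  also have "\<dots> \<le> exp y * (1 - y + y\<^sup>2)"
  proof (rule mult_right_mono)
    show "1 + y \<le> exp y" by (rule exp_ge_add_one_self)
    show "0 \<le> 1 - y + y\<^sup>2" using y by simp
  qed
  finally have "exp (- y) \<le> 1 - y + y\<^sup>2"
    by (simp add: exp_minus field_simps)
  then show ?thesis by (simp add: y_def)
qed

text \<open>\<open>P\<close> is read as the probability generating function of a law on
  \<open>nat\<close>; this is the expectation of \<open>\<phi>\<close> under that law.\<close>

definition mean :: "real poly \<Rightarrow> (nat \<Rightarrow> real) \<Rightarrow> real" where
  "mean P \<phi> = (\<Sum>d\<le>degree P. coeff P d * \<phi> d)"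

text \<open>The linear term of the exponential yields the mean, and \<open>B\<^sup>2\<close> bounds
  the second moment. The condition on \<open>t\<close> keeps the exponents in the range of
  \<open>exp_le_quadratic\<close>.\<close>

lemma mgf_bound:
  assumes nonneg: "\<And>d. coeff P d \<ge> 0" and one: "poly P 1 = 1"
    and B: "\<And>d. d \<le> degree P \<Longrightarrow> \<bar>\<phi> d\<bar> \<le> B" and t: "\<bar>t\<bar> * B \<le> 1"
  shows "mean P (\<lambda>d. exp (t * \<phi> d)) \<le> exp (t * mean P \<phi> + t\<^sup>2 * B\<^sup>2)"
proof -
  have "mean P (\<lambda>d. exp (t * \<phi> d)) \<le> mean P (\<lambda>d. 1 + t * \<phi> d + t\<^sup>2 * B\<^sup>2)"
    unfolding mean_def
  proof (intro sum_mono mult_left_mono nonneg)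
    fix d assume d: "d \<in> {..degree P}"
    have b: "\<bar>t * \<phi> d\<bar> \<le> \<bar>t\<bar> * B" using B[of d] d by (auto simp: abs_mult intro: mult_left_mono)
    then have "exp (t * \<phi> d) \<le> 1 + t * \<phi> d + (t * \<phi> d)\<^sup>2"
      using t by (intro exp_le_quadratic) linarith
    also have "(t * \<phi> d)\<^sup>2 \<le> (\<bar>t\<bar> * B)\<^sup>2" using b by (metis abs_ge_zero power2_abs power_mono)
    finally show "exp (t * \<phi> d) \<le> 1 + t * \<phi> d + t\<^sup>2 * B\<^sup>2" by (simp add: power_mult_distrib)
  qed
  also have "\<dots> = 1 + t * mean P \<phi> + t\<^sup>2 * B\<^sup>2"
  proof -
    have s: "(\<Sum>d\<le>degree P. coeff P d) = 1" using one by (simp add: poly_altdef)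
    have "mean P (\<lambda>d. 1 + t * \<phi> d + t\<^sup>2 * B\<^sup>2)
      = (\<Sum>d\<le>degree P. coeff P d) + t * mean P \<phi> + (\<Sum>d\<le>degree P. coeff P d) * (t\<^sup>2 * B\<^sup>2)"
      unfolding mean_def sum_distrib_left sum_distrib_right sum.distrib[symmetric]
      by (intro sum.cong) (auto simp: algebra_simps)
    then show ?thesis by (simp add: s)
  qed
  also have "\<dots> \<le> exp (t * mean P \<phi> + t\<^sup>2 * B\<^sup>2)"
    using exp_ge_add_one_self[of "t * mean P \<phi> + t\<^sup>2 * B\<^sup>2"] by (simp add: add.assoc)
  finally show ?thesis .
qed

lemma coeff_power_nonneg:
  fixes P :: "real poly"
  assumes "\<And>d. coeff P d \<ge> 0"
  shows "coeff (P ^ n) d \<ge> 0"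
  by (induction n arbitrary: d) (auto simp: coeff_mult assms intro!: sum_nonneg)

lemma coeff_le_poly_1:
  fixes P :: "real poly"
  assumes "\<And>d. coeff P d \<ge> 0"
  shows "coeff P d \<le> poly P 1"
proof (cases "d \<le> degree P")
  case True
  then show ?thesis unfolding poly_altdef
    using assms by (auto intro!: member_le_sum)
next
  case False
  then have "coeff P d = 0" by (simp add: coeff_eq_0)
  then show ?thesis unfolding poly_altdef using assms by (auto intro!: sum_nonneg)
qed

text \<open>Chernoff's bound: \<open>coeff (P ^ n) s\<close> is the probability that
  \<open>n\<close> independent variables with law \<open>P\<close> have sum \<open>s\<close>. The
  factor 2 stands for the two tails.\<close>

lemma coeff_power_concentration:
  assumes nonneg: "\<And>d. coeff P d \<ge> 0" and one: "poly P 1 = 1" and \<eta>: "\<eta> > 0"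
  shows "\<exists>c>0. \<forall>n. (\<Sum>s | s \<le> degree (P ^ n) \<and> \<bar>real s - real n * mean P real\<bar> > \<eta> * real n. coeff (P ^ n) s)
     \<le> 2 * exp (- c * real n)"
proof -
  define B where "B = real (degree P) + 1"
  define \<mu> where "\<mu> = mean P real"
  \<comment> \<open>Makes the quadratic loss \<open>t\<^sup>2 * B\<^sup>2\<close> at most half of
    the gain \<open>t * \<eta>\<close>, cut off at \<open>1 / B\<close> where
    \<open>mgf_bound\<close> stops. The 1 added in \<open>B\<close> keeps it positive for constant
    \<open>P\<close>.\<close>
  define t where "t = min (1 / B) (\<eta> / (2 * B\<^sup>2))"
  have B: "B > 0" by (simp add: B_def add_nonneg_pos)
  have t: "t > 0" "t * B \<le> 1" "t * B\<^sup>2 \<le> \<eta> / 2"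
  proof -
    show "t > 0" using B \<eta> by (simp add: t_def)
    have "t \<le> 1 / B" "t \<le> \<eta> / (2 * B\<^sup>2)" by (simp_all add: t_def)
    then show "t * B \<le> 1" "t * B\<^sup>2 \<le> \<eta> / 2" using B by (simp_all add: field_simps)
  qed
  have gen: "(\<Sum>s\<le>degree (P ^ n). coeff (P ^ n) s * exp (u * (real s - real n * \<mu>))) \<le> exp (real n * (t\<^sup>2 * B\<^sup>2))"
    if u: "\<bar>u\<bar> = t" for u n
  proof -
    have "(\<Sum>s\<le>degree (P ^ n). coeff (P ^ n) s * exp (u * (real s - real n * \<mu>)))
      = exp (- (u * real n * \<mu>)) * poly (P ^ n) (exp u)"
      unfolding poly_altdef sum_distrib_left
      by (intro sum.cong) (auto simp: exp_of_nat_mult[symmetric] exp_add[symmetric] algebra_simps mult_exp_exp)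
    also have "poly (P ^ n) (exp u) = (mean P (\<lambda>d. exp (u * real d))) ^ n"
    proof -
      have "poly P (exp u) = mean P (\<lambda>d. exp (u * real d))"
        by (simp add: mean_def poly_altdef exp_of_nat_mult[symmetric] mult.commute)
      then show ?thesis by (simp add: poly_power)
    qed
    also have "\<dots> \<le> exp (u * \<mu> + u\<^sup>2 * B\<^sup>2) ^ n"
      unfolding \<mu>_def
      using u t by (intro power_mono mgf_bound nonneg one) (auto simp: B_def mean_def intro!: sum_nonneg mult_nonneg_nonneg nonneg)
    also have "\<dots> = exp (u * real n * \<mu>) * exp (real n * (t\<^sup>2 * B\<^sup>2))"
    proof -
      have "u\<^sup>2 = t\<^sup>2" using u by (metis power2_abs)
      then show ?thesis by (simp add: exp_of_nat_mult[symmetric] mult_exp_exp algebra_simps)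
    qed
    finally show ?thesis by (simp add: mult_exp_exp mult.assoc[symmetric])
  qed
  have "(\<Sum>s | s \<le> degree (P ^ n) \<and> \<bar>real s - real n * \<mu>\<bar> > \<eta> * real n. coeff (P ^ n) s)
     \<le> 2 * exp (- (t * \<eta> / 2) * real n)" for n
  proof -
    let ?c = "coeff (P ^ n)"
    let ?x = "\<lambda>s. real s - real n * \<mu>"
    have "(\<Sum>s | s \<le> degree (P ^ n) \<and> \<bar>?x s\<bar> > \<eta> * real n. ?c s)
      \<le> (\<Sum>s | s \<le> degree (P ^ n) \<and> \<bar>?x s\<bar> > \<eta> * real n.
          exp (- (t * \<eta> * real n)) * (?c s * exp (t * ?x s) + ?c s * exp (- t * ?x s)))"
    proof (intro sum_mono)
      fix s assume "s \<in> {s. s \<le> degree (P ^ n) \<and> \<bar>?x s\<bar> > \<eta> * real n}"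
      then have s: "\<bar>?x s\<bar> > \<eta> * real n" by auto
      have "exp (t * \<eta> * real n) \<le> exp (t * \<bar>?x s\<bar>)" using s t by simp
      also have "\<dots> \<le> exp (t * ?x s) + exp (- t * ?x s)"
      proof (cases "?x s \<ge> 0")
        case False
        then have "t * \<bar>?x s\<bar> = - t * ?x s" by (simp add: algebra_simps)
        then show ?thesis by (metis add_increasing exp_ge_zero order_refl)
      qed simp
      finally have "1 \<le> exp (- (t * \<eta> * real n)) * (exp (t * ?x s) + exp (- t * ?x s))"
        by (simp add: exp_minus field_simps)
      then have "?c s * 1 \<le> ?c s * (exp (- (t * \<eta> * real n)) * (exp (t * ?x s) + exp (- t * ?x s)))"
        by (intro mult_left_mono coeff_power_nonneg nonneg)
      then show "?c s \<le> exp (- (t * \<eta> * real n)) * (?c s * exp (t * ?x s) + ?c s * exp (- t * ?x s))"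
        by (simp add: algebra_simps)
    qed
    also have "\<dots> \<le> (\<Sum>s\<le>degree (P ^ n).
          exp (- (t * \<eta> * real n)) * (?c s * exp (t * ?x s) + ?c s * exp (- t * ?x s)))"
      by (intro sum_mono2) (auto intro!: mult_nonneg_nonneg add_nonneg_nonneg coeff_power_nonneg nonneg)
    also have "\<dots> = exp (- (t * \<eta> * real n)) * ((\<Sum>s\<le>degree (P ^ n). ?c s * exp (t * ?x s))
        + (\<Sum>s\<le>degree (P ^ n). ?c s * exp (- t * ?x s)))"
      by (simp add: sum_distrib_left sum.distrib algebra_simps)
    also have "\<dots> \<le> exp (- (t * \<eta> * real n)) * (exp (real n * (t\<^sup>2 * B\<^sup>2)) + exp (real n * (t\<^sup>2 * B\<^sup>2)))"
      using gen[of t n] gen[of "-t" n] t by (intro mult_left_mono add_mono) auto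
    also have "\<dots> = 2 * exp (real n * (t * (t * B\<^sup>2) - t * \<eta>))"
      by (simp add: mult_exp_exp algebra_simps power2_eq_square)
    also have "\<dots> \<le> 2 * exp (real n * (t * (\<eta> / 2) - t * \<eta>))"
    proof -
      have "t * (t * B\<^sup>2) \<le> t * (\<eta> / 2)" using t by (intro mult_left_mono) auto
      then have "real n * (t * (t * B\<^sup>2) - t * \<eta>) \<le> real n * (t * (\<eta> / 2) - t * \<eta>)"
        by (intro mult_left_mono[OF diff_right_mono]) simp_all
      then have "exp (real n * (t * (t * B\<^sup>2) - t * \<eta>)) \<le> exp (real n * (t * (\<eta> / 2) - t * \<eta>))"
        unfolding exp_le_cancel_iff .
      then show ?thesis by (rule mult_left_mono) simp
    qed
    also have "\<dots> = 2 * exp (- (t * \<eta> / 2) * real n)" by (simp add: algebra_simps)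
    finally show ?thesis .
  qed
  moreover have "t * \<eta> / 2 > 0" using t \<eta> by simp
  ultimately show ?thesis unfolding \<mu>_def by blast
qed

text \<open>Sums of \<open>r\<close> elements of \<open>{a, b}\<close> only reach
  \<open>r * a\<close> plus multiples of \<open>b - a\<close>. The other residues are reached by a
  bounded number of further elements of \<open>D\<close>, and gcd 1 makes all residues occur.
  \<open>Q\<close> is kept abstract so that a lower bound for the probability of the sum can be
  carried along instead of mere existence.\<close>

lemma attainable_sums:
  fixes D :: "nat set" and Q :: "nat \<Rightarrow> nat \<Rightarrow> bool"
  assumes Q0: "Q 0 0" and Q1: "\<And>d. d \<in> D \<Longrightarrow> Q 1 d"
    and Qadd: "\<And>r M r' M'. Q r M \<Longrightarrow> Q r' M' \<Longrightarrow> Q (r + r') (M + M')"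
    and ab: "a \<in> D" "b \<in> D" "a < b"
    and gcd1: "Gcd {int d1 - int d2 | d1 d2. d1 \<in> D \<and> d2 \<in> D} = 1"
  shows "\<exists>K. \<forall>r M. int r * int a + K \<le> int M \<longrightarrow> int M + K \<le> int r * int b \<longrightarrow> Q r M"
proof -
  define q where "q = int b - int a"
  have q: "q > 0" using ab by (simp add: q_def)
  \<comment> \<open>The residues modulo \<open>q\<close> of \<open>int M - int r * int a\<close>
    over all attainable pairs. The set is closed under addition, and multiplication by
    \<open>q - 1\<close> acts as negation modulo \<open>q\<close>, so it is a subgroup of the
    integers.\<close>
  define H where "H = {x::int. \<exists>r M. Q r M \<and> q dvd (int M - int r * int a - x)}"
  have Qmult: "Q (k * r) (k * M)" if "Q r M" for k r M
  proof (induction k)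
    case 0 then show ?case using Q0 by simp
  next
    case (Suc k) then show ?case using Qadd[OF that Suc] by (simp add: add.commute)
  qed
  have Hadd: "x + y \<in> H" if xy: "x \<in> H" "y \<in> H" for x y
  proof -
    obtain r M where 1: "Q r M" "q dvd (int M - int r * int a - x)"
      using xy(1) by (auto simp: H_def)
    obtain r' M' where 2: "Q r' M'" "q dvd (int M' - int r' * int a - y)"
      using xy(2) by (auto simp: H_def)
    have "q dvd (int M - int r * int a - x) + (int M' - int r' * int a - y)"
      using 1 2 by (intro dvd_add)
    also have "\<dots> = int (M + M') - int (r + r') * int a - (x + y)" by (simp add: algebra_simps)
    finally show ?thesis using Qadd[OF 1(1) 2(1)] unfolding H_def by blast
  qed
  have Hmult: "int k * x \<in> H" if xH: "x \<in> H" for k x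
  proof -
    obtain r M where 1: "Q r M" "q dvd (int M - int r * int a - x)" using xH by (auto simp: H_def)
    have "q dvd int k * (int M - int r * int a - x)" using 1 by simp
    also have "\<dots> = int (k * M) - int (k * r) * int a - int k * x" by (simp add: algebra_simps)
    finally show ?thesis using Qmult[OF 1(1)] unfolding H_def by blast
  qed
  have Hmod: "y \<in> H" if xH: "x \<in> H" and xy: "q dvd x - y" for x y
  proof -
    obtain r M where 1: "Q r M" "q dvd (int M - int r * int a - x)" using xH by (auto simp: H_def)
    have "q dvd (int M - int r * int a - x) + (x - y)" using 1 xy by (intro dvd_add)
    also have "(int M - int r * int a - x) + (x - y) = int M - int r * int a - y" by linarith
    finally show ?thesis using 1 unfolding H_def by blast
  qed
  have Huminus: "- x \<in> H" if "x \<in> H" for x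
  proof -
    have "int (nat (q - 1)) * x \<in> H" using that by (rule Hmult)
    moreover have "q dvd int (nat (q - 1)) * x - (- x)" using q by (simp add: algebra_simps)
    ultimately show ?thesis by (rule Hmod)
  qed
  have Hscale: "k * x \<in> H" if "x \<in> H" for k x :: int
  proof (cases "k \<ge> 0")
    case True then show ?thesis using Hmult[OF that, of "nat k"] by simp
  next
    case False then show ?thesis using Huminus[OF Hmult[OF that, of "nat (-k)"]] by simp
  qed
  have Hd: "int d - int a \<in> H" if "d \<in> D" for d
    using Q1[OF that] unfolding H_def by (intro CollectI exI[of _ 1] exI[of _ d]) auto
  have H1: "1 \<in> H"
  proof -
    \<comment> \<open>The generator of the subgroup \<open>H\<close>, which is not trivial as it
      contains \<open>q\<close>. It divides every difference of elements of \<open>D\<close>, hence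
      their gcd.\<close>
    define g where "g = (LEAST k. k > 0 \<and> int k \<in> H)"
    have "nat q > 0 \<and> int (nat q) \<in> H" using Hd[OF ab(2)] q by (simp add: q_def)
    then have "g > 0 \<and> int g \<in> H" unfolding g_def by (rule LeastI)
    then have g: "g > 0" "int g \<in> H" by auto
    have gd: "int g dvd x" if x: "x \<in> H" for x
    proof (rule ccontr)
      assume n: "\<not> int g dvd x"
      have "x + (- (x div int g)) * int g \<in> H" by (intro Hadd x Hscale g)
      then have m: "x mod int g \<in> H" by (simp add: minus_div_mult_eq_mod[symmetric])
      have "x mod int g \<noteq> 0" using n by (simp add: mod_eq_0_iff_dvd)
      moreover have "x mod int g \<ge> 0" using g by simp
      ultimately have pos: "x mod int g > 0" by linarith
      then have "nat (x mod int g) > 0 \<and> int (nat (x mod int g)) \<in> H" using m by (simp only: zero_less_nat_eq nat_0_le order_less_imp_le simp_thms)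
      then have "g \<le> nat (x mod int g)" unfolding g_def by (rule Least_le)
      moreover have "x mod int g < int g" using g by simp
      ultimately show False using pos by linarith
    qed
    have "int g dvd Gcd {int d1 - int d2 | d1 d2. d1 \<in> D \<and> d2 \<in> D}"
    proof (rule Gcd_greatest, clarify)
      fix d1 d2 assume "d1 \<in> D" "d2 \<in> D"
      then have "int g dvd (int d1 - int a) - (int d2 - int a)" by (intro dvd_diff gd Hd)
      then show "int g dvd int d1 - int d2" by simp
    qed
    then have "g = 1" unfolding gcd1 by simp
    then show ?thesis using g by simp
  qed
  have Hall: "x \<in> H" for x using Hscale[OF H1, of x] by simp
  have "\<forall>x. \<exists>r M. Q r M \<and> q dvd (int M - int r * int a - x)"
    using Hall unfolding H_def by blast
  then obtain R S where RS: "\<And>x. Q (R x) (S x)" "\<And>x. q dvd (int (S x) - int (R x) * int a - x)"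
    by metis
  define T where "T x = int (S x) - int (R x) * int a" for x
  \<comment> \<open>A bound for the correction needed in any of the finitely many residue classes;
    \<open>q * int (R x)\<close> pays for the \<open>R x\<close> summands that are no longer free to
    be \<open>a\<close> or \<open>b\<close>.\<close>
  define K where "K = (\<Sum>x\<in>{0..<q}. \<bar>T x\<bar> + q * int (R x))"
  show ?thesis
  proof (intro exI[of _ K] allI impI)
    fix r M assume lo: "int r * int a + K \<le> int M" and hi: "int M + K \<le> int r * int b"
    define x where "x = (int M - int r * int a) mod q"
    have x: "x \<in> {0..<q}" using q by (simp add: x_def)
    have "\<bar>T x\<bar> + q * int (R x) \<le> K"
      unfolding K_def using x q by (intro member_le_sum) auto
    then have K: "\<bar>T x\<bar> + q * int (R x) \<le> K" .
    have nn: "q * int (R x) \<ge> 0" using q by simp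
    have "q dvd (int M - int r * int a - x) - (T x - x)"
    proof (rule dvd_diff)
      show "q dvd int M - int r * int a - x" unfolding x_def by (rule dvd_minus_mod)
      show "q dvd T x - x" using RS(2)[of x] by (simp add: T_def)
    qed
    moreover have "(int M - int r * int a - x) - (T x - x) = int M - int r * int a - T x" by linarith
    ultimately have "q dvd int M - int r * int a - T x" by simp
    then obtain j where j: "int M - int r * int a - T x = q * j" by (rule dvdE)
    have "q * j \<ge> 0" using j lo K nn by linarith
    then have j0: "j \<ge> 0" using q by (simp add: zero_le_mult_iff)
    have "q * (j + int (R x)) \<le> q * int r"
    proof -
      have "q * j + q * int (R x) \<le> int r * int b - int r * int a"
        using j hi K by linarith
      also have "\<dots> = q * int r" by (simp add: q_def algebra_simps)
      finally show ?thesis by (simp add: algebra_simps)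
    qed
    then have jr: "j + int (R x) \<le> int r" using q by simp
    define k where "k = nat j"
    have k: "int k = j" "k + R x \<le> r" using j0 jr by (auto simp: k_def)
    \<comment> \<open>The correction for the residue class of \<open>M\<close>, then
      \<open>k\<close> summands \<open>b\<close>, and \<open>a\<close> for all the others.\<close>
    have "Q (R x + (k * 1 + (r - R x - k) * 1)) (S x + (k * b + (r - R x - k) * a))"
      by (intro Qadd Qmult RS Q1 ab)
    moreover have "R x + (k * 1 + (r - R x - k) * 1) = r" using k by simp
    moreover have "S x + (k * b + (r - R x - k) * a) = M"
    proof -
      have "int (r - R x - k) = int r - int (R x) - j" using k by linarith
      then have "int (S x + (k * b + (r - R x - k) * a)) = int (S x) + j * int b + (int r - int (R x) - j) * int a"
        by (simp add: k)
      also have "\<dots> = int M" using j unfolding T_def q_def by (simp add: algebra_simps)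
      finally show ?thesis by linarith
    qed
    ultimately show "Q r M" by simp
  qed
qed


lemma coeff_power_lower_bound:
  fixes P :: "real poly"
  assumes nonneg: "\<And>d. coeff P d \<ge> 0" and one: "poly P 1 = 1"
    and ab: "coeff P a > 0" "coeff P b > 0" "real a < mean P real" "mean P real < real b"
    and gcd1: "Gcd {int d1 - int d2 | d1 d2. coeff P d1 > 0 \<and> coeff P d2 > 0} = 1"
    and N: "(\<lambda>n. real (N n) / real n) \<longlonglongrightarrow> mean P real" and \<epsilon>: "\<epsilon> > 0"
  shows "eventually (\<lambda>n. coeff (P ^ n) (N n) \<ge> exp (- \<epsilon> * real n)) sequentially"
proof -
  define D where "D = {d. coeff P d > 0}"
  define \<mu> where "\<mu> = mean P real"
  have fD: "finite D" unfolding D_def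
    by (rule finite_subset[of _ "{..degree P}"]) (auto intro: le_degree)
  define c where "c = Min (coeff P ` D)"
  have ne: "D \<noteq> {}" using ab by (auto simp: D_def)
  have c0: "c > 0" using fD ne by (auto simp: c_def D_def)
  have cD: "c \<le> coeff P d" if "d \<in> D" for d using fD that by (simp add: c_def)
  have c1: "c \<le> 1" using cD[of a] coeff_le_poly_1[of P a] nonneg one ab by (simp add: D_def)
  \<comment> \<open>A fixed sequence of \<open>r\<close> degrees in the support has probability at
    least \<open>c ^ r\<close>. The bound is multiplicative under convolution, which gives the
    additivity that \<open>attainable_sums\<close> asks for.\<close>
  define Q where "Q r M \<longleftrightarrow> coeff (P ^ r) M \<ge> c ^ r" for r M
  have Qadd: "Q (r + r') (M + M')" if "Q r M" "Q r' M'" for r M r' M'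
  proof -
    have "c ^ (r + r') \<le> coeff (P ^ r) M * coeff (P ^ r') (M + M' - M)"
      unfolding power_add using that c0 nonneg
      by (intro mult_mono) (auto simp: Q_def coeff_power_nonneg)
    also have "\<dots> \<le> (\<Sum>i\<le>M + M'. coeff (P ^ r) i * coeff (P ^ r') (M + M' - i))"
      by (rule member_le_sum) (auto intro!: mult_nonneg_nonneg coeff_power_nonneg nonneg)
    finally show ?thesis by (simp add: Q_def power_add coeff_mult)
  qed
  have "\<exists>K. \<forall>r M. int r * int a + K \<le> int M \<longrightarrow> int M + K \<le> int r * int b \<longrightarrow> Q r M"
  proof (rule attainable_sums[where D = D])
    show "Q 0 0" by (simp add: Q_def)
    show "Q 1 d" if "d \<in> D" for d using cD[OF that] by (simp add: Q_def)
    show "a \<in> D" "b \<in> D" using ab by (auto simp: D_def)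
    have "real a < real b" using ab(3,4) by linarith
    then show "a < b" by simp
    show "Gcd {int d1 - int d2 |d1 d2. d1 \<in> D \<and> d2 \<in> D} = 1" using gcd1 by (simp add: D_def)
  qed (rule Qadd)
  then obtain K where K: "\<And>r M. int r * int a + K \<le> int M \<Longrightarrow> int M + K \<le> int r * int b \<Longrightarrow> Q r M"
    by blast
  \<comment> \<open>Taken nonnegative because the lower window bound must also give
    \<open>s \<le> N n\<close> further down, where natural subtraction is used.\<close>
  define K' where "K' = real_of_int (max K 0)"
  have K': "Q r M" if "real r * real a + K' \<le> real M" "real M + K' \<le> real r * real b" for r M
  proof (rule K)
    have "real_of_int K \<le> K'" by (simp add: K'_def)
    then have "real_of_int (int r * int a + K) \<le> real_of_int (int M)"
      "real_of_int (int M + K) \<le> real_of_int (int r * int b)" using that by auto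
    then show "int r * int a + K \<le> int M" "int M + K \<le> int r * int b"
      unfolding of_int_le_iff .
  qed
  \<comment> \<open>With at most \<open>\<theta> * n\<close> steering vertices the cost
    \<open>c ^ r\<close> is at least \<open>exp (- (\<epsilon> / 2) * n)\<close>. The 1 in the
    denominator keeps it positive when \<open>c = 1\<close>.\<close>
  define \<theta> where "\<theta> = min (1/2) (\<epsilon> / (2 * (1 - ln c)))"
  have lc: "ln c \<le> 0" using c0 c1 by simp
  have \<theta>: "\<theta> > 0" "\<theta> \<le> 1/2" "\<theta> * (- ln c) \<le> \<epsilon> / 2"
  proof -
    show "\<theta> > 0" using \<epsilon> lc by (auto simp: \<theta>_def)
    show "\<theta> \<le> 1/2" unfolding \<theta>_def by (rule min.cobounded1)
    have "\<theta> \<le> \<epsilon> / (2 * (1 - ln c))" by (simp add: \<theta>_def)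
    then have "\<theta> * (1 - ln c) \<le> \<epsilon> / 2" using lc by (simp add: field_simps)
    then show "\<theta> * (- ln c) \<le> \<epsilon> / 2" using \<open>\<theta> > 0\<close> by (simp add: algebra_simps)
  qed
  define g where "g = min (\<mu> - a) (b - \<mu>)"
  have g: "g > 0" using ab by (simp add: g_def \<mu>_def)
  \<comment> \<open>\<open>g\<close> is the distance from the mean to the nearer of \<open>a\<close>
    and \<open>b\<close>, so the steering vertices can correct a deviation of about
    \<open>r * g\<close>, that is \<open>4 * \<eta> * n\<close>. Half of this absorbs the deviations
    of \<open>N n\<close> and of the first \<open>n'\<close> degrees, each at most
    \<open>\<eta> * n\<close>; the other half absorbs \<open>K' + g\<close>.\<close>
  define \<eta> where "\<eta> = \<theta> * g / 4"
  have \<eta>: "\<eta> > 0" using \<theta> g by (simp add: \<eta>_def)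
  obtain c' where c': "c' > 0" and tail: "\<And>n. (\<Sum>s | s \<le> degree (P ^ n) \<and> \<bar>real s - real n * \<mu>\<bar> > \<eta> * real n. coeff (P ^ n) s)
     \<le> 2 * exp (- c' * real n)"
    using coeff_power_concentration[OF nonneg one \<eta>] unfolding \<mu>_def by blast
  have e1: "eventually (\<lambda>n. \<bar>real (N n) - real n * \<mu>\<bar> \<le> \<eta> * real n) sequentially"
  proof -
    have "eventually (\<lambda>n. dist (real (N n) / real n) \<mu> < \<eta>) sequentially"
      using N \<eta> unfolding \<mu>_def by (rule tendstoD)
    then show ?thesis using eventually_gt_at_top[of 0]
    proof eventually_elim
      case (elim n)
      have "real (N n) - real n * \<mu> = real n * (real (N n) / real n - \<mu>)"
        using elim by (simp add: field_simps)
      then have "\<bar>real (N n) - real n * \<mu>\<bar> = real n * \<bar>real (N n) / real n - \<mu>\<bar>"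
        by (simp add: abs_mult)
      also have "\<dots> \<le> real n * \<eta>" using elim by (intro mult_left_mono) (auto simp: dist_real_def)
      finally show ?case by (simp add: mult.commute)
    qed
  qed
  have small: "eventually (\<lambda>n. A * exp (- B * real n) \<le> 1 / 2) sequentially" if "B > 0" for A B :: real
  proof -
    have "(\<lambda>n. A * exp (- B * real n)) \<longlonglongrightarrow> A * 0"
      using that by (intro tendsto_mult tendsto_const filterlim_compose[OF exp_at_bot]
          filterlim_tendsto_neg_mult_at_bot[OF tendsto_const] filterlim_real_sequentially) auto
    then have "eventually (\<lambda>n. A * exp (- B * real n) < 1/2) sequentially"
      by (rule order_tendstoD) simp
    then show ?thesis by eventually_elim simp
  qed
  have e2: "eventually (\<lambda>n. 2 * exp (- (c' / 2) * real n) \<le> 1 / 2) sequentially"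
    using c' by (intro small) auto
  have e4: "eventually (\<lambda>n. 1 * exp (- (\<epsilon> / 2) * real n) \<le> 1 / 2) sequentially"
    using \<epsilon> by (intro small) auto
  have e3: "eventually (\<lambda>n. (K' + g) / (2 * \<eta>) \<le> real n) sequentially"
    using filterlim_real_sequentially by (simp add: filterlim_at_top)
  show ?thesis using e1 e2 e3 e4
  proof eventually_elim
    case (elim n)
    define r where "r = nat \<lfloor>\<theta> * real n\<rfloor>"
    define n' where "n' = n - r"
    have r: "real r \<le> \<theta> * real n" "\<theta> * real n - 1 \<le> real r"
      using \<theta> by (auto simp: r_def)
    have "\<theta> * real n \<le> 1/2 * real n" using \<theta> by (intro mult_right_mono) auto
    with r have rn: "real r \<le> real n / 2" by linarith
    then have n': "n = n' + r" "real n' = real n - real r" by (auto simp: n'_def)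
    have rg: "2 * \<eta> * real n + K' \<le> real r * g"
    proof -
      have "(\<theta> * real n - 1) * g \<le> real r * g" using r g by (intro mult_right_mono) auto
      moreover have "(\<theta> * real n - 1) * g = 4 * \<eta> * real n - g" by (simp add: \<eta>_def algebra_simps)
      moreover have "K' + g \<le> 2 * \<eta> * real n" using elim(3) \<eta> by (simp add: field_simps)
      ultimately show ?thesis by linarith
    qed
    \<comment> \<open>The likely values of the sum of the first \<open>n'\<close> degrees. For each
      of them the rest \<open>N n - s\<close> lies in the window that \<open>r\<close> vertices can
      reach.\<close>
    define W where "W = {s. s \<le> degree (P ^ n') \<and> \<not> (\<bar>real s - real n' * \<mu>\<bar> > \<eta> * real n')}"
    have W: "s \<le> N n \<and> coeff (P ^ r) (N n - s) \<ge> c ^ r" if "s \<in> W" for s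
    proof -
      have "\<bar>real s - real n' * \<mu>\<bar> \<le> \<eta> * real n'" using that by (simp add: W_def)
      also have "\<dots> \<le> \<eta> * real n" using n' \<eta> by (intro mult_left_mono) auto
      finally have "\<bar>(real (N n) - real s) - real r * \<mu>\<bar> \<le> 2 * \<eta> * real n"
        using elim(1) unfolding n' by (simp add: algebra_simps abs_if split: if_splits)
      moreover have "real r * g \<le> real r * (\<mu> - a)" "real r * g \<le> real r * (b - \<mu>)"
        by (intro mult_left_mono; simp add: g_def)+
      ultimately have *: "real r * real a + K' \<le> real (N n) - real s" "real (N n) - real s + K' \<le> real r * real b"
        using rg by (auto simp: algebra_simps)
      have "K' \<ge> 0" by (simp add: K'_def)
      then have "0 \<le> real r * real a + K'" by simp
      with * have sN: "s \<le> N n" by linarith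
      then have "Q r (N n - s)" using * by (intro K') (auto simp: of_nat_diff)
      then show ?thesis using sN by (simp add: Q_def)
    qed
    have "(\<Sum>s\<le>degree (P ^ n'). coeff (P ^ n') s) = poly (P ^ n') 1" by (simp add: poly_altdef)
    also have "\<dots> = 1" using one by (simp add: poly_power)
    finally have tot: "(\<Sum>s\<le>degree (P ^ n'). coeff (P ^ n') s) = 1" .
    have "(\<Sum>s\<in>W. coeff (P ^ n') s) = 1 - (\<Sum>s | s \<le> degree (P ^ n') \<and> \<bar>real s - real n' * \<mu>\<bar> > \<eta> * real n'. coeff (P ^ n') s)"
    proof -
      have "(\<Sum>s\<le>degree (P ^ n'). coeff (P ^ n') s)
        = (\<Sum>s\<in>W. coeff (P ^ n') s) + (\<Sum>s | s \<le> degree (P ^ n') \<and> \<bar>real s - real n' * \<mu>\<bar> > \<eta> * real n'. coeff (P ^ n') s)"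
        by (subst sum.union_disjoint[symmetric]) (auto simp: W_def intro!: sum.cong)
      then show ?thesis using tot by simp
    qed
    then have "(\<Sum>s\<in>W. coeff (P ^ n') s) \<ge> 1 - 2 * exp (- c' * real n')" using tail[of n'] by simp
    moreover have "2 * exp (- c' * real n') \<le> 2 * exp (- (c' / 2) * real n)"
      using n' rn c' by (simp add: field_simps)
    ultimately have Wsum: "(\<Sum>s\<in>W. coeff (P ^ n') s) \<ge> 1 / 2" using elim(2) by linarith
    have "exp (- (\<epsilon> / 2) * real n) \<le> exp (real r * ln c)"
    proof -
      have "real r * (- ln c) \<le> \<theta> * real n * (- ln c)" using r lc by (intro mult_right_mono) auto
      also have "\<dots> = \<theta> * (- ln c) * real n" by simp
      also have "\<dots> \<le> \<epsilon> / 2 * real n" using \<theta> by (intro mult_right_mono) auto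
      finally show ?thesis by simp
    qed
    also have "\<dots> = c ^ r" using c0 by (simp add: exp_of_nat_mult)
    finally have cr: "exp (- (\<epsilon> / 2) * real n) \<le> c ^ r" .
    \<comment> \<open>One half of the exponent pays for the probability \<open>1 / 2\<close> of
      \<open>W\<close>, the other half for \<open>c ^ r\<close>.\<close>
    have "exp (- \<epsilon> * real n) = exp (- (\<epsilon> / 2) * real n) * exp (- (\<epsilon> / 2) * real n)"
      by (simp add: mult_exp_exp algebra_simps)
    also have "\<dots> \<le> 1 / 2 * c ^ r" using elim(4) cr by (intro mult_mono) auto
    also have "\<dots> \<le> (\<Sum>s\<in>W. coeff (P ^ n') s) * c ^ r" using Wsum c0 by (intro mult_right_mono) auto
    also have "\<dots> = (\<Sum>s\<in>W. coeff (P ^ n') s * c ^ r)" by (simp add: sum_distrib_right)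
    also have "\<dots> \<le> (\<Sum>s\<in>W. coeff (P ^ n') s * coeff (P ^ r) (N n - s))"
      using W by (intro sum_mono mult_left_mono coeff_power_nonneg nonneg) auto
    also have "\<dots> \<le> (\<Sum>s\<le>N n. coeff (P ^ n') s * coeff (P ^ r) (N n - s))"
      using W by (intro sum_mono2) (auto intro!: mult_nonneg_nonneg coeff_power_nonneg nonneg)
    also have "\<dots> = coeff (P ^ n) (N n)"
      unfolding n'(1) power_add coeff_mult ..
    finally show ?case .
  qed
qed

section \<open>Concentration of degree statistics\<close>

definition hdeg :: "'a set \<Rightarrow> ('a \<Rightarrow> 'v) \<Rightarrow> 'v \<Rightarrow> nat" where
  "hdeg A h v = card {a\<in>A. h a = v}"

text \<open>The factorials cancel the multinomial number of maps with given fibre sizes: summed over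
  all maps with degrees d_v, this weight is \<open>fact (card A)\<close> times the product of the
  probabilities \<open>coeff P\<close> at d_v.\<close>

definition hweight :: "real poly \<Rightarrow> 'a set \<Rightarrow> 'v set \<Rightarrow> ('a \<Rightarrow> 'v) \<Rightarrow> real" where
  "hweight P A V h = (\<Prod>v\<in>V. coeff P (hdeg A h v) * fact (hdeg A h v))"

definition wsum :: "real poly \<Rightarrow> 'a set \<Rightarrow> 'v set \<Rightarrow> (('a \<Rightarrow> 'v) \<Rightarrow> real) \<Rightarrow> real" where
  "wsum P A V X = (\<Sum>h\<in>A \<rightarrow>\<^sub>E V. hweight P A V h * X h)"

lemma hweight_nonneg:
  assumes "\<And>d. coeff P d \<ge> 0"
  shows "hweight P A V h \<ge> 0"
  unfolding hweight_def by (intro prod_nonneg) (simp add: assms)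

lemma wsum_mono:
  assumes "\<And>d. coeff P d \<ge> 0" "\<And>h. h \<in> A \<rightarrow>\<^sub>E V \<Longrightarrow> X h \<le> Y h"
  shows "wsum P A V X \<le> wsum P A V Y"
  unfolding wsum_def by (intro sum_mono mult_left_mono hweight_nonneg assms)

lemma wsum_add: "wsum P A V (\<lambda>h. X h + Y h) = wsum P A V X + wsum P A V Y"
  by (simp add: wsum_def distrib_left sum.distrib)

lemma wsum_cmult: "wsum P A V (\<lambda>h. c * X h) = c * wsum P A V X"
  by (simp add: wsum_def sum_distrib_left mult.left_commute)

lemma wsum_hdeg_prod:
  assumes "finite A" "finite V"
  shows "wsum P A V (\<lambda>h. \<Prod>v\<in>V. f (hdeg A h v)) = (\<Sum>h\<in>A \<rightarrow>\<^sub>E V. \<Prod>v\<in>V. coeff P (hdeg A h v) * fact (hdeg A h v) * f (hdeg A h v))"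
  by (simp add: wsum_def hweight_def prod.distrib[symmetric])

lemma sum_PiE_coeff:
  fixes R :: "real poly"
  assumes "finite A" "finite V"
  shows "(\<Sum>h\<in>A \<rightarrow>\<^sub>E V. \<Prod>v\<in>V. coeff R (hdeg A h v) * fact (hdeg A h v))
    = fact (card A) * coeff (R ^ card V) (card A)"
proof -
  have "Abs_fps (\<lambda>d. coeff R d * fact d / fact d) = fps_of_poly R"
    by (simp add: fps_of_poly_def)
  then show ?thesis
    using sum_PiE_degrees[OF assms(2,1), of "\<lambda>v d. coeff R d * fact d"]
    by (simp add: hdeg_def fps_of_poly_power[symmetric])
qed

lemma wsum_1:
  assumes "finite A" "finite V"
  shows "wsum P A V (\<lambda>_. 1) = fact (card A) * coeff (P ^ card V) (card A)"
  using sum_PiE_coeff[OF assms, of P] by (simp add: wsum_def hweight_def)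

text \<open>The exponential factors are absorbed in a new polynomial \<open>R\<close>. The
  conditioning on the degree sum selects one coefficient of a power of \<open>R\<close>, and it is
  given up by bounding this coefficient by the value at 1.\<close>

lemma wsum_exp_le:
  assumes fin: "finite A" "finite V" and nonneg: "\<And>d. coeff P d \<ge> 0"
  shows "wsum P A V (\<lambda>h. exp (t * (\<Sum>v\<in>V. \<phi> (hdeg A h v))))
    \<le> fact (card A) * mean P (\<lambda>d. exp (t * \<phi> d)) ^ card V"
proof -
  define R where "R = (\<Sum>d\<le>degree P. monom (coeff P d * exp (t * \<phi> d)) d)"
  have R: "coeff R d = coeff P d * exp (t * \<phi> d)" for d
    by (simp add: R_def coeff_sum coeff_monom sum.delta coeff_eq_0)
  have R1: "poly R 1 = mean P (\<lambda>d. exp (t * \<phi> d))"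
    by (simp add: R_def mean_def poly_sum poly_monom)
  have "wsum P A V (\<lambda>h. exp (t * (\<Sum>v\<in>V. \<phi> (hdeg A h v))))
    = wsum P A V (\<lambda>h. \<Prod>v\<in>V. exp (t * \<phi> (hdeg A h v)))"
    using fin by (simp add: sum_distrib_left exp_sum)
  also have "\<dots> = fact (card A) * coeff (R ^ card V) (card A)"
    unfolding sum_PiE_coeff[OF fin, symmetric] wsum_hdeg_prod[OF fin, of P "\<lambda>d. exp (t * \<phi> d)"]
    by (intro sum.cong prod.cong) (simp_all add: R)
  also have "\<dots> \<le> fact (card A) * poly (R ^ card V) 1"
    by (intro mult_left_mono coeff_le_poly_1 coeff_power_nonneg) (auto simp: R nonneg)
  finally show ?thesis by (simp add: poly_power R1)
qed

text \<open>For the conditioned law the exponential moments grow at most by the factor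
  \<open>exp (\<epsilon> * card V)\<close>, the inverse of the lower bound for the conditioning
  event. They are turned into a bound for the mean absolute deviation by
  \<open>y \<le> K + exp (y - K)\<close>.\<close>

lemma wsum_abs_deviation:
  assumes fin: "finite A" "finite V" "V \<noteq> {}"
    and nonneg: "\<And>d. coeff P d \<ge> 0" and one: "poly P 1 = 1"
    and B: "\<And>d. d \<le> degree P \<Longrightarrow> \<bar>\<phi> d\<bar> \<le> B" and t: "t > 0" "t * B \<le> 1"
    and lower: "coeff (P ^ card V) (card A) \<ge> exp (- \<epsilon> * real (card V))"
  shows "wsum P A V (\<lambda>h. \<bar>(\<Sum>v\<in>V. \<phi> (hdeg A h v)) / real (card V) - mean P \<phi>\<bar>)
    \<le> (t * B\<^sup>2 + \<epsilon> / t + 2 / (real (card V) * t)) * wsum P A V (\<lambda>_. 1)"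
proof -
  let ?n = "real (card V)" and ?Z = "wsum P A V (\<lambda>_. 1)"
  let ?S = "\<lambda>h. \<Sum>v\<in>V. \<phi> (hdeg A h v)"
  let ?x = "\<lambda>h. ?S h / ?n - mean P \<phi>"
  have n: "?n > 0" using fin by (simp add: card_gt_0_iff)
  \<comment> \<open>The logarithm of the bound for both exponential moments, relative to the total
    weight. With this \<open>K\<close> each of the two exponentials contributes at most 1
    below.\<close>
  define K where "K = ?n * (t\<^sup>2 * B\<^sup>2 + \<epsilon>)"
  have Z: "fact (card A) \<le> exp (\<epsilon> * ?n) * ?Z"
  proof -
    have "exp (\<epsilon> * ?n) * ?Z \<ge> exp (\<epsilon> * ?n) * (fact (card A) * exp (- \<epsilon> * ?n))"
      unfolding wsum_1[OF fin(1,2)] using lower by (intro mult_left_mono) auto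
    then show ?thesis by (simp add: exp_minus field_simps)
  qed
  have gen: "wsum P A V (\<lambda>h. exp (u * (?n * ?x h))) \<le> exp K * ?Z" if u: "\<bar>u\<bar> = t" for u
  proof -
    have "mean P (\<lambda>d. exp (u * \<phi> d)) ^ card V \<le> exp (u * mean P \<phi> + u\<^sup>2 * B\<^sup>2) ^ card V"
      using u t by (intro power_mono mgf_bound nonneg one B) (auto simp: mean_def intro!: sum_nonneg mult_nonneg_nonneg nonneg)
    also have "\<dots> = exp (u * ?n * mean P \<phi>) * exp (?n * (t\<^sup>2 * B\<^sup>2))"
    proof -
      have "u\<^sup>2 = t\<^sup>2" using u by (metis power2_abs)
      then show ?thesis by (simp add: exp_of_nat_mult[symmetric] mult_exp_exp algebra_simps)
    qed
    finally have M: "mean P (\<lambda>d. exp (u * \<phi> d)) ^ card V \<le> exp (u * ?n * mean P \<phi>) * exp (?n * (t\<^sup>2 * B\<^sup>2))" .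
    have "wsum P A V (\<lambda>h. exp (u * (?n * ?x h)))
      = exp (- (u * ?n * mean P \<phi>)) * wsum P A V (\<lambda>h. exp (u * ?S h))"
    proof -
      have "exp (u * (?n * ?x h)) = exp (- (u * ?n * mean P \<phi>)) * exp (u * ?S h)" for h
      proof -
        have "u * (?n * ?x h) = - (u * ?n * mean P \<phi>) + u * ?S h" using n by (simp add: right_diff_distrib)
        then show ?thesis by (simp only: exp_add)
      qed
      then show ?thesis by (simp only: wsum_cmult)
    qed
    also have "\<dots> \<le> exp (- (u * ?n * mean P \<phi>)) * (fact (card A) * mean P (\<lambda>d. exp (u * \<phi> d)) ^ card V)"
      by (intro mult_left_mono wsum_exp_le fin nonneg) auto
    also have "\<dots> \<le> exp (- (u * ?n * mean P \<phi>)) * (fact (card A) * (exp (u * ?n * mean P \<phi>) * exp (?n * (t\<^sup>2 * B\<^sup>2))))"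
      by (intro mult_left_mono M) auto
    also have "\<dots> = exp (?n * (t\<^sup>2 * B\<^sup>2)) * fact (card A)"
      by (simp add: exp_minus)
    also have "\<dots> \<le> exp (?n * (t\<^sup>2 * B\<^sup>2)) * (exp (\<epsilon> * ?n) * ?Z)"
      using Z by (intro mult_left_mono) auto
    also have "\<dots> = exp K * ?Z"
    proof -
      have "K = ?n * (t\<^sup>2 * B\<^sup>2) + \<epsilon> * ?n" by (simp add: K_def algebra_simps)
      then show ?thesis by (simp only: exp_add mult.assoc)
    qed
    finally show ?thesis .
  qed
  have "?n * t * wsum P A V (\<lambda>h. \<bar>?x h\<bar>) = wsum P A V (\<lambda>h. ?n * t * \<bar>?x h\<bar>)"
    by (simp add: wsum_cmult)
  also have "\<dots> \<le> wsum P A V (\<lambda>h. K * 1 + exp (- K) * (exp (t * (?n * ?x h)) + exp (- t * (?n * ?x h))))"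
  proof (intro wsum_mono nonneg)
    fix h
    let ?y = "?n * t * \<bar>?x h\<bar>"
    have "?y - K \<le> exp (?y - K)" using exp_ge_add_one_self[of "?y - K"] by linarith
    also have "\<dots> = exp (- K) * exp ?y" by (simp add: mult_exp_exp)
    finally have 1: "?y - K \<le> exp (- K) * exp ?y" .
    have "exp ?y \<le> exp (t * (?n * ?x h)) + exp (- t * (?n * ?x h))"
    proof (cases "?x h \<ge> 0")
      case True
      then have "?y = t * (?n * ?x h)" by simp
      then show ?thesis by (metis add_increasing2 exp_ge_zero order_refl)
    next
      case False
      then have "?y = - t * (?n * ?x h)" by (simp add: algebra_simps)
      then show ?thesis by (metis add_increasing exp_ge_zero order_refl)
    qed
    then have "exp (- K) * exp ?y \<le> exp (- K) * (exp (t * (?n * ?x h)) + exp (- t * (?n * ?x h)))"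
      by (rule mult_left_mono) simp
    with 1 show "?y \<le> K * 1 + exp (- K) * (exp (t * (?n * ?x h)) + exp (- t * (?n * ?x h)))" by linarith
  qed
  also have "\<dots> = K * ?Z + exp (- K) * (wsum P A V (\<lambda>h. exp (t * (?n * ?x h))) + wsum P A V (\<lambda>h. exp (- t * (?n * ?x h))))"
    by (simp only: wsum_add wsum_cmult)
  also have "\<dots> \<le> K * ?Z + exp (- K) * (exp K * ?Z + exp K * ?Z)"
    using t by (intro add_left_mono mult_left_mono add_mono gen) auto
  also have "\<dots> = K * ?Z + 2 * (exp (- K) * exp K) * ?Z" by (simp only: distrib_left mult_2 distrib_right mult.assoc)
  also have "\<dots> = (K + 2) * ?Z" by (simp add: exp_minus distrib_right)
  finally have "wsum P A V (\<lambda>h. \<bar>?x h\<bar>) \<le> (K + 2) * ?Z / (?n * t)"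
    using n t by (simp add: field_simps)
  also have "\<dots> = (t * B\<^sup>2 + \<epsilon> / t + 2 / (?n * t)) * ?Z"
    using n t by (simp add: K_def field_simps power2_eq_square)
  finally show ?thesis .
qed

section \<open>Multigraphs as maps on half-edges\<close>

definition halves :: "nat \<Rightarrow> (int \<times> bool) set" where
  "halves m = {1..int m} \<times> UNIV"

lemma finite_halves [simp]: "finite (halves m)"
  by (simp add: halves_def)

lemma card_halves [simp]: "card (halves m) = 2 * m"
  by (simp add: halves_def card_cartesian_product)

definition graph_of :: "nat \<Rightarrow> nat \<Rightarrow> (int \<times> bool \<Rightarrow> int) \<Rightarrow> multigraph" where
  "graph_of n m h = \<lparr>mverts = {1..int n}, medges = (\<lambda>e. (h (e, False), h (e, True), e)) ` {1..int m}\<rparr>"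

lemma edge_simps [simp]:
  "edge_source (a, b, e) = a" "edge_target (a, b, e) = b" "edge_label (a, b, e) = e"
  by (simp_all add: edge_source_def edge_target_def edge_label_def)

lemma edge_collapse: "(edge_source x, edge_target x, edge_label x) = x"
  by (simp add: edge_source_def edge_target_def edge_label_def)

lemma mdegree_graph_of: "mdegree (graph_of n m h) v = hdeg (halves m) h v"
proof -
  have *: "card {x \<in> medges (graph_of n m h). Q x} = card {e\<in>{1..int m}. Q (h (e, False), h (e, True), e)}" for Q
  proof -
    have "{x \<in> medges (graph_of n m h). Q x}
      = (\<lambda>e. (h (e, False), h (e, True), e)) ` {e\<in>{1..int m}. Q (h (e, False), h (e, True), e)}"
      by (auto simp: graph_of_def)
    then show ?thesis by (simp add: card_image inj_on_def)
  qed
  have "{a\<in>halves m. h a = v} = (\<lambda>e. (e, False)) ` {e\<in>{1..int m}. h (e, False) = v}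
     \<union> (\<lambda>e. (e, True)) ` {e\<in>{1..int m}. h (e, True) = v}" (is "?L = ?A \<union> ?B")
  proof (rule set_eqI)
    fix x :: "int \<times> bool"
    obtain e b where "x = (e, b)" by force
    then show "x \<in> ?L \<longleftrightarrow> x \<in> ?A \<union> ?B" by (cases b) (auto simp: halves_def)
  qed
  moreover have "card (?A \<union> ?B) = card ?A + card ?B"
    by (intro card_Un_disjoint finite_imageI finite_subset[of "{e\<in>{1..int m}. _ e}" "{1..int m}"]) auto
  ultimately have "hdeg (halves m) h v = card ?A + card ?B" by (simp only: hdeg_def)
  then show ?thesis
    by (simp add: mdegree_def * card_image inj_on_def)
qed

text \<open>An \<open>(n, m)\<close>-multigraph has exactly one edge for each label, so reading off
  the source and the target of that edge inverts \<open>graph_of\<close>.\<close>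

lemma bij_betw_graph_of:
  "bij_betw (graph_of n m) (halves m \<rightarrow>\<^sub>E {1..int n}) (nm_multigraphs n m)"
proof (rule bij_betw_imageI)
  show "inj_on (graph_of n m) (halves m \<rightarrow>\<^sub>E {1..int n})"
  proof (rule inj_onI)
    fix h h' assume h: "h \<in> halves m \<rightarrow>\<^sub>E {1..int n}" "h' \<in> halves m \<rightarrow>\<^sub>E {1..int n}"
      and eq: "graph_of n m h = graph_of n m h'"
    have "h (e, b) = h' (e, b)" if e: "e \<in> {1..int m}" for e b
    proof -
      have "(h (e, False), h (e, True), e) \<in> medges (graph_of n m h')"
        unfolding eq[symmetric] using e by (auto simp: graph_of_def)
      then show ?thesis by (cases b) (auto simp: graph_of_def)
    qed
    then show "h = h'" by (intro PiE_ext[OF h]) (auto simp: halves_def)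
  qed
  show "graph_of n m ` (halves m \<rightarrow>\<^sub>E {1..int n}) = nm_multigraphs n m"
  proof (intro equalityI subsetI)
    fix G assume "G \<in> graph_of n m ` (halves m \<rightarrow>\<^sub>E {1..int n})"
    then obtain h where G: "G = graph_of n m h" and h: "h \<in> halves m \<rightarrow>\<^sub>E {1..int n}" by auto
    have "h (e, b) \<in> {1..int n}" if "e \<in> {1..int m}" for e b
      using h that by (auto simp: halves_def PiE_def Pi_def)
    then show "G \<in> nm_multigraphs n m"
      unfolding G by (auto simp: nm_multigraphs_def wf_multigraph_def graph_of_def edge_ends_def inj_on_def image_image)
  next
    fix G assume G: "G \<in> nm_multigraphs n m"
    then have wf: "wf_multigraph G" and lab: "edge_label ` medges G = {1..int m}" and vs: "mverts G = {1..int n}"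
      by (auto simp: nm_multigraphs_def)
    define r where "r e = inv_into (medges G) edge_label e" for e
    have r: "r e \<in> medges G" "edge_label (r e) = e" if "e \<in> {1..int m}" for e
      using that lab unfolding r_def by (auto intro: inv_into_into f_inv_into_f)
    have rl: "r (edge_label x) = x" if "x \<in> medges G" for x
      using wf that by (simp add: r_def wf_multigraph_def)
    define h where "h = (\<lambda>(e, b). if e \<in> {1..int m} then (if b then edge_target (r e) else edge_source (r e)) else undefined)"
    have tr: "(h (e, False), h (e, True), e) = r e" if "e \<in> {1..int m}" for e
      using r[OF that] edge_collapse[of "r e"] that by (simp add: h_def)
    have "r ` {1..int m} = medges G"
      using r rl lab by (metis (no_types, lifting) image_cong image_ident image_image)
    moreover have "(\<lambda>e. (h (e, False), h (e, True), e)) ` {1..int m} = r ` {1..int m}"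
      by (intro image_cong refl tr)
    ultimately have "medges (graph_of n m h) = medges G" by (simp add: graph_of_def)
    then have "graph_of n m h = G" using vs by (simp add: graph_of_def)
    moreover have "h \<in> halves m \<rightarrow>\<^sub>E {1..int n}"
    proof -
      have "edge_source (r e) \<in> {1..int n}" "edge_target (r e) \<in> {1..int n}" if "e \<in> {1..int m}" for e
        using r(1)[OF that] wf vs by (auto simp: wf_multigraph_def edge_ends_def)
      then show ?thesis by (auto simp: h_def halves_def PiE_def extensional_def)
    qed
    ultimately show "G \<in> graph_of n m ` (halves m \<rightarrow>\<^sub>E {1..int n})" by blast
  qed
qed

lemma finite_nm_multigraphs: "finite (nm_multigraphs n m)"
  using bij_betw_finite[OF bij_betw_graph_of[of n m]] by (simp add: finite_PiE)

section \<open>Half-edges and embeddings\<close>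

text \<open>Positive total weight is what makes the normalised weights sum to 1, so that
  \<open>embed_pmf\<close> has them as its mass function.\<close>

lemma expectation_random_multigraph:
  fixes X :: "multigraph \<Rightarrow> real"
  assumes nonneg: "\<And>d. \<delta> d \<ge> 0" and pos: "(\<Sum>G\<in>nm_multigraphs n m. weight \<delta> G) > 0"
  shows "measure_pmf.expectation (random_multigraph \<delta> n m) X
    = (\<Sum>G\<in>nm_multigraphs n m. weight \<delta> G * X G) / (\<Sum>G\<in>nm_multigraphs n m. weight \<delta> G)"
proof -
  let ?S = "\<Sum>G\<in>nm_multigraphs n m. weight \<delta> G"
  define f where "f G = (if G \<in> nm_multigraphs n m then weight \<delta> G / ?S else 0)" for G
  have w: "weight \<delta> G \<ge> 0" for G unfolding weight_def by (intro prod_nonneg) (simp add: nonneg)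
  have f0: "f G \<ge> 0" for G using w pos by (simp add: f_def)
  have "(\<integral>\<^sup>+ G. ennreal (f G) \<partial>count_space UNIV) = (\<Sum>G\<in>nm_multigraphs n m. ennreal (f G))"
    by (intro nn_integral_count_space') (auto simp: f_def finite_nm_multigraphs)
  also have "\<dots> = ennreal (\<Sum>G\<in>nm_multigraphs n m. f G)"
    by (intro sum_ennreal f0)
  also have "(\<Sum>G\<in>nm_multigraphs n m. f G) = 1"
    using pos by (simp add: f_def sum_divide_distrib[symmetric])
  finally have f1: "(\<integral>\<^sup>+ G. ennreal (f G) \<partial>count_space UNIV) = 1" by simp
  have rm: "random_multigraph \<delta> n m = embed_pmf f"
    unfolding random_multigraph_def f_def ..
  have pmf: "pmf (random_multigraph \<delta> n m) G = f G" for G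
    unfolding rm by (rule pmf_embed_pmf[OF f0 f1])
  have "measure_pmf.expectation (random_multigraph \<delta> n m) X
    = (\<Sum>G\<in>nm_multigraphs n m. X G * pmf (random_multigraph \<delta> n m) G)"
    by (intro integral_measure_pmf_real finite_nm_multigraphs)
      (metis f_def pmf set_pmf_iff)
  also have "\<dots> = (\<Sum>G\<in>nm_multigraphs n m. weight \<delta> G * X G) / ?S"
    unfolding sum_divide_distrib by (intro sum.cong) (simp_all add: pmf f_def)
  finally show ?thesis .
qed

lemma sum_hdeg:
  assumes "finite A" "finite V" "h \<in> A \<rightarrow>\<^sub>E V"
  shows "(\<Sum>v\<in>V. hdeg A h v) = card A"
proof -
  have "(\<Sum>v\<in>V. \<Sum>a\<in>{a\<in>A. h a = v}. 1) = (\<Sum>a\<in>A. 1::nat)"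
    using assms by (intro sum.group) auto
  then show ?thesis by (simp add: hdeg_def)
qed

lemma expectation_eq_wsum:
  fixes X :: "multigraph \<Rightarrow> real"
  assumes nonneg: "\<And>d. \<delta> d \<ge> 0" and c: "chi > 0" "D > 0"
    and P: "\<And>d. coeff P d * fact d = \<delta> d * chi ^ d / D"
    and pos: "wsum P (halves m) {1..int n} (\<lambda>_. 1) > 0"
  shows "measure_pmf.expectation (random_multigraph \<delta> n m) X
    = wsum P (halves m) {1..int n} (\<lambda>h. X (graph_of n m h)) / wsum P (halves m) {1..int n} (\<lambda>_. 1)"
proof -
  \<comment> \<open>The degrees of every \<open>(n, m)\<close>-multigraph sum to
    \<open>2 * m\<close>, so the factors \<open>chi ^ d / D\<close> change all weights by this one
    constant, which cancels in the quotient.\<close>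
  define \<kappa> where "\<kappa> = chi ^ (2 * m) / D ^ n"
  have \<kappa>: "\<kappa> > 0" using c by (simp add: \<kappa>_def)
  have eq: "wsum P (halves m) {1..int n} (\<lambda>h. Y (graph_of n m h)) = \<kappa> * (\<Sum>G\<in>nm_multigraphs n m. weight \<delta> G * Y G)" for Y
  proof -
    have "(\<Sum>G\<in>nm_multigraphs n m. weight \<delta> G * Y G)
      = (\<Sum>h\<in>halves m \<rightarrow>\<^sub>E {1..int n}. weight \<delta> (graph_of n m h) * Y (graph_of n m h))"
      by (rule sum.reindex_bij_betw[OF bij_betw_graph_of, symmetric])
    also have "\<kappa> * \<dots> = wsum P (halves m) {1..int n} (\<lambda>h. Y (graph_of n m h))"
      unfolding wsum_def sum_distrib_left
    proof (intro sum.cong refl)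
      fix h assume h: "h \<in> halves m \<rightarrow>\<^sub>E {1..int n}"
      have "hweight P (halves m) {1..int n} h
        = (\<Prod>v\<in>{1..int n}. \<delta> (hdeg (halves m) h v)) * (\<Prod>v\<in>{1..int n}. chi ^ hdeg (halves m) h v) / (\<Prod>v\<in>{1..int n}. D)"
        unfolding hweight_def P by (simp only: prod.distrib prod_dividef)
      also have "(\<Prod>v\<in>{1..int n}. chi ^ hdeg (halves m) h v) = chi ^ (2 * m)"
        using sum_hdeg[OF _ _ h] by (simp add: power_sum[symmetric])
      finally have "hweight P (halves m) {1..int n} h = \<kappa> * weight \<delta> (graph_of n m h)"
        by (simp add: \<kappa>_def weight_def mdegree_graph_of) (simp add: graph_of_def)
      then show "\<kappa> * (weight \<delta> (graph_of n m h) * Y (graph_of n m h))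
        = hweight P (halves m) {1..int n} h * Y (graph_of n m h)" by simp
    qed
    finally show ?thesis by simp
  qed
  have 1: "wsum P (halves m) {1..int n} (\<lambda>_. 1) = \<kappa> * (\<Sum>G\<in>nm_multigraphs n m. weight \<delta> G)"
    using eq[of "\<lambda>_. 1"] by simp
  have "(\<Sum>G\<in>nm_multigraphs n m. weight \<delta> G) > 0"
    using pos \<kappa> unfolding 1 by (simp add: zero_less_mult_iff)
  from expectation_random_multigraph[OF nonneg this] show ?thesis
    unfolding eq 1 using \<kappa> by simp
qed

text \<open>A dart is an edge with a direction of traversal; \<open>True\<close> means against its
  orientation.\<close>

definition dart_tail :: "edge \<times> bool \<Rightarrow> int" where
  "dart_tail d = (if snd d then edge_target (fst d) else edge_source (fst d))"

definition dart_head :: "edge \<times> bool \<Rightarrow> int" where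
  "dart_head d = (if snd d then edge_source (fst d) else edge_target (fst d))"

text \<open>
  Embeddings of a pattern that record the orientation in which each edge is used, so that
  every loop of the pattern contributes a factor 2.
\<close>

definition embeddings ::
  "'v set \<Rightarrow> 'e set \<Rightarrow> ('e \<Rightarrow> 'v) \<Rightarrow> ('e \<Rightarrow> 'v) \<Rightarrow> multigraph \<Rightarrow> (('v \<Rightarrow> int) \<times> ('e \<Rightarrow> edge \<times> bool)) set" where
  "embeddings V E s t G = {(f, g). f \<in> V \<rightarrow>\<^sub>E mverts G \<and> inj_on f V \<and>
     g \<in> E \<rightarrow>\<^sub>E medges G \<times> UNIV \<and> inj_on (\<lambda>e. fst (g e)) E \<and>
     (\<forall>e\<in>E. dart_tail (g e) = f (s e) \<and> dart_head (g e) = f (t e))}"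

definition pattern_end :: "('e \<Rightarrow> 'v) \<Rightarrow> ('e \<Rightarrow> 'v) \<Rightarrow> 'e \<times> bool \<Rightarrow> 'v" where
  "pattern_end s t z = (if snd z then t (fst z) else s (fst z))"

definition pattern_degree :: "'e set \<Rightarrow> ('e \<Rightarrow> 'v) \<Rightarrow> ('e \<Rightarrow> 'v) \<Rightarrow> 'v \<Rightarrow> nat" where
  "pattern_degree E s t v = card {z\<in>E \<times> UNIV. pattern_end s t z = v}"

definition dart_choices :: "'e set \<Rightarrow> nat \<Rightarrow> ('e \<Rightarrow> int \<times> bool) set" where
  "dart_choices E m = {k \<in> E \<rightarrow>\<^sub>E halves m. inj_on (\<lambda>e. fst (k e)) E}"

text \<open>The half-edge taken by an end of a pattern edge. A dart with label \<open>l\<close> and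
  bit \<open>b\<close> starts at the half-edge \<open>(l, b)\<close> and ends at
  \<open>(l, \<not> b)\<close>, hence the exclusive or.\<close>

definition half_map :: "('e \<Rightarrow> int \<times> bool) \<Rightarrow> 'e \<times> bool \<Rightarrow> int \<times> bool" where
  "half_map k z = (fst (k (fst z)), snd (k (fst z)) \<noteq> snd z)"

lemma card_dart_choices:
  assumes "finite E"
  shows "card (dart_choices E m) = ffac m (card E) * 2 ^ card E"
proof -
  let ?L = "{l \<in> E \<rightarrow>\<^sub>E {1..int m}. inj_on l E}" and ?O = "E \<rightarrow>\<^sub>E (UNIV :: bool set)"
  have "bij_betw (\<lambda>(l, b). \<lambda>e\<in>E. (l e, b e)) (?L \<times> ?O) (dart_choices E m)"
  proof (rule bij_betw_byWitness[where f' = "\<lambda>k. (\<lambda>e\<in>E. fst (k e), \<lambda>e\<in>E. snd (k e))"])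
    show "\<forall>a\<in>?L \<times> ?O. (\<lambda>k. (\<lambda>e\<in>E. fst (k e), \<lambda>e\<in>E. snd (k e))) ((\<lambda>(l, b). \<lambda>e\<in>E. (l e, b e)) a) = a"
      by (auto intro!: extensionalityI[where A = E] simp: PiE_def)
    show "\<forall>a'\<in>dart_choices E m. (\<lambda>(l, b). \<lambda>e\<in>E. (l e, b e)) (\<lambda>e\<in>E. fst (a' e), \<lambda>e\<in>E. snd (a' e)) = a'"
      by (auto intro!: extensionalityI[where A = E] simp: PiE_def dart_choices_def)
    show "(\<lambda>(l, b). \<lambda>e\<in>E. (l e, b e)) ` (?L \<times> ?O) \<subseteq> dart_choices E m"
      by (auto simp: dart_choices_def halves_def PiE_def Pi_def inj_on_def)
    show "(\<lambda>k. (\<lambda>e\<in>E. fst (k e), \<lambda>e\<in>E. snd (k e))) ` dart_choices E m \<subseteq> ?L \<times> ?O"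
      by (auto simp: dart_choices_def halves_def PiE_def Pi_def inj_on_def mem_Times_iff)
  qed
  from bij_betw_same_card[OF this] have "card (dart_choices E m) = card ?L * card ?O"
    by (simp add: card_cartesian_product)
  also have "card ?L = ffac m (card E)"
    using card_inj_funcset[OF assms, of "{1..int m}"] by simp
  also have "card ?O = 2 ^ card E"
    using assms by (simp add: card_PiE)
  finally show ?thesis .
qed

text \<open>Edges are addressed by their labels, so both sums range over sets that do not depend on
  \<open>h\<close>. The random map only enters through the event that it has prescribed values at
  the half-edges used.\<close>

lemma card_embeddings_graph_of:
  assumes fin: "finite V" "finite E"
  shows "real (card (embeddings V E s t (graph_of n m h)))
    = (\<Sum>f\<in>{f \<in> V \<rightarrow>\<^sub>E {1..int n}. inj_on f V}. \<Sum>k\<in>dart_choices E m.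
        if \<forall>z\<in>E \<times> UNIV. h (half_map k z) = f (pattern_end s t z) then 1 else 0)"
proof -
  let ?F = "{f \<in> V \<rightarrow>\<^sub>E {1..int n}. inj_on f V}"
  let ?c = "\<lambda>f k. \<forall>z\<in>E \<times> UNIV. h (half_map k z) = f (pattern_end s t z)"
  define D where "D x = ((h (fst x, False), h (fst x, True), fst x), snd x)" for x :: "int \<times> bool"
  have Dt: "dart_tail (D x) = h x" "dart_head (D x) = h (fst x, \<not> snd x)" for x
    by (cases x; simp add: dart_tail_def dart_head_def D_def)+
  have finF: "finite ?F" using fin by (simp add: finite_PiE)
  have finK: "finite (dart_choices E m)" using fin by (simp add: dart_choices_def finite_PiE)
  have c: "?c f k \<longleftrightarrow> (\<forall>e\<in>E. dart_tail (D (k e)) = f (s e) \<and> dart_head (D (k e)) = f (t e))" for f k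
  proof
    assume *: "?c f k"
    show "\<forall>e\<in>E. dart_tail (D (k e)) = f (s e) \<and> dart_head (D (k e)) = f (t e)"
    proof
      fix e assume "e \<in> E"
      then show "dart_tail (D (k e)) = f (s e) \<and> dart_head (D (k e)) = f (t e)"
        using *[rule_format, of "(e, False)"] *[rule_format, of "(e, True)"]
        by (simp add: half_map_def pattern_end_def Dt)
    qed
  next
    assume *: "\<forall>e\<in>E. dart_tail (D (k e)) = f (s e) \<and> dart_head (D (k e)) = f (t e)"
    show "?c f k"
    proof
      fix z :: "_ \<times> bool" assume z: "z \<in> E \<times> UNIV"
      obtain e b where "z = (e, b)" by force
      then show "h (half_map k z) = f (pattern_end s t z)"
        using * z by (cases b) (auto simp: half_map_def pattern_end_def Dt)
    qed
  qed
  have "bij_betw (\<lambda>(f, k). (f, \<lambda>e\<in>E. D (k e))) (SIGMA f:?F. {k\<in>dart_choices E m. ?c f k})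
    (embeddings V E s t (graph_of n m h))"
  proof (rule bij_betw_byWitness[where f' = "\<lambda>(f, g). (f, \<lambda>e\<in>E. (edge_label (fst (g e)), snd (g e)))"])
    show "\<forall>a\<in>SIGMA f:?F. {k\<in>dart_choices E m. ?c f k}.
      (\<lambda>(f, g). (f, \<lambda>e\<in>E. (edge_label (fst (g e)), snd (g e)))) ((\<lambda>(f, k). (f, \<lambda>e\<in>E. D (k e))) a) = a"
      by (auto intro!: extensionalityI[where A = E] simp: dart_choices_def PiE_def D_def)
    have DD: "D (edge_label (fst x), snd x) = x" if "x \<in> medges (graph_of n m h) \<times> UNIV" for x
      using that by (cases x) (auto simp: D_def graph_of_def)
    show "\<forall>a'\<in>embeddings V E s t (graph_of n m h).
      (\<lambda>(f, k). (f, \<lambda>e\<in>E. D (k e))) ((\<lambda>(f, g). (f, \<lambda>e\<in>E. (edge_label (fst (g e)), snd (g e)))) a') = a'"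
    proof
      fix a assume a: "a \<in> embeddings V E s t (graph_of n m h)"
      obtain f g where fg: "a = (f, g)" by force
      have g: "g \<in> E \<rightarrow>\<^sub>E medges (graph_of n m h) \<times> UNIV" using a by (simp add: fg embeddings_def)
      have "(\<lambda>e\<in>E. D ((\<lambda>e\<in>E. (edge_label (fst (g e)), snd (g e))) e)) = g"
      proof (rule extensionalityI[where A = E])
        show "g \<in> extensional E" using g by (simp add: PiE_def)
        fix e assume e: "e \<in> E"
        then show "(\<lambda>e\<in>E. D ((\<lambda>e\<in>E. (edge_label (fst (g e)), snd (g e))) e)) e = g e"
          using DD[OF PiE_mem[OF g e]] by simp
      qed simp
      then show "(\<lambda>(f, k). (f, \<lambda>e\<in>E. D (k e))) ((\<lambda>(f, g). (f, \<lambda>e\<in>E. (edge_label (fst (g e)), snd (g e)))) a) = a"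
        by (simp add: fg)
    qed
    have Dm: "fst (D x) \<in> medges (graph_of n m h)" if "x \<in> halves m" for x
      using that by (auto simp: D_def graph_of_def halves_def)
    have Dl: "fst (D x) = fst (D y) \<longleftrightarrow> fst x = fst y" for x y by (auto simp: D_def)
    show "(\<lambda>(f, k). (f, \<lambda>e\<in>E. D (k e))) ` (SIGMA f:?F. {k\<in>dart_choices E m. ?c f k})
      \<subseteq> embeddings V E s t (graph_of n m h)"
    proof
      fix x assume x: "x \<in> (\<lambda>(f, k). (f, \<lambda>e\<in>E. D (k e))) ` (SIGMA f:?F. {k\<in>dart_choices E m. ?c f k})"
      then obtain f k where 1: "f \<in> ?F" "k \<in> dart_choices E m" "?c f k"
        and xe: "x = (f, \<lambda>e\<in>E. D (k e))" by fast
      then have k: "k \<in> E \<rightarrow>\<^sub>E halves m" "inj_on (\<lambda>e. fst (k e)) E" by (auto simp: dart_choices_def)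
      have "inj_on (\<lambda>e. fst ((\<lambda>e\<in>E. D (k e)) e)) E"
        using k(2) by (simp add: inj_on_def Dl)
      moreover have "(\<lambda>e\<in>E. D (k e)) \<in> E \<rightarrow>\<^sub>E medges (graph_of n m h) \<times> UNIV"
        by (intro restrict_PiE_iff[THEN iffD2] ballI mem_Times_iff[THEN iffD2] conjI Dm PiE_mem[OF k(1)]) auto
      moreover have "f \<in> V \<rightarrow>\<^sub>E mverts (graph_of n m h)" "inj_on f V"
        using 1 by (auto simp: graph_of_def)
      moreover have "\<forall>e\<in>E. dart_tail (D (k e)) = f (s e) \<and> dart_head (D (k e)) = f (t e)"
        by (rule iffD1[OF c 1(3)])
      ultimately show "x \<in> embeddings V E s t (graph_of n m h)"
        unfolding xe embeddings_def by simp
    qed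
    show "(\<lambda>(f, g). (f, \<lambda>e\<in>E. (edge_label (fst (g e)), snd (g e)))) ` embeddings V E s t (graph_of n m h)
      \<subseteq> (SIGMA f:?F. {k\<in>dart_choices E m. ?c f k})"
    proof
      fix x assume "x \<in> (\<lambda>(f, g). (f, \<lambda>e\<in>E. (edge_label (fst (g e)), snd (g e)))) ` embeddings V E s t (graph_of n m h)"
      then obtain f g where 1: "(f, g) \<in> embeddings V E s t (graph_of n m h)"
        and xe: "x = (f, \<lambda>e\<in>E. (edge_label (fst (g e)), snd (g e)))" by fast
      let ?k = "\<lambda>e\<in>E. (edge_label (fst (g e)), snd (g e))"
      have g: "g e \<in> medges (graph_of n m h) \<times> UNIV" if "e \<in> E" for e
        using 1 that by (auto simp: embeddings_def)
      have Dg: "D (?k e) = g e" if "e \<in> E" for e using DD[OF g[OF that]] that by simp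
      have "?c f ?k"
      proof (rule iffD2[OF c], rule ballI)
        fix e assume e: "e \<in> E"
        have "dart_tail (g e) = f (s e) \<and> dart_head (g e) = f (t e)"
          using 1 e by (simp add: embeddings_def)
        then show "dart_tail (D (?k e)) = f (s e) \<and> dart_head (D (?k e)) = f (t e)"
          unfolding Dg[OF e] .
      qed
      moreover have "?k \<in> dart_choices E m"
      proof -
        have inj: "inj_on (\<lambda>e. fst (g e)) E" using 1 by (simp add: embeddings_def)
        have "inj_on (\<lambda>e. fst (?k e)) E"
        proof (rule inj_onI)
          fix e e' assume e: "e \<in> E" "e' \<in> E" and "fst (?k e) = fst (?k e')"
          then have "fst (D (?k e)) = fst (D (?k e'))" by (simp only: Dl)
          then have "fst (g e) = fst (g e')" unfolding Dg[OF e(1)] Dg[OF e(2)] .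
          with inj e show "e = e'" by (auto dest: inj_onD)
        qed
        moreover have "edge_label (fst (g e)) \<in> {1..int m}" if "e \<in> E" for e
          using g[OF that] by (auto simp: graph_of_def)
        ultimately show ?thesis by (auto simp: dart_choices_def halves_def)
      qed
      moreover have "f \<in> ?F" using 1 by (simp add: embeddings_def) (simp add: graph_of_def)
      ultimately show "x \<in> (SIGMA f:?F. {k\<in>dart_choices E m. ?c f k})" unfolding xe by blast
    qed
  qed
  then have "card (embeddings V E s t (graph_of n m h)) = card (SIGMA f:?F. {k\<in>dart_choices E m. ?c f k})"
    by (simp add: bij_betw_same_card)
  also have "\<dots> = (\<Sum>f\<in>?F. card {k\<in>dart_choices E m. ?c f k})"
    using finF finK by (intro card_SigmaI) auto
  finally show ?thesis
    using finK by (simp add: sum.If_cases Int_def)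
qed

lemma wsum_prescribed:
  assumes fin: "finite A" "finite V" "finite B" and \<iota>: "inj_on \<iota> B" "\<iota> ` B \<subseteq> A" and y: "y ` B \<subseteq> V"
  shows "real (ffac (card A) (card B)) * wsum P A V (\<lambda>h. if \<forall>z\<in>B. h (\<iota> z) = y z then 1 else 0)
    = wsum P A V (\<lambda>h. \<Prod>v\<in>V. real (ffac (hdeg A h v) (card {z\<in>B. y z = v})))"
proof -
  have "wsum P A V (\<lambda>h. if \<forall>z\<in>B. h (\<iota> z) = y z then 1 else 0)
    = (\<Sum>h\<in>{h \<in> A \<rightarrow>\<^sub>E V. \<forall>z\<in>B. h (\<iota> z) = y z}. hweight P A V h)"
    unfolding wsum_def using fin
    by (subst sum.inter_filter) (auto intro!: sum.cong simp: finite_PiE)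
  then show ?thesis
    using sum_PiE_prescribed[OF fin(2,1,3) \<iota> y, of "\<lambda>v d. coeff P d * fact d"]
    by (simp add: wsum_def hweight_def hdeg_def prod.distrib)
qed

lemma wsum_sum: "wsum P A V (\<lambda>h. \<Sum>i\<in>I. X i h) = (\<Sum>i\<in>I. wsum P A V (X i))"
  unfolding wsum_def sum_distrib_left by (rule sum.swap)

lemma wsum_cong:
  assumes "\<And>h. h \<in> A \<rightarrow>\<^sub>E V \<Longrightarrow> hweight P A V h \<noteq> 0 \<Longrightarrow> X h = Y h"
  shows "wsum P A V X = wsum P A V Y"
  unfolding wsum_def by (intro sum.cong refl) (metis assms mult_zero_left)

text \<open>A vertex map and a dart choice prescribe \<open>h\<close> at \<open>2 * card E\<close>
  distinct half-edges. By exchangeability the weight of this event does not depend on the dart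
  choice, so the dart choices contribute only their number.\<close>

lemma wsum_card_embeddings:
  assumes fin: "finite V" "finite E" and ends: "s ` E \<subseteq> V" "t ` E \<subseteq> V"
  shows "real (ffac (2 * m) (2 * card E)) *
      wsum P (halves m) {1..int n} (\<lambda>h. real (card (embeddings V E s t (graph_of n m h))))
    = real (ffac m (card E) * 2 ^ card E) *
      wsum P (halves m) {1..int n} (\<lambda>h. \<Sum>f\<in>{f \<in> V \<rightarrow>\<^sub>E {1..int n}. inj_on f V}.
        \<Prod>u\<in>V. real (ffac (hdeg (halves m) h (f u)) (pattern_degree E s t u)))"
proof -
  let ?F = "{f \<in> V \<rightarrow>\<^sub>E {1..int n}. inj_on f V}" and ?B = "E \<times> (UNIV :: bool set)"
  let ?w = "wsum P (halves m) {1..int n}"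
  let ?\<Pi> = "\<lambda>f h. \<Prod>u\<in>V. real (ffac (hdeg (halves m) h (f u)) (pattern_degree E s t u))"
  have cB: "card ?B = 2 * card E" by (simp add: card_cartesian_product)
  have finB: "finite ?B" using fin by simp
  have one: "real (ffac (2 * m) (2 * card E)) *
      ?w (\<lambda>h. if \<forall>z\<in>?B. h (half_map k z) = f (pattern_end s t z) then 1 else 0) = ?w (?\<Pi> f)"
    if f: "f \<in> ?F" and k: "k \<in> dart_choices E m" for f k
  proof -
    have kE: "k e \<in> halves m" if "e \<in> E" for e using k that by (auto simp: dart_choices_def)
    have inj: "inj_on (half_map k) ?B"
    proof (rule inj_onI)
      fix z z' assume z: "z \<in> ?B" "z' \<in> ?B" "half_map k z = half_map k z'"
      then have "fst (k (fst z)) = fst (k (fst z'))" by (simp add: half_map_def)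
      then have "fst z = fst z'" using k z by (auto simp: dart_choices_def dest: inj_onD)
      then show "z = z'" using z(3) by (auto simp: half_map_def prod_eq_iff)
    qed
    have img: "half_map k ` ?B \<subseteq> halves m"
      using kE by (force simp: half_map_def halves_def)
    have pe: "pattern_end s t ` ?B \<subseteq> V" using ends by (auto simp: pattern_end_def)
    have fV: "f ` V \<subseteq> {1..int n}" and fi: "inj_on f V" using f by auto
    have y: "(\<lambda>z. f (pattern_end s t z)) ` ?B \<subseteq> {1..int n}" using pe fV by blast
    have "(\<Prod>v\<in>{1..int n}. real (ffac (hdeg (halves m) h v) (card {z\<in>?B. f (pattern_end s t z) = v}))) = ?\<Pi> f h" for h
    proof -
      have "(\<Prod>v\<in>{1..int n}. real (ffac (hdeg (halves m) h v) (card {z\<in>?B. f (pattern_end s t z) = v})))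
        = (\<Prod>v\<in>f ` V. real (ffac (hdeg (halves m) h v) (card {z\<in>?B. f (pattern_end s t z) = v})))"
      proof (intro prod.mono_neutral_right fV ballI)
        fix v assume "v \<in> {1..int n} - f ` V"
        then have "{z\<in>?B. f (pattern_end s t z) = v} = {}" using pe by blast
        then show "real (ffac (hdeg (halves m) h v) (card {z\<in>?B. f (pattern_end s t z) = v})) = 1"
          by (simp only: card.empty ffac_0 of_nat_1)
      qed simp
      also have "\<dots> = (\<Prod>u\<in>V. real (ffac (hdeg (halves m) h (f u)) (card {z\<in>?B. f (pattern_end s t z) = f u})))"
        by (simp add: prod.reindex[OF fi])
      also have "\<dots> = ?\<Pi> f h"
      proof (intro prod.cong refl)
        fix u assume u: "u \<in> V"
        have "{z\<in>?B. f (pattern_end s t z) = f u} = {z\<in>?B. pattern_end s t z = u}"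
          using u pe fi by (auto dest: inj_onD)
        then show "real (ffac (hdeg (halves m) h (f u)) (card {z\<in>?B. f (pattern_end s t z) = f u}))
          = real (ffac (hdeg (halves m) h (f u)) (pattern_degree E s t u))"
          by (simp add: pattern_degree_def)
      qed
      finally show ?thesis .
    qed
    then show ?thesis
      using wsum_prescribed[OF finite_halves finite_atLeastAtMost_int finB inj img y, of P]
      unfolding cB card_halves by simp
  qed
  have "real (ffac (2 * m) (2 * card E)) * ?w (\<lambda>h. real (card (embeddings V E s t (graph_of n m h))))
    = (\<Sum>f\<in>?F. \<Sum>k\<in>dart_choices E m. real (ffac (2 * m) (2 * card E)) *
        ?w (\<lambda>h. if \<forall>z\<in>?B. h (half_map k z) = f (pattern_end s t z) then 1 else 0))"
    unfolding card_embeddings_graph_of[OF fin] wsum_sum sum_distrib_left ..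
  also have "\<dots> = (\<Sum>f\<in>?F. \<Sum>k\<in>dart_choices E m. ?w (?\<Pi> f))"
    by (intro sum.cong refl one)
  also have "\<dots> = real (card (dart_choices E m)) * ?w (\<lambda>h. \<Sum>f\<in>?F. ?\<Pi> f h)"
    by (simp add: wsum_sum sum_distrib_left)
  finally show ?thesis by (simp add: card_dart_choices[OF fin(2)])
qed

lemma ffac_ratio_tendsto_1: "(\<lambda>n. real (ffac n k) / real n ^ k) \<longlonglongrightarrow> 1"
proof (induction k)
  case 0
  then show ?case by simp
next
  case (Suc k)
  have "eventually (\<lambda>n. 1 - real k / real n = real (n - k) / real n) sequentially"
    using eventually_gt_at_top[of k] by eventually_elim (simp add: of_nat_diff field_simps)
  moreover have "(\<lambda>n. 1 - real k / real n) \<longlonglongrightarrow> 1 - 0"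
    by (intro tendsto_intros lim_const_over_n)
  ultimately have "(\<lambda>n. real (n - k) / real n) \<longlonglongrightarrow> 1"
    by (simp add: tendsto_cong)
  from tendsto_mult[OF Suc this] show ?case
    by (simp add: ffac_Suc mult.commute)
qed

text \<open>
  \<open>P\<close> is a probability generating function, and the event on which the degrees are conditioned
  is not exponentially unlikely.
\<close>

definition admissible :: "real poly \<Rightarrow> (nat \<Rightarrow> nat) \<Rightarrow> bool" where
  "admissible P m \<longleftrightarrow> (\<forall>d. coeff P d \<ge> 0) \<and> poly P 1 = 1 \<and> filterlim m at_top sequentially \<and>
     (\<forall>\<epsilon>>0. eventually (\<lambda>n. coeff (P ^ n) (2 * m n) \<ge> exp (- \<epsilon> * real n)) sequentially)"

text \<open>The expectation over the random half-edge map; for the tilted law it is the expectation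
  over the random multigraph. It is 0 by division by zero where the total weight vanishes.\<close>

definition hexp :: "real poly \<Rightarrow> (nat \<Rightarrow> nat) \<Rightarrow> nat \<Rightarrow> ((int \<times> bool \<Rightarrow> int) \<Rightarrow> real) \<Rightarrow> real" where
  "hexp P m n X = wsum P (halves (m n)) {1..int n} X / wsum P (halves (m n)) {1..int n} (\<lambda>_. 1)"

lemma admissible_wsum_pos:
  assumes "admissible P m"
  shows "eventually (\<lambda>n. wsum P (halves (m n)) {1..int n} (\<lambda>_. 1) > 0) sequentially"
proof -
  have "eventually (\<lambda>n. coeff (P ^ n) (2 * m n) \<ge> exp (- 1 * real n)) sequentially"
    using assms unfolding admissible_def by (meson zero_less_one)
  then show ?thesis
  proof eventually_elim
    case (elim n)
    then have "coeff (P ^ n) (2 * m n) > 0" using exp_gt_zero[of "- 1 * real n"] by linarith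
    then show ?case by (simp add: wsum_1)
  qed
qed

lemma hexp_mono:
  assumes "admissible P m" "\<And>h. h \<in> halves (m n) \<rightarrow>\<^sub>E {1..int n} \<Longrightarrow> X h \<le> Y h"
  shows "hexp P m n X \<le> hexp P m n Y"
  unfolding hexp_def using assms
  by (intro divide_right_mono wsum_mono) (auto simp: admissible_def wsum_def intro!: sum_nonneg hweight_nonneg)

lemma hexp_add: "hexp P m n (\<lambda>h. X h + Y h) = hexp P m n X + hexp P m n Y"
  by (simp add: hexp_def wsum_add add_divide_distrib)

lemma hexp_cmult: "hexp P m n (\<lambda>h. c * X h) = c * hexp P m n X"
  by (simp add: hexp_def wsum_cmult)

lemma hexp_sum: "hexp P m n (\<lambda>h. \<Sum>i\<in>I. X i h) = (\<Sum>i\<in>I. hexp P m n (X i))"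
  by (simp add: hexp_def wsum_sum sum_divide_distrib)

lemma hexp_const:
  assumes "wsum P (halves (m n)) {1..int n} (\<lambda>_. 1) > 0"
  shows "hexp P m n (\<lambda>_. c) = c"
  using wsum_cmult[of P "halves (m n)" "{1..int n}" c "\<lambda>_. 1"] assms by (simp add: hexp_def)

lemma hexp_abs_deviation_tendsto_0:
  assumes adm: "admissible P m" and B: "\<And>d. \<bar>\<phi> d\<bar> \<le> 1"
  shows "(\<lambda>n. hexp P m n (\<lambda>h. \<bar>(\<Sum>v\<in>{1..int n}. \<phi> (hdeg (halves (m n)) h v)) / real n - mean P \<phi>\<bar>)) \<longlonglongrightarrow> 0"
    (is "?X \<longlonglongrightarrow> 0")
proof (rule order_tendstoI)
  fix a :: real assume "a < 0"
  moreover have "?X n \<ge> hexp P m n (\<lambda>_. 0)" for n by (intro hexp_mono adm) auto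
  moreover have "hexp P m n (\<lambda>_. 0) = 0" for n by (simp add: hexp_def wsum_def)
  ultimately show "eventually (\<lambda>n. a < ?X n) sequentially" by (simp add: order_less_le_trans)
next
  fix \<eta> :: real assume \<eta>: "0 < \<eta>"
  \<comment> \<open>With these values and \<open>B = 1\<close>, the three error terms of
    \<open>wsum_abs_deviation\<close> are at most \<open>\<eta> / 4\<close>, equal to
    \<open>\<eta> / 4\<close>, and less than \<open>\<eta> / 2\<close> for large
    \<open>n\<close>.\<close>
  define t where "t = min 1 (\<eta> / 4)"
  define \<epsilon> where "\<epsilon> = t * (\<eta> / 4)"
  have t: "t > 0" "t \<le> 1" "t \<le> \<eta> / 4" using \<eta> by (auto simp: t_def)
  have \<epsilon>: "\<epsilon> > 0" using t \<eta> by (simp add: \<epsilon>_def)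
  have "eventually (\<lambda>n. coeff (P ^ n) (2 * m n) \<ge> exp (- \<epsilon> * real n)) sequentially"
    using adm \<epsilon> by (simp add: admissible_def)
  moreover have "eventually (\<lambda>n. 4 / (\<eta> * t) < real n) sequentially"
    using filterlim_real_sequentially by (simp add: filterlim_at_top_dense)
  ultimately show "eventually (\<lambda>n. ?X n < \<eta>) sequentially"
    using admissible_wsum_pos[OF adm] eventually_gt_at_top[of 0]
  proof eventually_elim
    case (elim n)
    let ?Z = "wsum P (halves (m n)) {1..int n} (\<lambda>_. 1)"
    have "?X n * ?Z \<le> (t * 1\<^sup>2 + \<epsilon> / t + 2 / (real (card {1..int n}) * t)) * ?Z"
      using wsum_abs_deviation[of "halves (m n)" "{1..int n}" P \<phi> 1 t \<epsilon>] adm t elim B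
      by (simp add: hexp_def admissible_def)
    then have "?X n \<le> t + \<eta> / 4 + 2 / (real n * t)"
      using elim t by (simp add: \<epsilon>_def)
    also have "2 / (real n * t) < \<eta> / 2" using elim t \<eta> by (simp add: field_simps)
    then have "t + \<eta> / 4 + 2 / (real n * t) < \<eta>" using t by linarith
    finally show ?case .
  qed
qed

text \<open>Over all maps of \<open>U\<close>, injective or not, the sum factorises into averages of
  degree statistics, which concentrate. Non-injective maps are a vanishing proportion, and since all
  factors are bounded by 1, the product changes by at most the sum of the deviations of its
  factors.\<close>

lemma hexp_inj_sum_unit:
  fixes \<phi> :: "'u \<Rightarrow> nat \<Rightarrow> real"
  assumes adm: "admissible P m" and U: "finite U" and B: "\<And>u d. \<bar>\<phi> u d\<bar> \<le> 1"
  shows "(\<lambda>n. hexp P m n (\<lambda>h. (\<Sum>f\<in>{f \<in> U \<rightarrow>\<^sub>E {1..int n}. inj_on f U}.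
        \<Prod>u\<in>U. \<phi> u (hdeg (halves (m n)) h (f u))) / real n ^ card U))
    \<longlonglongrightarrow> (\<Prod>u\<in>U. mean P (\<phi> u))"
proof -
  let ?k = "card U"
  let ?S = "\<lambda>n h. (\<Sum>f\<in>{f \<in> U \<rightarrow>\<^sub>E {1..int n}. inj_on f U}. \<Prod>u\<in>U. \<phi> u (hdeg (halves (m n)) h (f u))) / real n ^ ?k"
  let ?M = "\<Prod>u\<in>U. mean P (\<phi> u)"
  let ?a = "\<lambda>n h u. (\<Sum>v\<in>{1..int n}. \<phi> u (hdeg (halves (m n)) h v)) / real n"
  let ?r = "\<lambda>n. 1 - real (ffac n ?k) / real n ^ ?k"
  have mean1: "\<bar>mean P (\<phi> u)\<bar> \<le> 1" for u
  proof -
    have "\<bar>mean P (\<phi> u)\<bar> \<le> (\<Sum>d\<le>degree P. \<bar>coeff P d * \<phi> u d\<bar>)"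
      unfolding mean_def by (rule sum_abs)
    also have "\<dots> \<le> (\<Sum>d\<le>degree P. coeff P d)"
      using adm B by (intro sum_mono) (auto simp: abs_mult admissible_def intro: mult_left_le)
    also have "\<dots> = 1" using adm by (simp add: admissible_def poly_altdef)
    finally show ?thesis .
  qed
  have bound: "\<bar>?S n h - ?M\<bar> \<le> ?r n + (\<Sum>u\<in>U. \<bar>?a n h u - mean P (\<phi> u)\<bar>)" if n: "n > 0" for n h
  proof -
    let ?F = "U \<rightarrow>\<^sub>E {1..int n}" and ?I = "{f \<in> U \<rightarrow>\<^sub>E {1..int n}. inj_on f U}"
    let ?p = "\<lambda>f. \<Prod>u\<in>U. \<phi> u (hdeg (halves (m n)) h (f u))"
    have finF: "finite ?F" using U by (simp add: finite_PiE)
    have p1: "\<bar>?p f\<bar> \<le> 1" for f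
      unfolding abs_prod using B by (intro prod_le_1) auto
    have all: "(\<Sum>f\<in>?F. ?p f) / real n ^ ?k = (\<Prod>u\<in>U. ?a n h u)"
      by (subst prod_sum_PiE[symmetric, OF U]) (simp_all add: prod_dividef)
    have "(\<Sum>f\<in>?F. ?p f) - (\<Sum>f\<in>?I. ?p f) = (\<Sum>f\<in>?F - ?I. ?p f)"
      using finF by (intro sum_diff[symmetric]) auto
    then have "\<bar>(\<Sum>f\<in>?I. ?p f) - (\<Sum>f\<in>?F. ?p f)\<bar> = \<bar>\<Sum>f\<in>?F - ?I. ?p f\<bar>" by linarith
    also have "\<dots> \<le> (\<Sum>f\<in>?F - ?I. \<bar>?p f\<bar>)" by (rule sum_abs)
    also have "\<dots> \<le> (\<Sum>f\<in>?F - ?I. 1)" by (intro sum_mono p1)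
    also have "\<dots> = real n ^ ?k - real (ffac n ?k)"
    proof -
      have "card (?F - ?I) = card ?F - card ?I" using finF by (intro card_Diff_subset) auto
      moreover have "card ?I \<le> card ?F" using finF by (intro card_mono) auto
      moreover have "card ?F = n ^ ?k" using U by (simp add: card_PiE)
      moreover have "card ?I = ffac n ?k" using card_inj_funcset[OF U, of "{1..int n}"] by simp
      ultimately show ?thesis by (simp add: of_nat_diff)
    qed
    finally have "\<bar>(\<Sum>f\<in>?I. ?p f) - (\<Sum>f\<in>?F. ?p f)\<bar> / real n ^ ?k \<le> (real n ^ ?k - real (ffac n ?k)) / real n ^ ?k"
      by (rule divide_right_mono) simp
    then have 1: "\<bar>?S n h - (\<Prod>u\<in>U. ?a n h u)\<bar> \<le> ?r n"
      unfolding all[symmetric] diff_divide_distrib[symmetric] abs_divide using n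
      by (simp add: diff_divide_distrib)
    have a1: "\<bar>?a n h u\<bar> \<le> 1" for u
    proof -
      have "\<bar>\<Sum>v\<in>{1..int n}. \<phi> u (hdeg (halves (m n)) h v)\<bar> \<le> (\<Sum>v\<in>{1..int n}. \<bar>\<phi> u (hdeg (halves (m n)) h v)\<bar>)"
        by (rule sum_abs)
      also have "\<dots> \<le> (\<Sum>v\<in>{1..int n}. 1)" by (intro sum_mono B)
      finally show ?thesis using n by simp
    qed
    have 2: "\<bar>(\<Prod>u\<in>U. ?a n h u) - ?M\<bar> \<le> (\<Sum>u\<in>U. \<bar>?a n h u - mean P (\<phi> u)\<bar>)"
      using norm_prod_diff[of U "?a n h" "\<lambda>u. mean P (\<phi> u)"] a1 mean1 by simp
    from 1 2 show ?thesis by linarith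
  qed
  have lim: "(\<lambda>n. ?r n + (\<Sum>u\<in>U. hexp P m n (\<lambda>h. \<bar>?a n h u - mean P (\<phi> u)\<bar>))) \<longlonglongrightarrow> (1 - 1) + (\<Sum>u\<in>U. 0)"
    by (intro tendsto_add tendsto_diff tendsto_const tendsto_sum ffac_ratio_tendsto_1
        hexp_abs_deviation_tendsto_0 adm B)
  have "(\<lambda>n. hexp P m n (?S n) - ?M) \<longlonglongrightarrow> 0"
  proof (rule Lim_null_comparison)
    show "(\<lambda>n. ?r n + (\<Sum>u\<in>U. hexp P m n (\<lambda>h. \<bar>?a n h u - mean P (\<phi> u)\<bar>))) \<longlonglongrightarrow> 0"
      using lim by simp
    show "eventually (\<lambda>n. norm (hexp P m n (?S n) - ?M)
        \<le> ?r n + (\<Sum>u\<in>U. hexp P m n (\<lambda>h. \<bar>?a n h u - mean P (\<phi> u)\<bar>))) sequentially"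
      using admissible_wsum_pos[OF adm] eventually_gt_at_top[of 0]
    proof eventually_elim
      case (elim n)
      let ?D = "\<lambda>h. ?r n + (\<Sum>u\<in>U. \<bar>?a n h u - mean P (\<phi> u)\<bar>)"
      have D: "hexp P m n ?D = ?r n + (\<Sum>u\<in>U. hexp P m n (\<lambda>h. \<bar>?a n h u - mean P (\<phi> u)\<bar>))"
        using elim by (simp only: hexp_add hexp_sum hexp_const)
      have c: "hexp P m n (\<lambda>_. c) = c" for c by (rule hexp_const[of P m n, OF elim(1)])
      have "hexp P m n (?S n) \<le> hexp P m n (\<lambda>h. ?D h + ?M)"
        using bound[OF elim(2)] by (intro hexp_mono adm) (smt (verit))
      also have "\<dots> = hexp P m n ?D + ?M" by (simp only: hexp_add c)
      finally have 1: "hexp P m n (?S n) \<le> hexp P m n ?D + ?M" .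
      have "hexp P m n (\<lambda>_. ?M) \<le> hexp P m n (\<lambda>h. ?S n h + ?D h)"
        using bound[OF elim(2)] by (intro hexp_mono adm) (smt (verit))
      also have "\<dots> = hexp P m n (?S n) + hexp P m n ?D" by (simp only: hexp_add)
      finally have "?M \<le> hexp P m n (?S n) + hexp P m n ?D" by (simp only: c)
      with 1 show ?case unfolding D[symmetric] by simp
    qed
  qed
  then show ?thesis by (rule LIM_zero_cancel)
qed

section \<open>Asymptotic embedding counts\<close>

lemma hexp_cong:
  assumes "\<And>h. h \<in> halves (m n) \<rightarrow>\<^sub>E {1..int n} \<Longrightarrow> hweight P (halves (m n)) {1..int n} h \<noteq> 0 \<Longrightarrow> X h = Y h"
  shows "hexp P m n X = hexp P m n Y"
  unfolding hexp_def by (subst wsum_cong[of _ _ _ X Y]) (use assms in auto)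

lemma hweight_nonzero_degree:
  assumes "hweight P A V h \<noteq> 0" "v \<in> V" "finite V"
  shows "hdeg A h v \<le> degree P" "coeff P (hdeg A h v) \<noteq> 0"
proof -
  show "coeff P (hdeg A h v) \<noteq> 0" using assms by (auto simp: hweight_def)
  then show "hdeg A h v \<le> degree P" by (rule le_degree)
qed

text \<open>Maps of nonzero weight have no degree above \<open>degree P\<close>, so cutting the
  falling factorials off there changes nothing, and dividing by \<open>B\<close> brings them into
  the range of \<open>hexp_inj_sum_unit\<close>.\<close>

lemma hexp_inj_sum_ffac:
  fixes c :: "'u \<Rightarrow> nat"
  assumes adm: "admissible P m" and U: "finite U"
  shows "(\<lambda>n. hexp P m n (\<lambda>h. \<Sum>f\<in>{f \<in> U \<rightarrow>\<^sub>E {1..int n}. inj_on f U}.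
        \<Prod>u\<in>U. real (ffac (hdeg (halves (m n)) h (f u)) (c u))) / real n ^ card U)
    \<longlonglongrightarrow> (\<Prod>u\<in>U. mean P (\<lambda>d. real (ffac d (c u))))"
proof -
  define B where "B = 1 + (\<Sum>u\<in>U. real (degree P) ^ c u)"
  have B: "B > 0" unfolding B_def by (intro add_pos_nonneg sum_nonneg) auto
  define \<phi> where "\<phi> u d = (if u \<in> U \<and> d \<le> degree P then real (ffac d (c u)) / B else 0)" for u d
  have b: "\<bar>\<phi> u d\<bar> \<le> 1" for u d
  proof (cases "u \<in> U \<and> d \<le> degree P")
    case True
    have "real (ffac d (c u)) \<le> real d ^ c u" using ffac_le_power[of d "c u"] by (metis of_nat_le_iff of_nat_power)
    also have "\<dots> \<le> real (degree P) ^ c u" using True by (intro power_mono) auto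
    also have "\<dots> \<le> (\<Sum>u\<in>U. real (degree P) ^ c u)" using True U by (intro member_le_sum) auto
    also have "\<dots> \<le> B" by (simp add: B_def)
    finally show ?thesis using True B by (simp add: \<phi>_def)
  qed (auto simp: \<phi>_def)
  have m\<phi>: "mean P (\<phi> u) = mean P (\<lambda>d. real (ffac d (c u))) / B" if "u \<in> U" for u
    using that by (simp add: mean_def \<phi>_def sum_divide_distrib)
  have "B ^ card U * hexp P m n (\<lambda>h. (\<Sum>f\<in>{f \<in> U \<rightarrow>\<^sub>E {1..int n}. inj_on f U}.
        \<Prod>u\<in>U. \<phi> u (hdeg (halves (m n)) h (f u))) / real n ^ card U)
    = hexp P m n (\<lambda>h. \<Sum>f\<in>{f \<in> U \<rightarrow>\<^sub>E {1..int n}. inj_on f U}.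
        \<Prod>u\<in>U. real (ffac (hdeg (halves (m n)) h (f u)) (c u))) / real n ^ card U" for n
  proof -
    have "B ^ card U * hexp P m n (\<lambda>h. (\<Sum>f\<in>{f \<in> U \<rightarrow>\<^sub>E {1..int n}. inj_on f U}.
        \<Prod>u\<in>U. \<phi> u (hdeg (halves (m n)) h (f u))) / real n ^ card U)
      = hexp P m n (\<lambda>h. (1 / real n ^ card U) * (\<Sum>f\<in>{f \<in> U \<rightarrow>\<^sub>E {1..int n}. inj_on f U}.
        \<Prod>u\<in>U. real (ffac (hdeg (halves (m n)) h (f u)) (c u))))"
      unfolding hexp_cmult[symmetric]
    proof (rule hexp_cong)
      fix h assume h: "h \<in> halves (m n) \<rightarrow>\<^sub>E {1..int n}" "hweight P (halves (m n)) {1..int n} h \<noteq> 0"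
      have "B ^ card U * (\<Prod>u\<in>U. \<phi> u (hdeg (halves (m n)) h (f u))) = (\<Prod>u\<in>U. real (ffac (hdeg (halves (m n)) h (f u)) (c u)))"
        if f: "f \<in> U \<rightarrow>\<^sub>E {1..int n}" for f
      proof -
        have "B ^ card U * (\<Prod>u\<in>U. \<phi> u (hdeg (halves (m n)) h (f u))) = (\<Prod>u\<in>U. B * \<phi> u (hdeg (halves (m n)) h (f u)))"
          by (simp add: prod.distrib)
        also have "\<dots> = (\<Prod>u\<in>U. real (ffac (hdeg (halves (m n)) h (f u)) (c u)))"
        proof (intro prod.cong refl)
          fix u assume u: "u \<in> U"
          then have "hdeg (halves (m n)) h (f u) \<le> degree P"
            using hweight_nonzero_degree(1)[OF h(2)] f by (auto dest: PiE_mem)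
          then show "B * \<phi> u (hdeg (halves (m n)) h (f u)) = real (ffac (hdeg (halves (m n)) h (f u)) (c u))"
            using u B by (simp add: \<phi>_def)
        qed
        finally show ?thesis .
      qed
      then show "B ^ card U * ((\<Sum>f\<in>{f \<in> U \<rightarrow>\<^sub>E {1..int n}. inj_on f U}.
          \<Prod>u\<in>U. \<phi> u (hdeg (halves (m n)) h (f u))) / real n ^ card U)
        = (1 / real n ^ card U) * (\<Sum>f\<in>{f \<in> U \<rightarrow>\<^sub>E {1..int n}. inj_on f U}.
          \<Prod>u\<in>U. real (ffac (hdeg (halves (m n)) h (f u)) (c u)))"
        by (simp add: sum_distrib_left sum_divide_distrib)
    qed
    then show ?thesis unfolding hexp_cmult by simp
  qed
  moreover have "(\<lambda>n. B ^ card U * hexp P m n (\<lambda>h. (\<Sum>f\<in>{f \<in> U \<rightarrow>\<^sub>E {1..int n}. inj_on f U}.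
        \<Prod>u\<in>U. \<phi> u (hdeg (halves (m n)) h (f u))) / real n ^ card U)) \<longlonglongrightarrow> B ^ card U * (\<Prod>u\<in>U. mean P (\<phi> u))"
    by (intro tendsto_mult tendsto_const hexp_inj_sum_unit adm U b)
  moreover have "B ^ card U * (\<Prod>u\<in>U. mean P (\<phi> u)) = (\<Prod>u\<in>U. mean P (\<lambda>d. real (ffac d (c u))))"
    using B by (simp add: m\<phi> prod_dividef cong: prod.cong)
  ultimately show ?thesis by simp
qed

lemma hexp_card_embeddings:
  assumes adm: "admissible P m" and fin: "finite V" "finite E" and ends: "s ` E \<subseteq> V" "t ` E \<subseteq> V"
  shows "(\<lambda>n. hexp P m n (\<lambda>h. real (card (embeddings V E s t (graph_of n (m n) h)))) *
      (2 * real (m n)) ^ card E / real n ^ card V)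
    \<longlonglongrightarrow> (\<Prod>u\<in>V. mean P (\<lambda>d. real (ffac d (pattern_degree E s t u))))"
proof -
  let ?s = "card E"
  \<comment> \<open>The exact factor \<open>ffac k s * 2 ^ s / ffac (2 * k) (2 * s)\<close> relative
    to its asymptotic value \<open>1 / (2 * k) ^ s\<close>, where \<open>s\<close> is the number of
    edges.\<close>
  define r where "r k = (real (ffac k ?s) / real k ^ ?s) / (real (ffac (2 * k) (2 * ?s)) / real (2 * k) ^ (2 * ?s))" for k
  have m: "filterlim m at_top sequentially" using adm by (simp add: admissible_def)
  have "(\<lambda>k. real (ffac (2 * k) (2 * ?s)) / real (2 * k) ^ (2 * ?s)) \<longlonglongrightarrow> 1"
    by (rule filterlim_compose[OF ffac_ratio_tendsto_1]) (rule mult_nat_left_at_top, simp)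
  then have "r \<longlonglongrightarrow> 1 / 1"
    unfolding r_def[abs_def] by (intro tendsto_divide ffac_ratio_tendsto_1) auto
  then have r: "(\<lambda>n. r (m n)) \<longlonglongrightarrow> 1" by (simp add: filterlim_compose[OF _ m])
  let ?S = "\<lambda>n. hexp P m n (\<lambda>h. \<Sum>f\<in>{f \<in> V \<rightarrow>\<^sub>E {1..int n}. inj_on f V}.
        \<Prod>u\<in>V. real (ffac (hdeg (halves (m n)) h (f u)) (pattern_degree E s t u)))"
  have lim: "(\<lambda>n. r (m n) * (?S n / real n ^ card V))
    \<longlonglongrightarrow> 1 * (\<Prod>u\<in>V. mean P (\<lambda>d. real (ffac d (pattern_degree E s t u))))"
    by (intro tendsto_mult r hexp_inj_sum_ffac adm fin)
  have "eventually (\<lambda>n. Suc ?s \<le> m n) sequentially"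
    using m unfolding filterlim_at_top by blast
  then have ev: "eventually (\<lambda>n. hexp P m n (\<lambda>h. real (card (embeddings V E s t (graph_of n (m n) h)))) *
      (2 * real (m n)) ^ card E / real n ^ card V = r (m n) * (?S n / real n ^ card V)) sequentially"
  proof eventually_elim
    case (elim n)
    let ?e = "hexp P m n (\<lambda>h. real (card (embeddings V E s t (graph_of n (m n) h))))"
    have pos: "ffac (2 * m n) (2 * ?s) > 0" using elim by (intro ffac_pos) simp
    have e1: "?e * real (ffac (2 * m n) (2 * ?s)) = real (ffac (m n) ?s * 2 ^ ?s) * ?S n"
      unfolding hexp_def using wsum_card_embeddings[OF fin ends, of "m n" P n] by (simp add: mult.commute)
    have nz: "real (ffac (2 * m n) (2 * ?s)) \<noteq> 0" using pos by simp
    have e: "?e = real (ffac (m n) ?s * 2 ^ ?s) * ?S n / real (ffac (2 * m n) (2 * ?s))"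
      by (rule iffD2[OF nonzero_eq_divide_eq[OF nz] e1])
    have "r (m n) = real (ffac (m n) ?s) * 2 ^ ?s * (2 * real (m n)) ^ ?s / real (ffac (2 * m n) (2 * ?s))"
    proof -
      have "real (2 * m n) ^ (2 * ?s) = 2 ^ ?s * real (m n) ^ ?s * (2 * real (m n)) ^ ?s"
      proof -
        have "x ^ (2 * ?s) = x ^ ?s * x ^ ?s" for x :: real by (simp only: mult_2 power_add)
        then show ?thesis by (simp only: of_nat_mult of_nat_numeral power_mult_distrib[of 2 "real (m n)" ?s])
      qed
      moreover have "(a / M) / (c / (T * M * W)) = a * T * W / c" if "M \<noteq> 0" for a M c T W :: real
        using that by simp
      moreover have "real (m n) ^ ?s \<noteq> 0" using elim by simp
      ultimately show ?thesis unfolding r_def by (simp only:)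
    qed
    then show ?case unfolding e by simp
  qed
  then show ?thesis using lim by (simp only: tendsto_cong mult_1)
qed

text \<open>A vanishing factorial moment means that some pattern degree exceeds every degree of
  positive weight, so the count is zero and not only small. The exact value matters because
  asymptotic equivalence to the zero function is eventual equality.\<close>

lemma hexp_card_embeddings_eq_0:
  assumes adm: "admissible P m" and fin: "finite V" "finite E" and ends: "s ` E \<subseteq> V" "t ` E \<subseteq> V"
    and zero: "(\<Prod>u\<in>V. mean P (\<lambda>d. real (ffac d (pattern_degree E s t u)))) = 0"
  shows "eventually (\<lambda>n. hexp P m n (\<lambda>h. real (card (embeddings V E s t (graph_of n (m n) h)))) = 0) sequentially"
proof -
  obtain u where u: "u \<in> V" and z: "mean P (\<lambda>d. real (ffac d (pattern_degree E s t u))) = 0"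
    using zero fin by auto
  have z0: "ffac d (pattern_degree E s t u) = 0" if "coeff P d \<noteq> 0" for d
  proof -
    have "coeff P d * real (ffac d (pattern_degree E s t u)) = 0"
      using z adm le_degree[OF that] unfolding mean_def
      by (subst (asm) sum_nonneg_eq_0_iff) (auto simp: admissible_def)
    then show ?thesis using that by simp
  qed
  have m: "filterlim m at_top sequentially" using adm by (simp add: admissible_def)
  have "eventually (\<lambda>n. Suc (card E) \<le> m n) sequentially"
    using m unfolding filterlim_at_top by blast
  then show ?thesis
  proof eventually_elim
    case (elim n)
    let ?e = "hexp P m n (\<lambda>h. real (card (embeddings V E s t (graph_of n (m n) h))))"
    let ?S = "hexp P m n (\<lambda>h. \<Sum>f\<in>{f \<in> V \<rightarrow>\<^sub>E {1..int n}. inj_on f V}.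
        \<Prod>u\<in>V. real (ffac (hdeg (halves (m n)) h (f u)) (pattern_degree E s t u)))"
    have pos: "ffac (2 * m n) (2 * card E) > 0" using elim by (intro ffac_pos) simp
    have "real (ffac (2 * m n) (2 * card E)) * ?e = real (ffac (m n) (card E) * 2 ^ card E) * ?S"
      unfolding hexp_def using wsum_card_embeddings[OF fin ends, of "m n" P n] by simp
    moreover have "?S = hexp P m n (\<lambda>h. 0)"
    proof (rule hexp_cong, rule sum.neutral, rule ballI)
      fix h f assume h: "hweight P (halves (m n)) {1..int n} h \<noteq> 0"
        and f: "f \<in> {f \<in> V \<rightarrow>\<^sub>E {1..int n}. inj_on f V}"
      have "f u \<in> {1..int n}" using f u by (auto dest: PiE_mem)
      then have "ffac (hdeg (halves (m n)) h (f u)) (pattern_degree E s t u) = 0"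
        by (intro z0 hweight_nonzero_degree(2)[OF h]) auto
      then show "(\<Prod>u\<in>V. real (ffac (hdeg (halves (m n)) h (f u)) (pattern_degree E s t u))) = 0"
        using u fin by (intro prod_zero) auto
    qed
    moreover have "hexp P m n (\<lambda>h. 0) = 0" by (simp add: hexp_def wsum_def)
    ultimately show ?case using pos by simp
  qed
qed

section \<open>Factorial moments of a tilted degree law\<close>

lemma pochhammer_eq_ffac: "pochhammer (of_nat (Suc n)) c = (of_nat (ffac (n + c) c) :: real)"
proof -
  have 1: "pochhammer (of_nat (Suc n)) c * fact n = (fact (n + c) :: real)"
  proof (induction c)
    case (Suc c)
    have "pochhammer (of_nat (Suc n)) (Suc c) * fact n
      = (of_nat (Suc n) + of_nat c) * (pochhammer (of_nat (Suc n)) c * (fact n :: real))"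
      by (simp add: pochhammer_Suc)
    also have "\<dots> = fact (n + Suc c)" unfolding Suc.IH by simp
    finally show ?case .
  qed simp
  have "real (ffac (n + c) c) * fact n = fact (n + c)"
    using ffac_fact[of c "n + c"] by (metis add_diff_cancel_right' le_add2 of_nat_fact of_nat_mult)
  with 1 have "pochhammer (of_nat (Suc n)) c * fact n = real (ffac (n + c) c) * fact n" by simp
  then show ?thesis by simp
qed

text \<open>Factorial moments are the derivatives of the generating function at 1; for a tilted law
  these are derivatives of \<open>\<Delta>\<close> at \<open>chi\<close>, with one factor
  \<open>chi\<close> for each differentiation.\<close>

lemma mean_ffac_tilted:
  fixes \<Delta> P :: "real poly"
  assumes P: "\<And>d. coeff P d = coeff \<Delta> d * chi ^ d / D"
  shows "mean P (\<lambda>d. real (ffac d c)) = chi ^ c * poly ((pderiv ^^ c) \<Delta>) chi / D"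
proof -
  let ?K = "degree \<Delta>"
  let ?g = "\<lambda>d. coeff P d * real (ffac d c)"
  have dP: "degree P \<le> ?K" by (rule degree_le) (simp add: P coeff_eq_0)
  have "degree ((pderiv ^^ c) \<Delta>) \<le> ?K"
    by (rule degree_le) (simp add: coeff_higher_pderiv coeff_eq_0)
  then have "poly ((pderiv ^^ c) \<Delta>) chi = (\<Sum>i\<le>?K. coeff ((pderiv ^^ c) \<Delta>) i * chi ^ i)"
    unfolding poly_altdef by (intro sum.mono_neutral_left) (auto simp: coeff_eq_0)
  then have "chi ^ c * poly ((pderiv ^^ c) \<Delta>) chi / D = (\<Sum>i\<le>?K. ?g (i + c))"
    unfolding sum_distrib_left sum_divide_distrib coeff_higher_pderiv pochhammer_eq_ffac P
    by (simp add: sum_distrib_left sum_divide_distrib power_add ac_simps)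
  also have "\<dots> = (\<Sum>d\<in>{c..?K + c}. ?g d)"
    using sum.shift_bounds_cl_nat_ivl[of ?g 0 c ?K] by (simp add: atLeast0AtMost)
  also have "\<dots> = (\<Sum>d\<le>?K + c. ?g d)"
    by (intro sum.mono_neutral_left) (auto simp: ffac_eq_0)
  also have "\<dots> = (\<Sum>d\<le>degree P. ?g d)"
    using dP by (intro sum.mono_neutral_right) (auto simp: coeff_eq_0)
  finally show ?thesis by (simp add: mean_def)
qed

section \<open>The tilted degree law and its expectations\<close>

locale tilted =
  fixes \<delta> :: "nat \<Rightarrow> real" and \<Delta> :: "real poly"
    and m :: "nat \<Rightarrow> nat" and L chi :: real
  assumes \<delta>_nonneg: "\<And>d. \<delta> d \<ge> 0"
    and coeff_\<Delta>: "\<And>d. coeff \<Delta> d = \<delta> d / fact d"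
    and aper: "aperiodic \<delta>"
    and m_top: "filterlim m at_top sequentially"
    and L_lim: "(\<lambda>n. 2 * real (m n) / real n) \<longlonglongrightarrow> L"
    and L_min: "real (Min (support \<delta>)) < L" and L_max: "L < real (Max (support \<delta>))"
    and chi_pos: "chi > 0" and chi_eq: "chi * poly (pderiv \<Delta>) chi / poly \<Delta> chi = L"
begin

definition pgf :: "real poly" where
  "pgf = smult (1 / poly \<Delta> chi) (pcompose \<Delta> [:0, chi:])"

definition \<mu> :: "nat \<Rightarrow> real" where
  "\<mu> c = chi ^ c * poly ((pderiv ^^ c) \<Delta>) chi / poly \<Delta> chi"

definition expec :: "nat \<Rightarrow> (multigraph \<Rightarrow> real) \<Rightarrow> real" where
  "expec n X = measure_pmf.expectation (random_multigraph \<delta> n (m n)) X"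

lemma coeff_pgf: "coeff pgf d = coeff \<Delta> d * chi ^ d / poly \<Delta> chi"
  by (simp add: pgf_def coeff_pcompose_linear)

lemma finite_support: "finite (support \<delta>)"
  by (rule finite_subset[of _ "{..degree \<Delta>}"])
    (auto simp: support_def coeff_\<Delta> intro!: le_degree)

lemma support_nonempty: "support \<delta> \<noteq> {}"
proof
  assume "support \<delta> = {}"
  then have "\<delta> d = 0" for d using \<delta>_nonneg[of d] by (auto simp: support_def order_less_le)
  \<comment> \<open>The gcd of the empty set is 0, so aperiodicity excludes an empty
    support.\<close>
  then have "{int d1 - int d2 | d1 d2. \<delta> d1 \<noteq> 0 \<and> \<delta> d2 \<noteq> 0} = {}" by simp
  then show False using aper unfolding aperiodic_def by simp
qed

lemma poly_\<Delta>_pos: "poly \<Delta> chi > 0"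
proof -
  obtain d where d: "\<delta> d > 0" using support_nonempty by (auto simp: support_def)
  have c0: "coeff \<Delta> i * chi ^ i \<ge> 0" for i using \<delta>_nonneg[of i] chi_pos by (simp add: coeff_\<Delta>)
  have "coeff \<Delta> d * chi ^ d > 0" using d chi_pos by (simp add: coeff_\<Delta>)
  moreover have "d \<le> degree \<Delta>" using d by (intro le_degree) (simp add: coeff_\<Delta>)
  ultimately show ?thesis unfolding poly_altdef using c0
    by (intro sum_pos2[of _ d]) auto
qed

lemma mean_pgf: "mean pgf (\<lambda>d. real (ffac d c)) = \<mu> c"
  unfolding \<mu>_def by (rule mean_ffac_tilted) (rule coeff_pgf)

lemma L_pos: "L > 0"
  using L_min by (simp add: order_le_less_trans[OF of_nat_0_le_iff])

lemma coeff_pgf_pos_iff: "coeff pgf d > 0 \<longleftrightarrow> \<delta> d > 0"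
proof -
  define k where "k = chi ^ d / (fact d * poly \<Delta> chi)"
  have "coeff pgf d = \<delta> d * k" by (simp add: coeff_pgf coeff_\<Delta> k_def)
  moreover have "k > 0" using poly_\<Delta>_pos chi_pos by (simp add: k_def)
  ultimately show ?thesis by (simp add: zero_less_mult_iff)
qed

lemma coeff_pgf_nonneg: "coeff pgf d \<ge> 0"
  using poly_\<Delta>_pos chi_pos \<delta>_nonneg[of d] by (simp add: coeff_pgf coeff_\<Delta>)

lemma poly_pgf_1: "poly pgf 1 = 1"
  using poly_\<Delta>_pos by (simp add: pgf_def poly_pcompose)

text \<open>The equation for \<open>chi\<close> says that the tilted law has mean \<open>L\<close>.
  The conditioning therefore asks for a degree sum near its expected value, as
  \<open>coeff_power_lower_bound\<close> requires.\<close>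

lemma mean_pgf_real: "mean pgf real = L"
proof -
  have "(\<lambda>d. real (ffac d 1)) = real" by (simp add: ffac_Suc fun_eq_iff)
  then show ?thesis using mean_pgf[of 1] chi_eq by (simp add: \<mu>_def)
qed

lemma admissible_pgf: "admissible pgf m"
  unfolding admissible_def
proof (intro conjI allI impI coeff_pgf_nonneg poly_pgf_1 m_top)
  fix \<epsilon> :: real assume \<epsilon>: "\<epsilon> > 0"
  show "eventually (\<lambda>n. exp (- \<epsilon> * real n) \<le> coeff (pgf ^ n) (2 * m n)) sequentially"
  proof (rule coeff_power_lower_bound[where a = "Min (support \<delta>)" and b = "Max (support \<delta>)"])
    have "Min (support \<delta>) \<in> support \<delta>" "Max (support \<delta>) \<in> support \<delta>"
      using finite_support support_nonempty by auto
    then show "coeff pgf (Min (support \<delta>)) > 0" "coeff pgf (Max (support \<delta>)) > 0"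
      by (auto simp: support_def coeff_pgf_pos_iff)
    have "\<delta> d \<noteq> 0 \<longleftrightarrow> \<delta> d > 0" for d using \<delta>_nonneg[of d] by auto
    then show "Gcd {int d1 - int d2 |d1 d2. coeff pgf d1 > 0 \<and> coeff pgf d2 > 0} = 1"
      using aper by (simp add: aperiodic_def coeff_pgf_pos_iff)
    show "(\<lambda>n. real (2 * m n) / real n) \<longlonglongrightarrow> mean pgf real"
      using L_lim by (simp add: mean_pgf_real)
  qed (use L_min L_max \<epsilon> in \<open>simp_all add: mean_pgf_real coeff_pgf_nonneg poly_pgf_1\<close>)
qed

lemma expec_eq_hexp:
  "eventually (\<lambda>n. \<forall>X. expec n X = hexp pgf m n (\<lambda>h. X (graph_of n (m n) h))) sequentially"
  using admissible_wsum_pos[OF admissible_pgf]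
proof eventually_elim
  case (elim n)
  show ?case
  proof
    fix X
    show "expec n X = hexp pgf m n (\<lambda>h. X (graph_of n (m n) h))"
      unfolding expec_def hexp_def
      by (rule expectation_eq_wsum[OF \<delta>_nonneg chi_pos poly_\<Delta>_pos _ elim])
        (simp add: coeff_pgf coeff_\<Delta>)
  qed
qed

lemma expec_embeddings:
  assumes "finite V" "finite E" "s ` E \<subseteq> V" "t ` E \<subseteq> V"
  shows "(\<lambda>n. expec n (\<lambda>G. real (card (embeddings V E s t G))) * (2 * real (m n)) ^ card E / real n ^ card V)
    \<longlonglongrightarrow> (\<Prod>u\<in>V. \<mu> (pattern_degree E s t u))"
proof -
  have ev: "eventually (\<lambda>n. expec n (\<lambda>G. real (card (embeddings V E s t G))) * (2 * real (m n)) ^ card E / real n ^ card V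
    = hexp pgf m n (\<lambda>h. real (card (embeddings V E s t (graph_of n (m n) h)))) *
      (2 * real (m n)) ^ card E / real n ^ card V) sequentially"
    using expec_eq_hexp by eventually_elim simp
  show ?thesis
    by (rule tendsto_cong[OF ev, THEN iffD2, OF hexp_card_embeddings[OF admissible_pgf assms, unfolded mean_pgf]])
qed

lemma expec_embeddings_eq_0:
  assumes "finite V" "finite E" "s ` E \<subseteq> V" "t ` E \<subseteq> V"
    and "(\<Prod>u\<in>V. \<mu> (pattern_degree E s t u)) = 0"
  shows "eventually (\<lambda>n. expec n (\<lambda>G. real (card (embeddings V E s t G))) = 0) sequentially"
  using expec_eq_hexp hexp_card_embeddings_eq_0[OF admissible_pgf assms(1-4), unfolded mean_pgf, OF assms(5)]
  by eventually_elim simp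

end

section \<open>Connected multigraphs and trees\<close>

abbreviation madj :: "edge set \<Rightarrow> (int \<times> int) set" where
  "madj E \<equiv> {(a, b). \<exists>x\<in>E. edge_ends x = {a, b}}"

lemma madj_sym: "(a, b) \<in> madj E \<Longrightarrow> (b, a) \<in> madj E"
  by (auto simp: insert_commute)

lemma madj_rtrancl_sym: "(a, b) \<in> (madj E)\<^sup>* \<Longrightarrow> (b, a) \<in> (madj E)\<^sup>*"
proof (induction rule: rtrancl_induct)
  case (step y z)
  then show ?case using madj_sym[of y z E] by (meson converse_rtrancl_into_rtrancl)
qed simp

text \<open>Breadth-first search from \<open>S\<close>: \<open>d v\<close> is the distance of
  \<open>v\<close> from \<open>S\<close>, and \<open>x v\<close> is the last edge of a shortest walk
  to \<open>v\<close>, coming from \<open>p v\<close>.\<close>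

lemma connected_parent_edges:
  assumes G: "connected_multigraph G" and S: "S \<subseteq> mverts G" "S \<noteq> {}"
  obtains x :: "int \<Rightarrow> edge" and p :: "int \<Rightarrow> int" and d :: "int \<Rightarrow> nat"
  where "\<And>v. v \<in> mverts G - S \<Longrightarrow> x v \<in> medges G \<and> edge_ends (x v) = {p v, v} \<and> p v \<in> mverts G \<and> d (p v) < d v"
proof -
  let ?R = "madj (medges G)"
  have wf: "wf_multigraph G" using G by (simp add: connected_multigraph_def)
  define d where "d v = (LEAST k. \<exists>u\<in>S. (u, v) \<in> ?R ^^ k)" for v
  have ex: "\<exists>x q. x \<in> medges G \<and> edge_ends x = {q, v} \<and> q \<in> mverts G \<and> d q < d v" if v: "v \<in> mverts G - S" for v
  proof -
    obtain u where u: "u \<in> S" using S by auto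
    then have "(u, v) \<in> ?R\<^sup>*" using G S v by (auto simp: connected_multigraph_def)
    then have "\<exists>k. \<exists>u\<in>S. (u, v) \<in> ?R ^^ k" using u unfolding rtrancl_power by blast
    from LeastI_ex[OF this] obtain u where u: "u \<in> S" "(u, v) \<in> ?R ^^ d v" unfolding d_def by blast
    obtain k where k: "d v = Suc k"
    proof (cases "d v")
      case 0
      then show ?thesis using u v by auto
    qed
    then obtain w where w: "(u, w) \<in> ?R ^^ k" "(w, v) \<in> ?R" using u by auto
    then have "d w \<le> k" using u unfolding d_def by (intro Least_le) auto
    moreover obtain x where x: "x \<in> medges G" "edge_ends x = {w, v}" using w by auto
    moreover have "w \<in> mverts G" using x wf by (auto simp: wf_multigraph_def)
    ultimately show ?thesis using k by (intro exI[of _ x] exI[of _ w]) simp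
  qed
  then obtain x p where "\<And>v. v \<in> mverts G - S \<Longrightarrow> x v \<in> medges G \<and> edge_ends (x v) = {p v, v} \<and> p v \<in> mverts G \<and> d (p v) < d v"
    by metis
  then show ?thesis by (rule that)
qed

text \<open>Two vertices with the same parent edge would be parents of each other, against the
  decrease of \<open>d\<close>.\<close>

lemma parent_edges_inj:
  assumes "\<And>v. v \<in> W \<Longrightarrow> edge_ends (x v) = {p v, v} \<and> d (p v) < (d v :: nat)"
  shows "inj_on x W"
proof (rule inj_onI, rule ccontr)
  fix v w assume vw: "v \<in> W" "w \<in> W" "x v = x w" "v \<noteq> w"
  then have "{p v, v} = {p w, w}" using assms by metis
  then have "p v = w" "p w = v" using vw(4) by (auto simp: doubleton_eq_iff)
  then show False using assms[OF vw(1)] assms[OF vw(2)] by simp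
qed

text \<open>Each vertex outside \<open>S\<close> owns its parent edge, which has that vertex as an
  end and so does not lie within \<open>S\<close>.\<close>

lemma connected_card_edges_outside:
  assumes G: "connected_multigraph G" and S: "S \<subseteq> mverts G" "S \<noteq> {}"
  shows "card (mverts G - S) \<le> card {x\<in>medges G. \<not> edge_ends x \<subseteq> S}"
proof -
  obtain x p and d :: "int \<Rightarrow> nat" where *: "\<And>v. v \<in> mverts G - S \<Longrightarrow>
    x v \<in> medges G \<and> edge_ends (x v) = {p v, v} \<and> p v \<in> mverts G \<and> d (p v) < d v"
    using connected_parent_edges[OF assms] by metis
  have "finite (medges G)" using G by (simp add: connected_multigraph_def wf_multigraph_def)
  moreover have "inj_on x (mverts G - S)" using * by (intro parent_edges_inj[of _ x p d]) blast
  moreover have "x ` (mverts G - S) \<subseteq> {x\<in>medges G. \<not> edge_ends x \<subseteq> S}"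
    using * by auto
  ultimately show ?thesis by (intro card_inj_on_le) auto
qed

lemma connected_card_le:
  assumes G: "connected_multigraph G"
  shows "card (mverts G) \<le> card (medges G) + 1"
proof -
  obtain r where r: "r \<in> mverts G" using G by (auto simp: connected_multigraph_def)
  have fin: "finite (mverts G)" "finite (medges G)" using G by (auto simp: connected_multigraph_def wf_multigraph_def)
  have "card (mverts G - {r}) \<le> card {x\<in>medges G. \<not> edge_ends x \<subseteq> {r}}"
    using r by (intro connected_card_edges_outside G) auto
  also have "\<dots> \<le> card (medges G)" using fin by (intro card_mono) auto
  finally show ?thesis using r fin by (simp add: card_Diff_singleton)
qed

lemma copies_iso_card:
  assumes "H \<in> copies F G"
  shows "card (mverts H) = card (mverts F)" "card (medges H) = card (medges F)"
  using assms by (auto simp: copies_def isomorphic_def multigraph_iso_def dest: bij_betw_same_card)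

text \<open>A cycle has as many edges as vertices, and every vertex outside it brings an edge of its
  own.\<close>

lemma connected_cycle_card:
  assumes G: "connected_multigraph G" and l: "l \<ge> 1" and H: "H \<in> copies (cycle_multigraph l) G"
  shows "card (mverts G) \<le> card (medges G)"
proof -
  have fin: "finite (mverts G)" "finite (medges G)" using G by (auto simp: connected_multigraph_def wf_multigraph_def)
  have c: "card (mverts (cycle_multigraph l)) = l" "card (medges (cycle_multigraph l)) = l"
    by (simp_all add: cycle_multigraph_def card_image inj_on_def)
  have sub: "mverts H \<subseteq> mverts G" "medges H \<subseteq> medges G" "wf_multigraph H"
    using H by (auto simp: copies_def submultigraph_def)
  have cH: "card (mverts H) = l" "card (medges H) = l" using copies_iso_card[OF H] c by auto
  have "card (mverts G) = card (mverts G - mverts H) + l"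
  proof -
    have "finite (mverts H)" using sub(1) fin(1) by (rule finite_subset)
    moreover have "card (mverts H) \<le> card (mverts G)" using sub(1) fin(1) by (intro card_mono)
    ultimately show ?thesis using card_Diff_subset[OF _ sub(1)] cH by simp
  qed
  also have "\<dots> \<le> card {x\<in>medges G. \<not> edge_ends x \<subseteq> mverts H} + card (medges H)"
    using cH l sub by (intro add_mono connected_card_edges_outside G) auto
  also have "\<dots> = card ({x\<in>medges G. \<not> edge_ends x \<subseteq> mverts H} \<union> medges H)"
    using sub fin by (intro card_Un_disjoint[symmetric]) (auto simp: wf_multigraph_def)
  also have "\<dots> \<le> card (medges G)" using sub fin by (intro card_mono) auto
  finally show ?thesis .
qed

section \<open>Images of embeddings, and cycles closed by an edge\<close>

abbreviation emb :: "multigraph \<Rightarrow> multigraph \<Rightarrow> ((int \<Rightarrow> int) \<times> (edge \<Rightarrow> edge \<times> bool)) set" where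
  "emb F G \<equiv> embeddings (mverts F) (medges F) edge_source edge_target G"

definition emb_image :: "multigraph \<Rightarrow> (int \<Rightarrow> int) \<times> (edge \<Rightarrow> edge \<times> bool) \<Rightarrow> multigraph" where
  "emb_image F p = \<lparr>mverts = fst p ` mverts F, medges = (\<lambda>x. fst (snd p x)) ` medges F\<rparr>"

lemma dart_ends: "edge_ends (fst d) = {dart_tail d, dart_head d}"
  by (auto simp: edge_ends_def dart_tail_def dart_head_def)

lemma submultigraphI:
  assumes "wf_multigraph G" "V \<subseteq> mverts G" "E \<subseteq> medges G" "\<And>x. x \<in> E \<Longrightarrow> edge_ends x \<subseteq> V"
  shows "submultigraph \<lparr>mverts = V, medges = E\<rparr> G"
  using assms by (auto simp: submultigraph_def wf_multigraph_def intro: finite_subset inj_on_subset)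

lemma emb_image_copies:
  assumes F: "wf_multigraph F" and G: "wf_multigraph G" and p: "p \<in> emb F G"
  shows "emb_image F p \<in> copies F G"
proof -
  obtain f g where fg: "p = (f, g)" by force
  have f: "f \<in> mverts F \<rightarrow>\<^sub>E mverts G" "inj_on f (mverts F)"
    and g: "g \<in> medges F \<rightarrow>\<^sub>E medges G \<times> UNIV" "inj_on (\<lambda>x. fst (g x)) (medges F)"
    and e: "\<And>x. x \<in> medges F \<Longrightarrow> dart_tail (g x) = f (edge_source x) \<and> dart_head (g x) = f (edge_target x)"
    using p by (auto simp: fg embeddings_def)
  have ge: "edge_ends (fst (g x)) = f ` edge_ends x" if "x \<in> medges F" for x
    using e[OF that] unfolding dart_ends by (auto simp: edge_ends_def)
  have gm: "fst (g x) \<in> medges G" if "x \<in> medges F" for x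
    using PiE_mem[OF g(1) that] by auto
  have "submultigraph (emb_image F p) G"
    unfolding emb_image_def
  proof (rule submultigraphI[OF G])
    show "fst p ` mverts F \<subseteq> mverts G" using f by (auto simp: fg)
    show "(\<lambda>x. fst (snd p x)) ` medges F \<subseteq> medges G" using gm by (auto simp: fg)
    fix y assume "y \<in> (\<lambda>x. fst (snd p x)) ` medges F"
    then obtain x where x: "x \<in> medges F" "y = fst (g x)" by (auto simp: fg)
    then have "edge_ends x \<subseteq> mverts F" using F by (auto simp: wf_multigraph_def)
    then show "edge_ends y \<subseteq> fst p ` mverts F" unfolding x(2) ge[OF x(1)] by (auto simp: fg)
  qed
  moreover have "multigraph_iso f (\<lambda>x. fst (g x)) F (emb_image F p)"
    unfolding multigraph_iso_def using f g ge by (auto simp: emb_image_def fg bij_betw_def)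
  ultimately show ?thesis unfolding copies_def isomorphic_def by auto
qed

text \<open>A walk of least length repeats no vertex, as the part between two visits could be cut
  out.\<close>

lemma madj_rtrancl_path:
  assumes "(u, w) \<in> (madj T)\<^sup>*"
  obtains k f where "f 0 = u" "f k = w" "\<And>i. i < k \<Longrightarrow> (f i, f (Suc i)) \<in> madj T" "inj_on f {..k}"
proof -
  let ?R = "madj T"
  define k where "k = (LEAST k. (u, w) \<in> ?R ^^ k)"
  have "\<exists>k. (u, w) \<in> ?R ^^ k" using assms unfolding rtrancl_power .
  then have "(u, w) \<in> ?R ^^ k" unfolding k_def by (rule LeastI_ex)
  then obtain f where f: "f 0 = u" "f k = w" "\<And>i. i < k \<Longrightarrow> (f i, f (Suc i)) \<in> ?R"
    unfolding relpow_fun_conv by blast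
  have seg: "(f i, f j) \<in> ?R ^^ (j - i)" if "i \<le> j" "j \<le> k" for i j
    unfolding relpow_fun_conv using that f(3)
    by (intro exI[of _ "\<lambda>a. f (i + a)"]) auto
  have no: False if ij: "i < j" "j \<le> k" "f i = f j" for i j
  proof -
    have "(u, w) \<in> ?R ^^ (i + (k - j))"
      unfolding relpow_add using seg[of 0 i] seg[of j k] ij f(1,2) by auto
    then have "k \<le> i + (k - j)" unfolding k_def by (rule Least_le)
    then show False using ij by simp
  qed
  have "inj_on f {..k}"
    by (rule inj_onI) (metis atMost_iff no nat_neq_iff)
  with f show ?thesis by (intro that)
qed

lemma cycle_edges: "x \<in> medges (cycle_multigraph l) \<longleftrightarrow> (\<exists>i. 1 \<le> i \<and> i \<le> int l \<and> x = (i, i mod int l + 1, i))"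
  by (auto simp: cycle_multigraph_def)

lemma wf_cycle: "l \<ge> 1 \<Longrightarrow> wf_multigraph (cycle_multigraph l)"
proof -
  assume l: "l \<ge> 1"
  have "i mod int l + 1 \<in> {1..int l}" for i
  proof -
    have l0: "0 < int l" using l by simp
    have "0 \<le> i mod int l" "i mod int l < int l" by (rule pos_mod_sign[OF l0], rule pos_mod_bound[OF l0])
    then show ?thesis unfolding atLeastAtMost_iff by linarith
  qed
  then show ?thesis
    by (auto simp: wf_multigraph_def cycle_multigraph_def edge_ends_def inj_on_def)
qed

text \<open>A simple path within \<open>T\<close> between the ends of \<open>e\<close> is closed by
  \<open>e\<close>, which differs from its edges because it is outside \<open>T\<close>. If
  \<open>e\<close> is a loop, the path has length 0 and the cycle length 1.\<close>

lemma cycle_through_edge: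
  assumes G: "wf_multigraph G" and T: "T \<subseteq> medges G" and e: "e \<in> medges G" "e \<notin> T"
    and path: "(edge_target e, edge_source e) \<in> (madj T)\<^sup>*"
  shows "\<exists>l\<ge>1. copies (cycle_multigraph l) G \<noteq> {}"
proof -
  obtain k f where f: "f 0 = edge_target e" "f k = edge_source e"
    and fe: "\<And>i. i < k \<Longrightarrow> (f i, f (Suc i)) \<in> madj T" and fi: "inj_on f {..k}"
    by (rule madj_rtrancl_path[OF path]) blast
  have "\<forall>i. i < k \<longrightarrow> (\<exists>x\<in>T. edge_ends x = {f i, f (Suc i)})" using fe by auto
  then obtain y where y: "\<And>i. i < k \<Longrightarrow> y i \<in> T \<and> edge_ends (y i) = {f i, f (Suc i)}" by metis
  define l where "l = Suc k"
  define z where "z i = (if i < k then y i else e)" for i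
  have zm: "z i \<in> medges G" for i using y T e by (auto simp: z_def)
  have ze: "edge_ends (z i) = {f i, f (Suc i mod l)}" if "i \<le> k" for i
    using y[of i] that f by (auto simp: z_def l_def edge_ends_def)
  have zi: "i = j" if "i \<le> k" "j \<le> k" "z i = z j" for i j
  proof (cases "i < k \<and> j < k")
    case True
    then have "{f i, f (Suc i)} = {f j, f (Suc j)}" using y that by (metis z_def)
    then consider "f i = f j" | "f i = f (Suc j)" "f (Suc i) = f j" by (auto simp: doubleton_eq_iff)
    then show ?thesis
    proof cases
      case 1 then show ?thesis using fi True by (auto dest: inj_onD)
    next
      case 2
      then have "i = Suc j" "Suc i = j" using fi True by (auto dest: inj_onD)
      then show ?thesis by simp
    qed
  next
    case False
    then show ?thesis using that y e by (auto simp: z_def split: if_splits)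
  qed
  let ?C = "cycle_multigraph l"
  define \<phi> where "\<phi> = (\<lambda>v\<in>mverts ?C. f (nat (v - 1)))"
  \<comment> \<open>Path positions start at 0 and cycle labels at 1, hence the shift. The bit
    records that the edge is used backwards, which is so when its source is not the current path
    vertex.\<close>
  define \<psi> where "\<psi> = (\<lambda>x\<in>medges ?C. (z (nat (edge_label x - 1)),
      edge_source (z (nat (edge_label x - 1))) \<noteq> f (nat (edge_label x - 1))))"
  have fV: "f i \<in> mverts G" if "i \<le> k" for i
    using ze[OF that] zm[of i] G by (auto simp: wf_multigraph_def)
  have "(\<phi>, \<psi>) \<in> emb ?C G"
    unfolding embeddings_def mem_Collect_eq prod.case
  proof (intro conjI ballI)
    show "\<phi> \<in> mverts ?C \<rightarrow>\<^sub>E mverts G"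
      using fV by (auto simp: \<phi>_def cycle_multigraph_def l_def)
    show "inj_on \<phi> (mverts ?C)"
    proof (rule inj_onI)
      fix v w assume "v \<in> mverts ?C" "w \<in> mverts ?C" "\<phi> v = \<phi> w"
      then have "f (nat (v - 1)) = f (nat (w - 1))" "nat (v - 1) \<le> k" "nat (w - 1) \<le> k" "v \<ge> 1" "w \<ge> 1"
        by (auto simp: \<phi>_def cycle_multigraph_def l_def)
      then show "v = w" using fi by (auto dest!: inj_onD)
    qed
    show "\<psi> \<in> medges ?C \<rightarrow>\<^sub>E medges G \<times> UNIV" using zm by (auto simp: \<psi>_def)
    show "inj_on (\<lambda>x. fst (\<psi> x)) (medges ?C)"
    proof (rule inj_onI)
      fix x x' assume x: "x \<in> medges ?C" "x' \<in> medges ?C" "fst (\<psi> x) = fst (\<psi> x')"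
      obtain i i' where i: "x = (i, i mod int l + 1, i)" "1 \<le> i" "i \<le> int l"
        "x' = (i', i' mod int l + 1, i')" "1 \<le> i'" "i' \<le> int l"
        using x(1,2) unfolding cycle_edges by blast
      have "z (nat (i - 1)) = z (nat (i' - 1))" using x i by (simp add: \<psi>_def)
      then have "nat (i - 1) = nat (i' - 1)" using i by (intro zi) (auto simp: l_def)
      then have "i = i'" using i by simp
      then show "x = x'" using i by simp
    qed
    fix x assume x: "x \<in> medges ?C"
    then obtain i where i: "x = (i, i mod int l + 1, i)" "1 \<le> i" "i \<le> int l"
      unfolding cycle_edges by blast
    define j where "j = nat (i - 1)"
    have j: "j \<le> k" "i = int j + 1" using i by (auto simp: j_def l_def)
    have "i mod int l + 1 = int (Suc j mod l) + 1" by (simp add: j zmod_int add.commute)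
    then have x': "x = (int j + 1, int (Suc j mod l) + 1, i)" using i j by simp
    have "Suc j mod l < l" by (simp add: l_def)
    then have m: "int j + 1 \<in> mverts ?C" "int (Suc j mod l) + 1 \<in> mverts ?C"
      using j by (auto simp: cycle_multigraph_def l_def)
    have \<phi>: "\<phi> (edge_source x) = f j" "\<phi> (edge_target x) = f (Suc j mod l)"
      using m by (simp_all add: x' \<phi>_def)
    have \<psi>: "\<psi> x = (z j, edge_source (z j) \<noteq> f j)" using x i by (simp add: \<psi>_def j_def)
    have "{edge_source (z j), edge_target (z j)} = {f j, f (Suc j mod l)}"
      using ze[OF j(1)] by (simp add: edge_ends_def)
    then show "dart_tail (\<psi> x) = \<phi> (edge_source x)" "dart_head (\<psi> x) = \<phi> (edge_target x)"
      unfolding \<phi> \<psi> dart_tail_def dart_head_def by (auto simp: doubleton_eq_iff)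
  qed
  then have "emb_image ?C (\<phi>, \<psi>) \<in> copies ?C G"
    by (intro emb_image_copies G wf_cycle) (auto simp: l_def)
  then show ?thesis by (intro exI[of _ l]) (auto simp: l_def)
qed

text \<open>Trees are defined by the absence of cycles, so the number of edges has to be derived.
  The parent edges \<open>T\<close> of a root connect all vertices, and any further edge would close
  a cycle with them.\<close>

lemma tree_card:
  assumes T: "tree_multigraph G"
  shows "card (mverts G) = card (medges G) + 1"
proof (rule antisym)
  have G: "connected_multigraph G" and nc: "\<And>l. l \<ge> 1 \<Longrightarrow> copies (cycle_multigraph l) G = {}"
    using T by (auto simp: tree_multigraph_def)
  show "card (mverts G) \<le> card (medges G) + 1" by (rule connected_card_le[OF G])
  have wf: "wf_multigraph G" using G by (simp add: connected_multigraph_def)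
  have fin: "finite (mverts G)" "finite (medges G)" using wf by (auto simp: wf_multigraph_def)
  obtain r where r: "r \<in> mverts G" using G by (auto simp: connected_multigraph_def)
  obtain x p and d :: "int \<Rightarrow> nat" where *: "\<And>v. v \<in> mverts G - {r} \<Longrightarrow>
    x v \<in> medges G \<and> edge_ends (x v) = {p v, v} \<and> p v \<in> mverts G \<and> d (p v) < d v"
    using connected_parent_edges[OF G, of "{r}"] r by (metis empty_subsetI insert_not_empty insert_subset)
  define T where "T = x ` (mverts G - {r})"
  have conn: "(r, v) \<in> (madj T)\<^sup>*" if "v \<in> mverts G" for v
    using that
  proof (induction "d v" arbitrary: v rule: less_induct)
    case less
    show ?case
    proof (cases "v = r")
      case False
      then have v: "v \<in> mverts G - {r}" using less.prems by simp
      then have "(r, p v) \<in> (madj T)\<^sup>*" using *[OF v] by (intro less.hyps) auto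
      moreover have "(p v, v) \<in> madj T" using *[OF v] v unfolding T_def by blast
      ultimately show ?thesis by (rule rtrancl_into_rtrancl)
    qed simp
  qed
  have "medges G \<subseteq> T"
  proof
    fix e assume e: "e \<in> medges G"
    show "e \<in> T"
    proof (rule ccontr)
      assume "e \<notin> T"
      have "edge_source e \<in> mverts G" "edge_target e \<in> mverts G"
        using e wf by (auto simp: wf_multigraph_def edge_ends_def)
      then have "(edge_target e, edge_source e) \<in> (madj T)\<^sup>*"
        using conn madj_rtrancl_sym by (meson rtrancl_trans)
      moreover have "T \<subseteq> medges G" unfolding T_def using * by blast
      ultimately show False using cycle_through_edge[OF wf _ e \<open>e \<notin> T\<close>] nc by blast
    qed
  qed
  then have "card (medges G) \<le> card T" using fin by (intro card_mono) (auto simp: T_def)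
  also have "\<dots> \<le> card (mverts G - {r})" unfolding T_def using fin by (intro card_image_le) auto
  finally show "card (medges G) + 1 \<le> card (mverts G)"
    using card_Suc_Diff1[OF fin(1) r] by simp
qed

lemma tree_loopless:
  assumes T: "tree_multigraph G" and e: "e \<in> medges G"
  shows "edge_source e \<noteq> edge_target e"
proof
  assume "edge_source e = edge_target e"
  then have "(edge_target e, edge_source e) \<in> (madj {})\<^sup>*" by simp
  then have "\<exists>l\<ge>1. copies (cycle_multigraph l) G \<noteq> {}"
    using T e by (intro cycle_through_edge[of G "{}" e]) (auto simp: tree_multigraph_def connected_multigraph_def)
  then show False using T by (auto simp: tree_multigraph_def)
qed

lemma connected_not_tree_not_unicycle:
  assumes "connected_multigraph F" "\<not> tree_multigraph F" "\<not> unicycle F"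
  shows "card (mverts F) < card (medges F)"
proof -
  obtain l where "l \<ge> 1" "copies (cycle_multigraph l) F \<noteq> {}"
    using assms by (auto simp: tree_multigraph_def)
  then have "card (mverts F) \<le> card (medges F)" using connected_cycle_card[OF assms(1)] by blast
  then show ?thesis using assms by (auto simp: unicycle_def)
qed

section \<open>Embeddings and copies\<close>

lemma finite_embeddings:
  assumes "finite V" "finite E" "wf_multigraph G"
  shows "finite (embeddings V E s t G)"
proof (rule finite_subset)
  show "embeddings V E s t G \<subseteq> (V \<rightarrow>\<^sub>E mverts G) \<times> (E \<rightarrow>\<^sub>E medges G \<times> UNIV)"
    by (auto simp: embeddings_def)
  show "finite ((V \<rightarrow>\<^sub>E mverts G) \<times> (E \<rightarrow>\<^sub>E medges G \<times> (UNIV :: bool set)))"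
    using assms by (intro finite_cartesian_product finite_PiE) (auto simp: wf_multigraph_def)
qed

lemma multigraph_iso_inv:
  assumes iso: "multigraph_iso \<alpha> \<beta> F H" and F: "wf_multigraph F"
  shows "multigraph_iso (inv_into (mverts F) \<alpha>) (inv_into (medges F) \<beta>) H F"
proof -
  have \<alpha>: "bij_betw \<alpha> (mverts F) (mverts H)" and \<beta>: "bij_betw \<beta> (medges F) (medges H)"
    and e: "\<And>x. x \<in> medges F \<Longrightarrow> edge_ends (\<beta> x) = \<alpha> ` edge_ends x"
    using iso by (auto simp: multigraph_iso_def)
  have "edge_ends (inv_into (medges F) \<beta> y) = inv_into (mverts F) \<alpha> ` edge_ends y" if y: "y \<in> medges H" for y
  proof -
    define x where "x = inv_into (medges F) \<beta> y"
    have x: "x \<in> medges F" "y = \<beta> x"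
      using y \<beta> by (auto simp: x_def bij_betw_def inv_into_into f_inv_into_f)
    have "edge_ends x \<subseteq> mverts F" using x F by (auto simp: wf_multigraph_def)
    then have "inv_into (mverts F) \<alpha> ` \<alpha> ` edge_ends x = edge_ends x"
      using \<alpha> by (intro inv_into_image_cancel) (auto simp: bij_betw_def)
    then have "edge_ends x = inv_into (mverts F) \<alpha> ` edge_ends y" using e[OF x(1)] x(2) by simp
    then show ?thesis unfolding x_def .
  qed
  then show ?thesis
    using bij_betw_inv_into[OF \<alpha>] bij_betw_inv_into[OF \<beta>] by (simp add: multigraph_iso_def)
qed

lemma card_embeddings_iso_le:
  assumes fin: "finite V" "finite E" and H: "wf_multigraph H"
    and ends: "s ` E \<subseteq> V" "t ` E \<subseteq> V" and iso: "multigraph_iso \<alpha> \<beta> F H"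
  shows "card (embeddings V E s t F) \<le> card (embeddings V E s t H)"
proof -
  have \<alpha>: "inj_on \<alpha> (mverts F)" "\<alpha> ` mverts F = mverts H"
    and \<beta>: "inj_on \<beta> (medges F)" "\<beta> ` medges F = medges H"
    and e: "\<And>x. x \<in> medges F \<Longrightarrow> edge_ends (\<beta> x) = \<alpha> ` edge_ends x"
    using iso by (auto simp: multigraph_iso_def bij_betw_def)
  \<comment> \<open>An isomorphism may reverse edges, since it only respects their sets of ends. The
    direction bit is flipped exactly for the reversed edges and kept for loops.\<close>
  define \<gamma> where "\<gamma> d = (\<beta> (fst d), snd d \<noteq> (edge_source (\<beta> (fst d)) \<noteq> \<alpha> (edge_source (fst d))))" for d
  have \<gamma>: "dart_tail (\<gamma> d) = \<alpha> (dart_tail d) \<and> dart_head (\<gamma> d) = \<alpha> (dart_head d)"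
    if "fst d \<in> medges F" for d
    using e[OF that] by (auto simp: \<gamma>_def dart_tail_def dart_head_def edge_ends_def doubleton_eq_iff)
  have \<gamma>i: "d = d'" if "fst d \<in> medges F" "fst d' \<in> medges F" "\<gamma> d = \<gamma> d'" for d d'
  proof -
    have "fst d = fst d'" using that \<beta>(1) by (auto simp: \<gamma>_def dest: inj_onD)
    moreover have "snd d = snd d'" using that(3) \<open>fst d = fst d'\<close> by (simp add: \<gamma>_def) blast
    ultimately show ?thesis by (rule prod_eqI)
  qed
  define \<Phi> where "\<Phi> p = (\<lambda>v\<in>V. \<alpha> (fst p v), \<lambda>x\<in>E. \<gamma> (snd p x))" for p :: "('a \<Rightarrow> int) \<times> ('b \<Rightarrow> edge \<times> bool)"
  show ?thesis
  proof (rule card_inj_on_le)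
    show "finite (embeddings V E s t H)" by (rule finite_embeddings[OF fin H])
    show "inj_on \<Phi> (embeddings V E s t F)"
    proof (rule inj_onI)
      fix p p' assume p: "p \<in> embeddings V E s t F" "p' \<in> embeddings V E s t F" and eq: "\<Phi> p = \<Phi> p'"
      obtain f g f' g' where pp: "p = (f, g)" "p' = (f', g')" by force
      have f: "f \<in> V \<rightarrow>\<^sub>E mverts F" "f' \<in> V \<rightarrow>\<^sub>E mverts F"
        and g: "g \<in> E \<rightarrow>\<^sub>E medges F \<times> UNIV" "g' \<in> E \<rightarrow>\<^sub>E medges F \<times> UNIV"
        using p by (auto simp: pp embeddings_def)
      have "f = f'"
      proof (rule PiE_ext[OF f])
        fix v assume v: "v \<in> V"
        then have "\<alpha> (f v) = \<alpha> (f' v)" using eq by (auto simp: \<Phi>_def pp dest!: fun_cong[of _ _ v])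
        then show "f v = f' v" using \<alpha>(1) PiE_mem[OF f(1) v] PiE_mem[OF f(2) v] by (auto dest: inj_onD)
      qed
      moreover have "g = g'"
      proof (rule PiE_ext[OF g])
        fix x assume x: "x \<in> E"
        then have "\<gamma> (g x) = \<gamma> (g' x)" using eq by (auto simp: \<Phi>_def pp dest!: fun_cong[of _ _ x])
        then show "g x = g' x" using PiE_mem[OF g(1) x] PiE_mem[OF g(2) x] \<gamma>i[of "g x" "g' x"] by auto
      qed
      ultimately show "p = p'" by (simp add: pp)
    qed
    show "\<Phi> ` embeddings V E s t F \<subseteq> embeddings V E s t H"
    proof
      fix q assume "q \<in> \<Phi> ` embeddings V E s t F"
      then obtain f g where p: "(f, g) \<in> embeddings V E s t F" and q: "q = \<Phi> (f, g)" by force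
      have f: "f \<in> V \<rightarrow>\<^sub>E mverts F" "inj_on f V"
        and g: "g \<in> E \<rightarrow>\<^sub>E medges F \<times> UNIV" "inj_on (\<lambda>x. fst (g x)) E"
        and fg: "\<And>x. x \<in> E \<Longrightarrow> dart_tail (g x) = f (s x) \<and> dart_head (g x) = f (t x)"
        using p by (auto simp: embeddings_def)
      have gm: "fst (g x) \<in> medges F" if "x \<in> E" for x using PiE_mem[OF g(1) that] by auto
      have "inj_on (\<lambda>v. \<alpha> (f v)) V"
        using comp_inj_on[OF f(2) inj_on_subset[OF \<alpha>(1)]] f(1) by (auto simp: comp_def)
      moreover have "inj_on (\<lambda>x. \<beta> (fst (g x))) E"
        using comp_inj_on[OF g(2) inj_on_subset[OF \<beta>(1)]] gm by (auto simp: comp_def)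
      moreover have "\<alpha> (f v) \<in> mverts H" if "v \<in> V" for v using PiE_mem[OF f(1) that] \<alpha>(2) by auto
      moreover have "\<beta> (fst (g x)) \<in> medges H" if "x \<in> E" for x using gm[OF that] \<beta>(2) by auto
      moreover have "s x \<in> V \<and> t x \<in> V" if x: "x \<in> E" for x
        using x ends by blast
      ultimately show "q \<in> embeddings V E s t H"
        unfolding q \<Phi>_def embeddings_def using fg \<gamma> gm
        by (auto simp: \<gamma>_def inj_on_def)
    qed
  qed
qed


lemma card_embeddings_iso:
  assumes fin: "finite V" "finite E" and ends: "s ` E \<subseteq> V" "t ` E \<subseteq> V"
    and F: "wf_multigraph F" and H: "wf_multigraph H" and iso: "multigraph_iso \<alpha> \<beta> F H"
  shows "card (embeddings V E s t F) = card (embeddings V E s t H)"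
  using card_embeddings_iso_le[OF fin H ends iso]
    card_embeddings_iso_le[OF fin F ends multigraph_iso_inv[OF iso F]] by simp

lemma wf_multigraph_ends:
  assumes "wf_multigraph F"
  shows "finite (mverts F)" "finite (medges F)"
    "edge_source ` medges F \<subseteq> mverts F" "edge_target ` medges F \<subseteq> mverts F"
  using assms by (auto simp: wf_multigraph_def edge_ends_def)

lemma multigraph_eqI: "mverts G = mverts H \<Longrightarrow> medges G = medges H \<Longrightarrow> G = (H :: multigraph)"
  by (rule multigraph.equality) auto

lemma finite_submultigraphs:
  assumes "wf_multigraph G"
  shows "finite {H. submultigraph H G}"
    "card {H. submultigraph H G} \<le> 2 ^ card (mverts G) * 2 ^ card (medges G)"
proof -
  let ?q = "\<lambda>H :: multigraph. (mverts H, medges H)"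
  have fin: "finite (mverts G)" "finite (medges G)" using assms by (auto simp: wf_multigraph_def)
  have inj: "inj_on ?q {H. submultigraph H G}" by (auto intro!: inj_onI multigraph_eqI)
  have sub: "?q ` {H. submultigraph H G} \<subseteq> Pow (mverts G) \<times> Pow (medges G)"
    by (auto simp: submultigraph_def)
  have finP: "finite (Pow (mverts G) \<times> Pow (medges G))" using fin by simp
  show "finite {H. submultigraph H G}" using inj sub finP by (rule inj_on_finite)
  have "card {H. submultigraph H G} \<le> card (Pow (mverts G) \<times> Pow (medges G))"
    using inj sub finP by (rule card_inj_on_le)
  then show "card {H. submultigraph H G} \<le> 2 ^ card (mverts G) * 2 ^ card (medges G)"
    using fin by (simp add: card_cartesian_product card_Pow)
qed

lemma finite_copies: "wf_multigraph G \<Longrightarrow> finite (copies F G)"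
  using finite_submultigraphs(1) by (rule finite_subset[rotated]) (auto simp: copies_def)

lemma copies_wf: "H \<in> copies F G \<Longrightarrow> wf_multigraph H"
  by (auto simp: copies_def submultigraph_def)

lemma emb_copy_subset: "H \<in> copies F G \<Longrightarrow> emb F H \<subseteq> emb F G"
proof
  fix p assume H: "H \<in> copies F G" and p: "p \<in> emb F H"
  obtain f g where fg: "p = (f, g)" by force
  have sub: "mverts H \<subseteq> mverts G" "medges H \<times> UNIV \<subseteq> medges G \<times> (UNIV :: bool set)"
    using H by (auto simp: copies_def submultigraph_def)
  have "f \<in> mverts F \<rightarrow>\<^sub>E mverts G" "g \<in> medges F \<rightarrow>\<^sub>E medges G \<times> UNIV"
  proof -
    have "f \<in> mverts F \<rightarrow>\<^sub>E mverts H" "g \<in> medges F \<rightarrow>\<^sub>E medges H \<times> UNIV"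
      using p by (simp_all add: fg embeddings_def)
    then show "f \<in> mverts F \<rightarrow>\<^sub>E mverts G" "g \<in> medges F \<rightarrow>\<^sub>E medges G \<times> UNIV"
      using PiE_mono[of "mverts F" "\<lambda>_. mverts H" "\<lambda>_. mverts G", OF sub(1)]
        PiE_mono[of "medges F" "\<lambda>_. medges H \<times> UNIV" "\<lambda>_. medges G \<times> UNIV", OF sub(2)] by blast+
  qed
  then show "p \<in> emb F G" using p by (simp add: fg embeddings_def)
qed

lemma emb_image_copy:
  assumes H: "H \<in> copies F G" and p: "p \<in> emb F H"
  shows "emb_image F p = H"
proof -
  obtain f g where fg: "p = (f, g)" by force
  have f: "f \<in> mverts F \<rightarrow>\<^sub>E mverts H" "inj_on f (mverts F)"
    and g: "g \<in> medges F \<rightarrow>\<^sub>E medges H \<times> UNIV" "inj_on (\<lambda>x. fst (g x)) (medges F)"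
    using p by (auto simp: fg embeddings_def)
  have finH: "finite (mverts H)" "finite (medges H)" using copies_wf[OF H] by (auto simp: wf_multigraph_def)
  have "f ` mverts F = mverts H"
    using f finH copies_iso_card(1)[OF H] by (intro card_subset_eq) (auto simp: card_image)
  moreover have "(\<lambda>x. fst (g x)) ` medges F = medges H"
  proof (rule card_subset_eq)
    show "(\<lambda>x. fst (g x)) ` medges F \<subseteq> medges H" using PiE_mem[OF g(1)] by fastforce
  qed (use g finH copies_iso_card(2)[OF H] in \<open>auto simp: card_image\<close>)
  ultimately show ?thesis by (intro multigraph_eqI) (simp_all add: emb_image_def fg)
qed

lemma emb_in_own_image:
  assumes "p \<in> emb F G"
  shows "p \<in> emb F (emb_image F p)"
proof -
  obtain f g where fg: "p = (f, g)" by force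
  have fg': "f \<in> mverts F \<rightarrow>\<^sub>E mverts G" "g \<in> medges F \<rightarrow>\<^sub>E medges G \<times> UNIV"
    using assms by (simp_all add: fg embeddings_def)
  have "f \<in> mverts F \<rightarrow>\<^sub>E f ` mverts F"
    using fg'(1) by (auto simp: PiE_def)
  moreover have "g \<in> medges F \<rightarrow>\<^sub>E (\<lambda>x. fst (g x)) ` medges F \<times> UNIV"
    using fg'(2) by (auto simp: PiE_def mem_Times_iff)
  ultimately show ?thesis using assms by (simp add: fg embeddings_def emb_image_def)
qed

lemma card_emb_copy:
  assumes F: "wf_multigraph F" and H: "H \<in> copies F G"
  shows "card (emb F H) = card (emb F F)"
proof -
  obtain \<alpha> \<beta> where "multigraph_iso \<alpha> \<beta> F H" using H by (auto simp: copies_def isomorphic_def)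
  then show ?thesis
    using card_embeddings_iso[OF wf_multigraph_ends[OF F] F copies_wf[OF H]] by metis
qed

text \<open>The image of an embedding is the only copy into which it maps, and every copy receives
  as many embeddings as \<open>F\<close> has into itself.\<close>

lemma card_emb:
  assumes F: "wf_multigraph F" and G: "wf_multigraph G"
  shows "card (emb F G) = card (emb F F) * subgraph_count F G"
proof -
  have "emb F G = (\<Union>H\<in>copies F G. emb F H)"
  proof (intro equalityI subsetI)
    fix p assume "p \<in> emb F G"
    then show "p \<in> (\<Union>H\<in>copies F G. emb F H)"
      using emb_image_copies[OF F G] emb_in_own_image by (intro UN_I)
  next
    fix p assume "p \<in> (\<Union>H\<in>copies F G. emb F H)"
    then obtain H where H: "H \<in> copies F G" "p \<in> emb F H" by (rule UN_E)
    show "p \<in> emb F G" by (rule subsetD[OF emb_copy_subset[OF H(1)] H(2)])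
  qed
  also have "card \<dots> = (\<Sum>H\<in>copies F G. card (emb F H))"
  proof (rule card_UN_disjoint[OF finite_copies[OF G]])
    show "\<forall>H\<in>copies F G. finite (emb F H)"
      by (intro ballI finite_embeddings wf_multigraph_ends[OF F] copies_wf)
    show "\<forall>H\<in>copies F G. \<forall>H'\<in>copies F G. H \<noteq> H' \<longrightarrow> emb F H \<inter> emb F H' = {}"
      using emb_image_copy[of _ F G] by (metis (no_types, lifting) disjoint_iff)
  qed
  also have "\<dots> = (\<Sum>H\<in>copies F G. card (emb F F))" by (intro sum.cong refl card_emb_copy F)
  finally show ?thesis by (simp add: subgraph_count_def)
qed

text \<open>Without loops the ends of an edge have distinct images, so the direction bit is forced
  by the vertex map and carries no information. The two maps of the bijection also convert between
  the conventions outside the domain: identity for permutations, \<open>undefined\<close> for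
  embeddings.\<close>

lemma card_emb_loopless:
  assumes F: "wf_multigraph F" and loopless: "\<And>x. x \<in> medges F \<Longrightarrow> edge_source x \<noteq> edge_target x"
  shows "card (emb F F) = aut F"
proof -
  let ?A = "{(f, g). f permutes mverts F \<and> g permutes medges F \<and> multigraph_iso f g F F}"
  let ?\<Phi> = "\<lambda>(f, g). (restrict f (mverts F), \<lambda>x\<in>medges F. (g x, edge_source (g x) \<noteq> f (edge_source x)))"
  let ?\<Psi> = "\<lambda>(f, g). (\<lambda>v. if v \<in> mverts F then f v else v, \<lambda>x. if x \<in> medges F then fst (g x) else x)"
  have src: "edge_source x \<in> mverts F" "edge_target x \<in> mverts F" if "x \<in> medges F" for x
    using that wf_multigraph_ends[OF F] by auto
  have "bij_betw ?\<Phi> ?A (emb F F)"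
  proof (rule bij_betw_byWitness[where f' = ?\<Psi>])
    show "\<forall>a\<in>?A. ?\<Psi> (?\<Phi> a) = a"
      by (auto simp: fun_eq_iff permutes_def)
    show "\<forall>p\<in>emb F F. ?\<Phi> (?\<Psi> p) = p"
    proof
      fix p assume p: "p \<in> emb F F"
      obtain f g where fg: "p = (f, g)" by force
      have f: "f \<in> mverts F \<rightarrow>\<^sub>E mverts F" "inj_on f (mverts F)"
        and g: "g \<in> medges F \<rightarrow>\<^sub>E medges F \<times> UNIV"
        and e: "\<And>x. x \<in> medges F \<Longrightarrow> dart_tail (g x) = f (edge_source x) \<and> dart_head (g x) = f (edge_target x)"
        using p by (auto simp: fg embeddings_def)
      have "restrict (\<lambda>v. if v \<in> mverts F then f v else v) (mverts F) = f"
        using f by (intro extensionalityI[where A = "mverts F"]) (auto simp: PiE_def)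
      moreover have "(\<lambda>x\<in>medges F. (if x \<in> medges F then fst (g x) else x,
          edge_source (if x \<in> medges F then fst (g x) else x) \<noteq>
          (if edge_source x \<in> mverts F then f (edge_source x) else edge_source x))) = g"
      proof (rule extensionalityI[where A = "medges F"])
        show "g \<in> extensional (medges F)" using g by (simp add: PiE_def)
        fix x assume x: "x \<in> medges F"
        have "f (edge_source x) \<noteq> f (edge_target x)"
          using f(2) src[OF x] loopless[OF x] by (auto dest: inj_onD)
        then have "snd (g x) \<longleftrightarrow> edge_source (fst (g x)) \<noteq> f (edge_source x)"
          using e[OF x] by (auto simp: dart_tail_def dart_head_def split: if_splits)
        then show "(\<lambda>x\<in>medges F. (if x \<in> medges F then fst (g x) else x,
          edge_source (if x \<in> medges F then fst (g x) else x) \<noteq>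
          (if edge_source x \<in> mverts F then f (edge_source x) else edge_source x))) x = g x"
          using x src[OF x] by (simp add: prod_eq_iff)
      qed simp
      ultimately show "?\<Phi> (?\<Psi> p) = p" by (simp only: fg prod.case)
    qed
    show "?\<Phi> ` ?A \<subseteq> emb F F"
    proof
      fix q assume "q \<in> ?\<Phi> ` ?A"
      then obtain f g where f: "f permutes mverts F" and g: "g permutes medges F"
        and iso: "multigraph_iso f g F F" and q: "q = ?\<Phi> (f, g)" by auto
      have e: "{edge_source (g x), edge_target (g x)} = {f (edge_source x), f (edge_target x)}"
        if "x \<in> medges F" for x
        using iso that by (auto simp: multigraph_iso_def edge_ends_def)
      show "q \<in> emb F F"
        unfolding q embeddings_def prod.case mem_Collect_eq
      proof (intro conjI ballI)
        show "restrict f (mverts F) \<in> mverts F \<rightarrow>\<^sub>E mverts F" using f by (auto simp: permutes_in_image)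
        show "inj_on (restrict f (mverts F)) (mverts F)" using permutes_inj[OF f] by (simp add: inj_on_def)
        show "(\<lambda>x\<in>medges F. (g x, edge_source (g x) \<noteq> f (edge_source x))) \<in> medges F \<rightarrow>\<^sub>E medges F \<times> UNIV"
          by (intro restrict_PiE_iff[THEN iffD2]) (simp add: permutes_in_image[OF g])
        show "inj_on (\<lambda>x. fst ((\<lambda>x\<in>medges F. (g x, edge_source (g x) \<noteq> f (edge_source x))) x)) (medges F)"
        proof (rule inj_onI)
          fix x y assume "x \<in> medges F" "y \<in> medges F"
            "fst ((\<lambda>x\<in>medges F. (g x, edge_source (g x) \<noteq> f (edge_source x))) x)
            = fst ((\<lambda>x\<in>medges F. (g x, edge_source (g x) \<noteq> f (edge_source x))) y)"
          then have "g x = g y" by simp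
          then show "x = y" by (rule injD[OF permutes_inj[OF g]])
        qed
        fix x assume x: "x \<in> medges F"
        show "dart_tail ((\<lambda>x\<in>medges F. (g x, edge_source (g x) \<noteq> f (edge_source x))) x) = restrict f (mverts F) (edge_source x)"
          "dart_head ((\<lambda>x\<in>medges F. (g x, edge_source (g x) \<noteq> f (edge_source x))) x) = restrict f (mverts F) (edge_target x)"
          using x e[OF x] src[OF x] by (auto simp: dart_tail_def dart_head_def doubleton_eq_iff)
      qed
    qed
    show "?\<Psi> ` emb F F \<subseteq> ?A"
    proof
      fix q assume "q \<in> ?\<Psi> ` emb F F"
      then obtain f g where p: "(f, g) \<in> emb F F" and q: "q = ?\<Psi> (f, g)" by auto
      have f: "f \<in> mverts F \<rightarrow>\<^sub>E mverts F" "inj_on f (mverts F)"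
        and g: "g \<in> medges F \<rightarrow>\<^sub>E medges F \<times> UNIV" "inj_on (\<lambda>x. fst (g x)) (medges F)"
        and e: "\<And>x. x \<in> medges F \<Longrightarrow> dart_tail (g x) = f (edge_source x) \<and> dart_head (g x) = f (edge_target x)"
        using p by (auto simp: embeddings_def)
      have gm: "fst (g x) \<in> medges F" if "x \<in> medges F" for x using PiE_mem[OF g(1) that] by auto
      define f' where "f' = (\<lambda>v. if v \<in> mverts F then f v else v)"
      define g' where "g' = (\<lambda>x. if x \<in> medges F then fst (g x) else x)"
      have f': "bij_betw f' (mverts F) (mverts F)"
        unfolding f'_def bij_betw_def using f wf_multigraph_ends(1)[OF F]
        by (intro conjI endo_inj_surj) (auto simp: inj_on_def)
      have g': "bij_betw g' (medges F) (medges F)"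
        unfolding g'_def bij_betw_def using g gm wf_multigraph_ends(2)[OF F]
        by (intro conjI endo_inj_surj) (auto simp: inj_on_def)
      have "f' permutes mverts F" using f' by (rule bij_imp_permutes) (simp add: f'_def)
      moreover have "g' permutes medges F" using g' by (rule bij_imp_permutes) (simp add: g'_def)
      moreover have "edge_ends (g' x) = f' ` edge_ends x" if x: "x \<in> medges F" for x
      proof -
        have "edge_ends (g' x) = {f (edge_source x), f (edge_target x)}"
          using x e[OF x] dart_ends[of "g x"] by (simp add: g'_def)
        then show ?thesis using src[OF x] by (simp add: f'_def edge_ends_def)
      qed
      ultimately show "q \<in> ?A" using f' g'
        unfolding q f'_def g'_def multigraph_iso_def by simp
    qed
  qed
  from bij_betw_same_card[OF this] show ?thesis unfolding aut_def by simp
qed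

section \<open>Cycles\<close>

text \<open>The representative of \<open>i\<close> modulo \<open>l\<close> in
  \<open>{1..int l}\<close>. Indexing the cycle by all integers lets rotations and reflections be
  written without case distinctions.\<close>

definition cvert :: "nat \<Rightarrow> int \<Rightarrow> int" where
  "cvert l i = (i - 1) mod int l + 1"

definition cedge :: "nat \<Rightarrow> int \<Rightarrow> edge" where
  "cedge l i = (cvert l i, cvert l (i + 1), cvert l i)"

lemma cvert_range: "l \<ge> 1 \<Longrightarrow> cvert l i \<in> {1..int l}"
proof -
  assume l: "l \<ge> 1"
  have l0: "0 < int l" using l by simp
  have "0 \<le> (i - 1) mod int l" "(i - 1) mod int l < int l"
    by (rule pos_mod_sign[OF l0], rule pos_mod_bound[OF l0])
  then show ?thesis unfolding cvert_def atLeastAtMost_iff by linarith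
qed

lemma cvert_id: "i \<in> {1..int l} \<Longrightarrow> cvert l i = i"
  by (simp add: cvert_def)

lemma cvert_eq_iff: "cvert l i = cvert l j \<longleftrightarrow> int l dvd i - j"
  by (simp add: cvert_def mod_eq_dvd_iff)

lemma cvert_shift: "cvert l i = cvert l j \<Longrightarrow> cvert l (i + c) = cvert l (j + c)"
  by (simp add: cvert_eq_iff)

lemma cvert_reflect: "cvert l i = cvert l j \<Longrightarrow> cvert l (c - i) = cvert l (c - j)"
  by (simp add: cvert_eq_iff dvd_diff_commute)

lemma cvert_cvert: "l \<ge> 1 \<Longrightarrow> cvert l (cvert l i) = cvert l i"
  using cvert_id cvert_range by blast

lemma cvert_cvert_add: "l \<ge> 1 \<Longrightarrow> cvert l (cvert l i + c) = cvert l (i + c)"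
  by (rule cvert_shift) (rule cvert_cvert)

lemma cvert_diff_cvert: "l \<ge> 1 \<Longrightarrow> cvert l (c - cvert l i) = cvert l (c - i)"
  by (rule cvert_reflect) (rule cvert_cvert)

lemma cedge_eq_iff: "cedge l i = cedge l j \<longleftrightarrow> cvert l i = cvert l j"
  using cvert_shift[of l i j 1] by (auto simp: cedge_def)

lemma cedge_simps [simp]:
  "edge_source (cedge l i) = cvert l i" "edge_target (cedge l i) = cvert l (i + 1)"
  "edge_label (cedge l i) = cvert l i"
  by (simp_all add: cedge_def)

lemma mverts_cycle: "mverts (cycle_multigraph l) = {1..int l}"
  by (simp add: cycle_multigraph_def)

lemma medges_cycle: "medges (cycle_multigraph l) = cedge l ` {1..int l}"
proof -
  have "(i, i mod int l + 1, i) = cedge l i" if "i \<in> {1..int l}" for i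
    using cvert_id[OF that] by (simp add: cedge_def) (simp add: cvert_def)
  then have "(\<lambda>i. (i, i mod int l + 1, i)) ` {1..int l} = cedge l ` {1..int l}"
    by (rule image_cong[OF refl])
  then show ?thesis by (simp add: cycle_multigraph_def)
qed

lemma cedge_in: "l \<ge> 1 \<Longrightarrow> cedge l i \<in> medges (cycle_multigraph l)"
proof -
  assume l: "l \<ge> 1"
  have "cedge l i = cedge l (cvert l i)" using cvert_cvert[OF l] by (simp add: cedge_eq_iff)
  then show ?thesis using cvert_range[OF l] by (simp add: medges_cycle)
qed

lemma card_medges_cycle: "card (medges (cycle_multigraph l)) = l"
  unfolding medges_cycle
  by (subst card_image) (auto intro!: inj_onI simp: cedge_eq_iff cvert_id)

text \<open>The rotations and reflections of the cycle carry its first edge to every dart.\<close>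

lemma cycle_embeddings_witness:
  assumes l: "l \<ge> 1"
  shows "\<exists>p\<in>emb (cycle_multigraph l) (cycle_multigraph l). snd p (cedge l 1) = (cedge l j, b)"
proof -
  let ?C = "cycle_multigraph l"
  \<comment> \<open>Without \<open>b\<close> a rotation by \<open>j - 1\<close>. With
    \<open>b\<close> a reflection taking vertex 1 to \<open>j + 1\<close> and vertex 2 to
    \<open>j\<close>, so that edge 1 is mapped to edge \<open>j\<close> reversed.\<close>
  define f where "f = (\<lambda>v\<in>mverts ?C. if b then cvert l (j + 2 - v) else cvert l (v + (j - 1)))"
  define g where "g = (\<lambda>x\<in>medges ?C. (if b then cedge l (j + 1 - edge_label x) else cedge l (edge_label x + (j - 1)), b))"
  have fc: "f (cvert l i) = (if b then cvert l (j + 2 - i) else cvert l (i + (j - 1)))" for i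
    using cvert_range[OF l] cvert_diff_cvert[OF l] cvert_cvert_add[OF l] by (simp add: f_def mverts_cycle)
  have gc: "g (cedge l i) = (if b then cedge l (j + 1 - i) else cedge l (i + (j - 1)), b)" for i
    using cedge_in[OF l] cvert_diff_cvert[OF l] cvert_cvert_add[OF l] by (simp add: g_def cedge_eq_iff)
  have inj: "cvert l i = cvert l k"
    if "(if b then cvert l (c - i) else cvert l (i + c')) = (if b then cvert l (c - k) else cvert l (k + c'))" for i k c c'
    using that by (auto simp: cvert_eq_iff dvd_diff_commute split: if_splits)
  have "(f, g) \<in> emb ?C ?C"
    unfolding embeddings_def mem_Collect_eq prod.case
  proof (intro conjI ballI)
    show "f \<in> mverts ?C \<rightarrow>\<^sub>E mverts ?C"
      unfolding f_def restrict_PiE_iff mverts_cycle using cvert_range[OF l] by simp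
    show "inj_on f (mverts ?C)"
    proof (rule inj_onI)
      fix v w assume v: "v \<in> mverts ?C" and w: "w \<in> mverts ?C" and "f v = f w"
      then have "cvert l v = cvert l w"
        using fc[of v] fc[of w] by (intro inj[of "j + 2" v "j - 1" w]) (simp add: cvert_id mverts_cycle)
      then show "v = w" using v w by (simp add: cvert_id mverts_cycle)
    qed
    show "g \<in> medges ?C \<rightarrow>\<^sub>E medges ?C \<times> UNIV"
      unfolding g_def restrict_PiE_iff using cedge_in[OF l] by simp
    show "inj_on (\<lambda>x. fst (g x)) (medges ?C)"
    proof (rule inj_onI)
      fix x y assume "x \<in> medges ?C" "y \<in> medges ?C" and eq: "fst (g x) = fst (g y)"
      then obtain i k where x: "x = cedge l i" and y: "y = cedge l k" by (auto simp: medges_cycle)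
      have "cvert l i = cvert l k"
        using eq unfolding x y gc by (intro inj[of "j + 1" i "j - 1" k]) (simp add: cedge_eq_iff split: if_splits)
      then show "x = y" by (simp add: x y cedge_eq_iff)
    qed
    fix x assume "x \<in> medges ?C"
    then obtain i where x: "x = cedge l i" by (auto simp: medges_cycle)
    show "dart_tail (g x) = f (edge_source x)" "dart_head (g x) = f (edge_target x)"
      unfolding x cedge_simps fc gc by (simp_all add: dart_tail_def dart_head_def algebra_simps)
  qed
  moreover have "snd (f, g) (cedge l 1) = (cedge l j, b)" using gc[of 1] by simp
  ultimately show ?thesis by blast
qed

text \<open>Only two edge ends meet at a vertex of the cycle, so a traversal that may not reuse its
  last edge has one continuation, in the same direction of rotation.\<close>

lemma cycle_next_dart_unique:
  assumes d0: "fst d0 \<in> medges (cycle_multigraph l)"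
    and d: "fst d \<in> medges (cycle_multigraph l)" "fst d \<noteq> fst d0" "dart_tail d = dart_head d0"
    and d': "fst d' \<in> medges (cycle_multigraph l)" "fst d' \<noteq> fst d0" "dart_tail d' = dart_head d0"
  shows "d = d'"
proof -
  obtain k b0 where e0: "d0 = (cedge l k, b0)" using d0 by (cases d0) (auto simp: medges_cycle)
  have main: "x = (if b0 then cedge l (k - 1) else cedge l (k + 1), b0)"
    if x: "fst x \<in> medges (cycle_multigraph l)" "fst x \<noteq> fst d0" "dart_tail x = dart_head d0" for x
  proof -
    obtain a b where e: "x = (cedge l a, b)" using x(1) by (cases x) (auto simp: medges_cycle)
    have ne: "cvert l a \<noteq> cvert l k" using x(2) by (simp add: e e0 cedge_eq_iff)
    have ne1: "cvert l (a + 1) \<noteq> cvert l (k + 1)" using ne by (simp add: cvert_eq_iff)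
    have t: "(if b then cvert l (a + 1) else cvert l a) = (if b0 then cvert l k else cvert l (k + 1))"
      using x(3) by (cases b; cases b0) (simp_all add: e e0 dart_tail_def dart_head_def)
    show ?thesis
    proof (cases b0)
      case True
      then have b: "b" "cvert l (a + 1) = cvert l k" using t ne by (auto split: if_splits)
      then have "cvert l a = cvert l (k - 1)" using cvert_shift[of l "a + 1" k "- 1"] by simp
      then show ?thesis using True b by (simp add: e cedge_eq_iff)
    next
      case False
      then have b: "\<not> b" "cvert l a = cvert l (k + 1)" using t ne1 by (auto split: if_splits)
      then show ?thesis using False by (simp add: e cedge_eq_iff)
    qed
  qed
  show ?thesis using main[OF d] main[OF d'] by simp
qed

text \<open>Images of consecutive edges are consecutive darts, so the image of the first edge, with
  its direction, propagates around the whole cycle.\<close>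

lemma cycle_embeddings_determined:
  assumes l: "l \<ge> 1" and p: "(f, g) \<in> emb (cycle_multigraph l) (cycle_multigraph l)"
    and p': "(f', g') \<in> emb (cycle_multigraph l) (cycle_multigraph l)"
    and eq: "g (cedge l 1) = g' (cedge l 1)"
  shows "f = f'" "g = g'"
proof -
  let ?C = "cycle_multigraph l"
  have f: "f \<in> mverts ?C \<rightarrow>\<^sub>E mverts ?C" "f' \<in> mverts ?C \<rightarrow>\<^sub>E mverts ?C"
    and g: "g \<in> medges ?C \<rightarrow>\<^sub>E medges ?C \<times> UNIV" "g' \<in> medges ?C \<rightarrow>\<^sub>E medges ?C \<times> UNIV"
    and gi: "inj_on (\<lambda>x. fst (g x)) (medges ?C)" "inj_on (\<lambda>x. fst (g' x)) (medges ?C)"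
    and e: "\<And>x. x \<in> medges ?C \<Longrightarrow> dart_tail (g x) = f (edge_source x) \<and> dart_head (g x) = f (edge_target x)"
    and e': "\<And>x. x \<in> medges ?C \<Longrightarrow> dart_tail (g' x) = f' (edge_source x) \<and> dart_head (g' x) = f' (edge_target x)"
    using p p' by (simp_all add: embeddings_def)
  have gm: "fst (g x) \<in> medges ?C" "fst (g' x) \<in> medges ?C" if "x \<in> medges ?C" for x
    using PiE_mem[OF g(1) that] PiE_mem[OF g(2) that] by (simp_all add: mem_Times_iff)
  have step: "g (cedge l (1 + int k)) = g' (cedge l (1 + int k))" for k
  proof (induction k)
    case 0
    then show ?case using eq by simp
  next
    case (Suc k)
    let ?x = "cedge l (1 + int k)" and ?y = "cedge l (1 + int (Suc k))"
    show ?case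
    proof (cases "?x = ?y")
      \<comment> \<open>Two consecutive edges coincide only for \<open>l = 1\<close>.\<close>
      case True
      then show ?thesis using Suc by simp
    next
      case False
      have m: "?x \<in> medges ?C" "?y \<in> medges ?C" using cedge_in[OF l] by auto
      have xy: "edge_target ?x = edge_source ?y" by (simp add: add.commute add.left_commute)
      show ?thesis
      proof (rule cycle_next_dart_unique[of "g ?x" l])
        show "fst (g ?y) \<noteq> fst (g ?x)" using False gi(1) m by (auto dest: inj_onD)
        show "fst (g' ?y) \<noteq> fst (g ?x)" unfolding Suc using False gi(2) m by (auto dest: inj_onD)
        show "dart_tail (g ?y) = dart_head (g ?x)" using e[OF m(1)] e[OF m(2)] xy by simp
        show "dart_tail (g' ?y) = dart_head (g ?x)" unfolding Suc using e'[OF m(1)] e'[OF m(2)] xy by simp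
      qed (use gm m in auto)
    qed
  qed
  have all: "g (cedge l i) = g' (cedge l i)" if "i \<in> {1..int l}" for i
    using step[of "nat (i - 1)"] that by simp
  show gg: "g = g'"
    by (rule PiE_ext[OF g]) (use all in \<open>auto simp: medges_cycle\<close>)
  show "f = f'"
  proof (rule PiE_ext[OF f])
    fix v assume v: "v \<in> mverts ?C"
    then have "edge_source (cedge l v) = v" by (simp add: cvert_id mverts_cycle)
    then show "f v = f' v" using e[of "cedge l v"] e'[of "cedge l v"] cedge_in[OF l] gg by metis
  qed
qed

text \<open>An embedding corresponds to the dart that is the image of the first edge:
  \<open>l\<close> edges with two directions each, also for the loop.\<close>

lemma card_emb_cycle:
  assumes l: "l \<ge> 1"
  shows "card (emb (cycle_multigraph l) (cycle_multigraph l)) = 2 * l"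
proof -
  let ?C = "cycle_multigraph l"
  have "bij_betw (\<lambda>p. snd p (cedge l 1)) (emb ?C ?C) (medges ?C \<times> UNIV)"
  proof (rule bij_betw_imageI)
    show "inj_on (\<lambda>p. snd p (cedge l 1)) (emb ?C ?C)"
    proof (rule inj_onI)
      fix p p' assume p: "p \<in> emb ?C ?C" "p' \<in> emb ?C ?C" "snd p (cedge l 1) = snd p' (cedge l 1)"
      obtain f g f' g' where pp: "p = (f, g)" "p' = (f', g')" by force
      show "p = p'"
        using cycle_embeddings_determined[OF l, of f g f' g'] p unfolding pp by simp
    qed
    show "(\<lambda>p. snd p (cedge l 1)) ` emb ?C ?C = medges ?C \<times> UNIV"
    proof (intro equalityI subsetI)
      fix d assume "d \<in> (\<lambda>p. snd p (cedge l 1)) ` emb ?C ?C"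
      then obtain f g where p: "(f, g) \<in> emb ?C ?C" and d: "d = g (cedge l 1)" by auto
      have "g \<in> medges ?C \<rightarrow>\<^sub>E medges ?C \<times> UNIV" using p by (simp add: embeddings_def)
      from PiE_mem[OF this cedge_in[OF l]] show "d \<in> medges ?C \<times> UNIV" unfolding d .
    next
      fix d assume "d \<in> medges ?C \<times> (UNIV :: bool set)"
      then obtain j b where "d = (cedge l j, b)" by (cases d) (auto simp: medges_cycle)
      then show "d \<in> (\<lambda>p. snd p (cedge l 1)) ` emb ?C ?C"
        using cycle_embeddings_witness[OF l, of j b] by (auto intro: rev_image_eqI)
    qed
  qed
  from bij_betw_same_card[OF this] show ?thesis
    by (simp add: card_cartesian_product card_medges_cycle)
qed

lemma mdegree_cycle:
  assumes l: "l \<ge> 1" and v: "v \<in> mverts (cycle_multigraph l)"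
  shows "mdegree (cycle_multigraph l) v = 2"
proof -
  let ?C = "cycle_multigraph l"
  have v': "cvert l v = v" using v by (simp add: mverts_cycle cvert_id)
  have "{x \<in> medges ?C. edge_source x = v} = {cedge l v}"
  proof -
    have "cedge l i = cedge l v" if "cvert l i = v" for i
      using that v' by (simp add: cedge_eq_iff)
    then have uniq: "x = cedge l (v)" if "x \<in> medges ?C" "edge_source x = v" for x
      using that unfolding medges_cycle by (metis cedge_simps(1) imageE)
    have "edge_source (cedge l (v)) = v" using v' by simp
    with uniq cedge_in[OF l, of "v"] show ?thesis by blast
  qed
  moreover have "{x \<in> medges ?C. edge_target x = v} = {cedge l (v - 1)}"
  proof -
    have "cedge l i = cedge l (v - 1)" if "cvert l (i + 1) = v" for i
      using cvert_shift[of l "i + 1" v "- 1"] that v' by (simp add: cedge_eq_iff)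
    then have uniq: "x = cedge l (v - 1)" if "x \<in> medges ?C" "edge_target x = v" for x
      using that unfolding medges_cycle by (metis cedge_simps(2) imageE)
    have "edge_target (cedge l (v - 1)) = v" using v' by simp
    with uniq cedge_in[OF l, of "v - 1"] show ?thesis by blast
  qed
  ultimately show ?thesis by (simp add: mdegree_def)
qed

lemma connected_cycle:
  assumes l: "l \<ge> 1"
  shows "connected_multigraph (cycle_multigraph l)"
proof -
  let ?C = "cycle_multigraph l" and ?R = "madj (medges (cycle_multigraph l))"
  have e: "(cvert l i, cvert l (i + 1)) \<in> ?R" for i
    using cedge_in[OF l, of i] by (auto simp: edge_ends_def intro!: bexI[of _ "cedge l i"])
  have walk: "(cvert l 1, cvert l (1 + int k)) \<in> ?R\<^sup>*" for k
  proof (induction k)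
    case (Suc k)
    have "(cvert l (1 + int k), cvert l (1 + int (Suc k))) \<in> ?R"
      using e[of "1 + int k"] by (simp add: add.commute add.left_commute)
    with Suc show ?case by (rule rtrancl_into_rtrancl)
  qed simp
  have r: "(cvert l 1, v) \<in> ?R\<^sup>*" if "v \<in> mverts ?C" for v
  proof -
    have "1 + int (nat (v - 1)) = v" "cvert l v = v" using that by (auto simp: mverts_cycle cvert_id)
    then show ?thesis using walk[of "nat (v - 1)"] by (simp only:)
  qed
  have "(u, v) \<in> ?R\<^sup>*" if "u \<in> mverts ?C" "v \<in> mverts ?C" for u v
    using madj_rtrancl_sym[OF r[OF that(1)]] r[OF that(2)] by (rule rtrancl_trans)
  then show ?thesis
    using wf_cycle[OF l] l unfolding connected_multigraph_def by (auto simp: mverts_cycle)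
qed

lemma mdegree_eq_pattern_degree:
  assumes "finite (medges F)"
  shows "pattern_degree (medges F) edge_source edge_target v = mdegree F v"
proof -
  have "{z \<in> medges F \<times> UNIV. pattern_end edge_source edge_target z = v}
    = (\<lambda>x. (x, False)) ` {x\<in>medges F. edge_source x = v} \<union> (\<lambda>x. (x, True)) ` {x\<in>medges F. edge_target x = v}"
    (is "?L = ?A \<union> ?B")
  proof (rule set_eqI)
    fix z :: "edge \<times> bool"
    obtain x b where "z = (x, b)" by (rule prod.exhaust)
    then show "z \<in> ?L \<longleftrightarrow> z \<in> ?A \<union> ?B" by (cases b) (auto simp: pattern_end_def)
  qed
  moreover have "card (?A \<union> ?B) = card ?A + card ?B" using assms by (intro card_Un_disjoint) auto
  ultimately show ?thesis by (simp add: pattern_degree_def mdegree_def card_image inj_on_def)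
qed

lemma handshake:
  assumes "wf_multigraph G"
  shows "(\<Sum>v\<in>mverts G. mdegree G v) = 2 * card (medges G)"
proof -
  note wf = wf_multigraph_ends[OF assms]
  have "(\<Sum>v\<in>mverts G. \<Sum>x\<in>{x\<in>medges G. edge_source x = v}. 1) = (\<Sum>x\<in>medges G. 1::nat)"
    by (rule sum.group[OF wf(2,1,3)])
  moreover have "(\<Sum>v\<in>mverts G. \<Sum>x\<in>{x\<in>medges G. edge_target x = v}. 1) = (\<Sum>x\<in>medges G. 1::nat)"
    by (rule sum.group[OF wf(2,1,4)])
  ultimately show ?thesis by (simp add: mdegree_def sum.distrib)
qed

section \<open>Overlapping cycles\<close>

text \<open>Expresses the degree through \<open>edge_ends\<close> alone, the only incidence data
  that isomorphisms preserve.\<close>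

lemma mdegree_eq_sum:
  assumes "finite (medges G)"
  shows "mdegree G v = (\<Sum>x\<in>medges G. if edge_ends x = {v} then 2 else if v \<in> edge_ends x then 1 else 0)"
proof -
  have "mdegree G v = (\<Sum>x\<in>medges G. (if edge_source x = v then 1 else 0) + (if edge_target x = v then 1 else 0))"
    using assms by (simp add: mdegree_def sum.distrib sum.If_cases Int_def)
  also have "\<dots> = (\<Sum>x\<in>medges G. if edge_ends x = {v} then 2 else if v \<in> edge_ends x then 1 else 0)"
    by (intro sum.cong refl) (auto simp: edge_ends_def)
  finally show ?thesis .
qed

lemma mdegree_iso:
  assumes iso: "multigraph_iso \<alpha> \<beta> F H" and F: "wf_multigraph F" and H: "wf_multigraph H"
    and v: "v \<in> mverts F"
  shows "mdegree H (\<alpha> v) = mdegree F v"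
proof -
  have \<alpha>: "inj_on \<alpha> (mverts F)" and \<beta>: "bij_betw \<beta> (medges F) (medges H)"
    and e: "\<And>x. x \<in> medges F \<Longrightarrow> edge_ends (\<beta> x) = \<alpha> ` edge_ends x"
    using iso by (auto simp: multigraph_iso_def bij_betw_def)
  have "mdegree H (\<alpha> v) = (\<Sum>x\<in>medges F. if edge_ends (\<beta> x) = {\<alpha> v} then 2 else if \<alpha> v \<in> edge_ends (\<beta> x) then 1 else 0)"
    unfolding mdegree_eq_sum[OF wf_multigraph_ends(2)[OF H]]
    by (rule sum.reindex_bij_betw[OF \<beta>, symmetric])
  also have "\<dots> = mdegree F v"
    unfolding mdegree_eq_sum[OF wf_multigraph_ends(2)[OF F]]
  proof (intro sum.cong refl)
    fix x assume x: "x \<in> medges F"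
    have sub: "edge_ends x \<subseteq> mverts F" using F x by (auto simp: wf_multigraph_def)
    have "\<alpha> ` edge_ends x = \<alpha> ` {v} \<longleftrightarrow> edge_ends x = {v}"
      using inj_on_image_eq_iff[OF \<alpha> sub, of "{v}"] v by simp
    moreover have "\<alpha> v \<in> \<alpha> ` edge_ends x \<longleftrightarrow> v \<in> edge_ends x"
      using inj_on_image_mem_iff[OF \<alpha> v sub] .
    ultimately show "(if edge_ends (\<beta> x) = {\<alpha> v} then 2 else if \<alpha> v \<in> edge_ends (\<beta> x) then 1 else 0)
      = (if edge_ends x = {v} then 2 else if v \<in> edge_ends x then 1 else 0 :: nat)"
      using e[OF x] by simp
  qed
  finally show ?thesis .
qed

lemma iso_madj_rtrancl:
  assumes iso: "multigraph_iso \<alpha> \<beta> F H" and "(u, v) \<in> (madj (medges F))\<^sup>*"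
  shows "(\<alpha> u, \<alpha> v) \<in> (madj (medges H))\<^sup>*"
  using assms(2)
proof (induction rule: rtrancl_induct)
  case (step y z)
  then obtain x where x: "x \<in> medges F" "edge_ends x = {y, z}" by auto
  then have "\<beta> x \<in> medges H" "edge_ends (\<beta> x) = {\<alpha> y, \<alpha> z}"
    using iso by (auto simp: multigraph_iso_def bij_betw_def)
  then have "(\<alpha> y, \<alpha> z) \<in> madj (medges H)" by auto
  with step.IH show ?case by (rule rtrancl_into_rtrancl)
qed simp

lemma cycle_copy:
  assumes l: "l \<ge> 1" and H: "H \<in> copies (cycle_multigraph l) G"
  shows "connected_multigraph H" "\<And>v. v \<in> mverts H \<Longrightarrow> mdegree H v = 2"
    "card (mverts H) = l" "card (medges H) = l"
proof -
  let ?C = "cycle_multigraph l"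
  have wf: "wf_multigraph H" using H by (rule copies_wf)
  obtain \<alpha> \<beta> where iso: "multigraph_iso \<alpha> \<beta> ?C H" using H by (auto simp: copies_def isomorphic_def)
  have V: "mverts H = \<alpha> ` mverts ?C" using iso by (auto simp: multigraph_iso_def bij_betw_def)
  have C: "\<And>u v. u \<in> mverts ?C \<Longrightarrow> v \<in> mverts ?C \<Longrightarrow> (u, v) \<in> (madj (medges ?C))\<^sup>*" "mverts ?C \<noteq> {}"
    using connected_cycle[OF l] by (auto simp: connected_multigraph_def)
  have "(u, v) \<in> (madj (medges H))\<^sup>*" if "u \<in> mverts H" "v \<in> mverts H" for u v
    using that iso_madj_rtrancl[OF iso C(1)] unfolding V by blast
  then show "connected_multigraph H"
    unfolding connected_multigraph_def using wf C(2) V by auto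
  show "mdegree H v = 2" if "v \<in> mverts H" for v
    using that mdegree_iso[OF iso wf_cycle[OF l] wf] mdegree_cycle[OF l] unfolding V by auto
  show "card (mverts H) = l" "card (medges H) = l"
    using copies_iso_card[OF H] by (simp_all add: mverts_cycle card_medges_cycle)
qed

lemma finite_mdegree_mono:
  assumes "finite (medges U)" "medges H \<subseteq> medges U"
  shows "mdegree H v \<le> mdegree U v"
  unfolding mdegree_def using assms by (intro add_mono card_mono) auto

text \<open>
  All degrees of the union are at least 2. If it had no more edges than vertices, it would be
  2-regular, and two distinct cycles could not meet.
\<close>

lemma overlapping_cycles_dense:
  assumes l: "l \<ge> 1" and fin: "finite \<H>" and copies: "\<H> \<subseteq> copies (cycle_multigraph l) G"
    and meet: "H1 \<in> \<H>" "H2 \<in> \<H>" "H1 \<noteq> H2" "mverts H1 \<inter> mverts H2 \<noteq> {}"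
    and G: "wf_multigraph G"
  shows "card (\<Union>H\<in>\<H>. mverts H) < card (\<Union>H\<in>\<H>. medges H)"
proof (rule ccontr)
  define U where "U = \<lparr>mverts = (\<Union>H\<in>\<H>. mverts H), medges = (\<Union>H\<in>\<H>. medges H)\<rparr>"
  assume "\<not> ?thesis"
  then have le: "card (medges U) \<le> card (mverts U)" by (simp add: U_def)
  have sub: "mverts H \<subseteq> mverts U" "medges H \<subseteq> medges U" if "H \<in> \<H>" for H
    using that by (auto simp: U_def)
  have HG: "H \<in> copies (cycle_multigraph l) G" if "H \<in> \<H>" for H using that copies by auto
  have wfH: "wf_multigraph H" if "H \<in> \<H>" for H using copies_wf[OF HG[OF that]] .
  have "submultigraph U G"
    unfolding U_def
  proof (rule submultigraphI[OF G])
    show "(\<Union>H\<in>\<H>. mverts H) \<subseteq> mverts G" "(\<Union>H\<in>\<H>. medges H) \<subseteq> medges G"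
      using copies by (auto simp: copies_def submultigraph_def)
    fix x assume "x \<in> (\<Union>H\<in>\<H>. medges H)"
    then obtain H where "H \<in> \<H>" "x \<in> medges H" by (rule UN_E)
    then show "edge_ends x \<subseteq> (\<Union>H\<in>\<H>. mverts H)" using wfH by (auto simp: wf_multigraph_def)
  qed
  then have wfU: "wf_multigraph U" by (simp add: submultigraph_def)
  note finU = wf_multigraph_ends(1,2)[OF wfU]
  have deg2: "2 \<le> mdegree U v" if v: "v \<in> mverts U" for v
  proof -
    obtain H where H: "H \<in> \<H>" "v \<in> mverts H" using v by (auto simp: U_def)
    then show ?thesis
      using cycle_copy(2)[OF l HG[OF H(1)] H(2)] finite_mdegree_mono[OF finU(2) sub(2)[OF H(1)]] by metis
  qed
  have deg: "mdegree U v = 2" if v: "v \<in> mverts U" for v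
  proof (rule ccontr)
    assume "mdegree U v \<noteq> 2"
    then have "2 < mdegree U v" using deg2[OF v] by simp
    then have "(\<Sum>v\<in>mverts U. 2) < (\<Sum>v\<in>mverts U. mdegree U v)"
      using deg2 v finU by (intro sum_strict_mono_ex1) auto
    then show False using le by (simp add: handshake[OF wfU])
  qed
  \<comment> \<open>In the 2-regular union, a cycle \<open>H\<close> already uses both edge ends at
    each of its vertices, so no other edge of the union can be incident with them.\<close>
  have local: "x \<in> medges H" if H: "H \<in> \<H>" and x: "x \<in> medges U" and v: "v \<in> mverts H" "v \<in> edge_ends x" for H x v
  proof -
    let ?s = "\<lambda>K. {x\<in>medges K. edge_source x = v}" and ?t = "\<lambda>K. {x\<in>medges K. edge_target x = v}"
    have "mdegree H v = mdegree U v"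
      using cycle_copy(2)[OF l HG[OF H] v(1)] deg[of v] sub[OF H] v(1) by auto
    then have "card (?s H) + card (?t H) = card (?s U) + card (?t U)" by (simp add: mdegree_def)
    moreover have "card (?s H) \<le> card (?s U)" "card (?t H) \<le> card (?t U)"
      using sub(2)[OF H] finU by (auto intro!: card_mono)
    ultimately have c: "card (?s H) = card (?s U)" "card (?t H) = card (?t U)" by auto
    have finst: "finite (?s U)" "finite (?t U)" using finU by simp_all
    have subst: "?s H \<subseteq> ?s U" "?t H \<subseteq> ?t U" using sub(2)[OF H] by blast+
    have "?s H = ?s U" "?t H = ?t U"
      using card_subset_eq[OF finst(1) subst(1) c(1)] card_subset_eq[OF finst(2) subst(2) c(2)] by blast+
    moreover have "x \<in> ?s U \<union> ?t U" using x v(2) by (auto simp: edge_ends_def)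
    ultimately show ?thesis by blast
  qed
  \<comment> \<open>Walking along \<open>H\<close> from a common vertex, every edge met is incident
    with a vertex of \<open>H'\<close> and thus belongs to \<open>H'\<close>. By connectivity this
    captures all of \<open>H\<close>.\<close>
  have le': "medges H \<subseteq> medges H' \<and> mverts H \<subseteq> mverts H'"
    if H: "H \<in> \<H>" and H': "H' \<in> \<H>" and v: "v \<in> mverts H" "v \<in> mverts H'" for H H' v
  proof -
    have reach: "w \<in> mverts H'" if "(v, w) \<in> (madj (medges H))\<^sup>*" for w
      using that
    proof (induction rule: rtrancl_induct)
      case (step y z)
      then obtain x where x: "x \<in> medges H" "edge_ends x = {y, z}" by auto
      then have "x \<in> medges H'" using sub(2)[OF H] step.IH by (intro local[OF H', of x y]) auto
      then have "edge_ends x \<subseteq> mverts H'" using wfH[OF H'] by (auto simp: wf_multigraph_def)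
      then show ?case using x by simp
    qed (rule v)
    have V: "mverts H \<subseteq> mverts H'"
      using cycle_copy(1)[OF l HG[OF H]] v(1) reach by (auto simp: connected_multigraph_def)
    moreover have "x \<in> medges H'" if x: "x \<in> medges H" for x
    proof (rule local[OF H', of x "edge_source x"])
      show "x \<in> medges U" using x sub(2)[OF H] by auto
      show "edge_source x \<in> mverts H'" using x V wfH[OF H] by (auto simp: wf_multigraph_def edge_ends_def)
    qed (simp add: edge_ends_def)
    ultimately show ?thesis by auto
  qed
  obtain v where v: "v \<in> mverts H1" "v \<in> mverts H2" using meet by auto
  have "H1 = H2"
    using le'[OF meet(1,2) v] le'[OF meet(2,1) v(2,1)] by (intro multigraph_eqI equalityI) blast+
  then show False using meet by simp
qed

definition dense_subgraphs :: "nat \<Rightarrow> nat \<Rightarrow> multigraph \<Rightarrow> multigraph set" where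
  "dense_subgraphs a b G = {U. submultigraph U G \<and> card (mverts U) = a \<and> card (medges U) = b}"

text \<open>After numbering its vertices and edges, a subgraph is the image of an embedding of one
  of finitely many patterns, given by the incidence maps \<open>s\<close> and \<open>t\<close>.
  Repetitions through different numberings are harmless in an upper bound.\<close>

lemma card_dense_subgraphs_le:
  assumes G: "wf_multigraph G"
  shows "card (dense_subgraphs a b G)
    \<le> (\<Sum>st\<in>({..<b} \<rightarrow>\<^sub>E {..<a}) \<times> ({..<b} \<rightarrow>\<^sub>E {..<a}). card (embeddings {..<a} {..<b} (fst st) (snd st) G))"
proof -
  let ?I = "({..<b} \<rightarrow>\<^sub>E {..<a}) \<times> ({..<b} \<rightarrow>\<^sub>E {..<a})"
  let ?im = "\<lambda>(f, g). \<lparr>mverts = f ` {..<a}, medges = (\<lambda>i. fst (g i)) ` {..<b}\<rparr> :: multigraph"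
  let ?E = "\<lambda>st. embeddings {..<a} {..<b} (fst st) (snd st) G"
  have finI: "finite ?I" by (intro finite_cartesian_product finite_PiE) auto
  have finE: "finite (?E st)" for st by (intro finite_embeddings G) auto
  have "dense_subgraphs a b G \<subseteq> (\<Union>st\<in>?I. ?im ` ?E st)"
  proof
    fix U assume U: "U \<in> dense_subgraphs a b G"
    then have wf: "wf_multigraph U" and sub: "mverts U \<subseteq> mverts G" "medges U \<subseteq> medges G"
      and c: "card (mverts U) = a" "card (medges U) = b" by (auto simp: dense_subgraphs_def submultigraph_def)
    note ends = wf_multigraph_ends[OF wf]
    obtain f where f: "bij_betw f {..<a} (mverts U)"
      using ex_bij_betw_nat_finite[OF ends(1)] c by (auto simp: atLeast0LessThan)
    obtain y where y: "bij_betw y {..<b} (medges U)"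
      using ex_bij_betw_nat_finite[OF ends(2)] c by (auto simp: atLeast0LessThan)
    define f' where "f' = restrict f {..<a}"
    define g where "g = (\<lambda>i\<in>{..<b}. (y i, False))"
    define s where "s = (\<lambda>i\<in>{..<b}. inv_into {..<a} f (edge_source (y i)))"
    define t where "t = (\<lambda>i\<in>{..<b}. inv_into {..<a} f (edge_target (y i)))"
    have yi: "edge_source (y i) \<in> f ` {..<a}" "edge_target (y i) \<in> f ` {..<a}" if "i < b" for i
    proof -
      have "y i \<in> medges U" using y that by (auto simp: bij_betw_def)
      moreover have "f ` {..<a} = mverts U" using f by (simp add: bij_betw_def)
      ultimately show "edge_source (y i) \<in> f ` {..<a}" "edge_target (y i) \<in> f ` {..<a}"
        using ends(3,4) by (simp_all add: image_subset_iff)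
    qed
    have st: "s \<in> {..<b} \<rightarrow>\<^sub>E {..<a}" "t \<in> {..<b} \<rightarrow>\<^sub>E {..<a}"
      using yi[THEN inv_into_into] by (auto simp: s_def t_def)
    have mem: "(f', g) \<in> ?E (s, t)"
      unfolding embeddings_def mem_Collect_eq prod.case
    proof (intro conjI ballI)
      show "f' \<in> {..<a} \<rightarrow>\<^sub>E mverts G" using f sub by (auto simp: f'_def bij_betw_def)
      show "inj_on f' {..<a}" using f by (simp add: f'_def bij_betw_def inj_on_def)
      show "g \<in> {..<b} \<rightarrow>\<^sub>E medges G \<times> UNIV"
        unfolding g_def restrict_PiE_iff using y sub by (auto simp: bij_betw_def)
      show "inj_on (\<lambda>i. fst (g i)) {..<b}" using y by (simp add: g_def bij_betw_def inj_on_def)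
      fix i assume i: "i \<in> {..<b}"
      then have "s i < a" "t i < a" using st by (auto dest: PiE_mem)
      then show "dart_tail (g i) = f' (fst (s, t) i)" "dart_head (g i) = f' (snd (s, t) i)"
        using i yi[of i] by (simp_all add: g_def f'_def dart_tail_def dart_head_def s_def t_def f_inv_into_f)
    qed
    have im: "?im (f', g) = U"
      using f y by (intro multigraph_eqI) (simp_all add: f'_def g_def bij_betw_def)
    have "U \<in> ?im ` ?E (s, t)" unfolding im[symmetric] using mem by (rule imageI)
    then show "U \<in> (\<Union>st\<in>?I. ?im ` ?E st)" using st by blast
  qed
  then have "card (dense_subgraphs a b G) \<le> card (\<Union>st\<in>?I. ?im ` ?E st)"
    using finI finE by (intro card_mono finite_UN_I finite_imageI)
  also have "\<dots> \<le> (\<Sum>st\<in>?I. card (?im ` ?E st))" using finI by (rule card_UN_le)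
  also have "\<dots> \<le> (\<Sum>st\<in>?I. card (?E st))" by (intro sum_mono card_image_le finE)
  finally show ?thesis .
qed

definition tuple_disjoint :: "nat \<Rightarrow> (nat \<Rightarrow> multigraph) \<Rightarrow> bool" where
  "tuple_disjoint r H \<longleftrightarrow> (\<forall>i<r. \<forall>j<r. i \<noteq> j \<longrightarrow> mverts (H i) \<inter> mverts (H j) = {})"

definition disjoint_copies :: "nat \<Rightarrow> multigraph \<Rightarrow> multigraph \<Rightarrow> (nat \<Rightarrow> multigraph) set" where
  "disjoint_copies r F G = {H \<in> {..<r} \<rightarrow>\<^sub>E copies F G. tuple_disjoint r H}"

definition overlapping_copies :: "nat \<Rightarrow> multigraph \<Rightarrow> multigraph \<Rightarrow> (nat \<Rightarrow> multigraph) set" where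
  "overlapping_copies r F G = {H \<in> {..<r} \<rightarrow>\<^sub>E copies F G. inj_on H {..<r} \<and> \<not> tuple_disjoint r H}"

text \<open>The falling factorial counts the injective \<open>r\<close>-tuples of copies. Disjoint
  tuples are automatically injective because copies have a vertex.\<close>

lemma ffac_subgraph_count:
  assumes G: "wf_multigraph G" and F: "mverts F \<noteq> {}" "finite (mverts F)"
  shows "ffac (subgraph_count F G) r = card (disjoint_copies r F G) + card (overlapping_copies r F G)"
proof -
  have fin: "finite ({..<r} \<rightarrow>\<^sub>E copies F G)" by (intro finite_PiE finite_copies[OF G]) auto
  have inj: "inj_on H {..<r}" if H: "H \<in> disjoint_copies r F G" for H
  proof (rule inj_onI, rule ccontr)
    fix i j assume ij: "i \<in> {..<r}" "j \<in> {..<r}" "H i = H j" "i \<noteq> j"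
    then have "mverts (H i) = {}" using H by (fastforce simp: disjoint_copies_def tuple_disjoint_def)
    moreover have "H i \<in> copies F G" using H ij by (auto simp: disjoint_copies_def)
    ultimately show False using copies_iso_card(1)[of "H i" F G] F by (simp add: card_eq_0_iff)
  qed
  have "{H \<in> {..<r} \<rightarrow>\<^sub>E copies F G. inj_on H {..<r}} = disjoint_copies r F G \<union> overlapping_copies r F G"
    using inj by (auto simp: disjoint_copies_def overlapping_copies_def)
  moreover have "card (disjoint_copies r F G \<union> overlapping_copies r F G)
    = card (disjoint_copies r F G) + card (overlapping_copies r F G)"
    using fin by (intro card_Un_disjoint) (auto simp: disjoint_copies_def overlapping_copies_def)
  moreover have "card {H \<in> {..<r} \<rightarrow>\<^sub>E copies F G. inj_on H {..<r}} = ffac (subgraph_count F G) r"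
    using card_inj_funcset[of "{..<r}" "copies F G"] finite_copies[OF G] by (simp add: subgraph_count_def)
  ultimately show ?thesis by simp
qed

text \<open>The union of an overlapping tuple has more edges than vertices and at most
  \<open>r * l\<close> edges. Conversely, a union with \<open>a\<close> vertices and
  \<open>b\<close> edges has at most \<open>2 ^ a * 2 ^ b\<close> subgraphs, hence at most the
  \<open>r\<close>-th power of this number of tuples.\<close>

lemma card_overlapping_cycles_le:
  assumes l: "l \<ge> 1" and G: "wf_multigraph G"
  shows "card (overlapping_copies r (cycle_multigraph l) G)
    \<le> (\<Sum>(a, b)\<in>{(a, b). a < b \<and> b \<le> r * l}. (2 ^ a * 2 ^ b) ^ r * card (dense_subgraphs a b G))"
proof -
  let ?C = "cycle_multigraph l"
  let ?I = "{(a, b). a < b \<and> b \<le> r * l}"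
  let ?T = "\<lambda>U. {..<r} \<rightarrow>\<^sub>E {H. submultigraph H U}"
  have finI: "finite ?I" by (rule finite_subset[of _ "{..r * l} \<times> {..r * l}"]) auto
  have finD: "finite (dense_subgraphs a b G)" for a b
    by (rule finite_subset[OF _ finite_submultigraphs(1)[OF G]]) (auto simp: dense_subgraphs_def)
  have wfU: "wf_multigraph U" if "U \<in> dense_subgraphs a b G" for U a b
    using that by (simp add: dense_subgraphs_def submultigraph_def)
  have finT: "finite (?T U)" if "U \<in> dense_subgraphs a b G" for U a b
    using finite_submultigraphs(1)[OF wfU[OF that]] by (intro finite_PiE) auto
  have cT: "card (?T U) \<le> (2 ^ a * 2 ^ b) ^ r" if U: "U \<in> dense_subgraphs a b G" for U a b
  proof -
    have "card (?T U) = card {H. submultigraph H U} ^ r" by (simp add: card_PiE)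
    also have "\<dots> \<le> (2 ^ a * 2 ^ b) ^ r"
      using finite_submultigraphs(2)[OF wfU[OF U]] U by (intro power_mono) (auto simp: dense_subgraphs_def)
    finally show ?thesis .
  qed
  have "overlapping_copies r ?C G \<subseteq> (\<Union>(a, b)\<in>?I. \<Union>U\<in>dense_subgraphs a b G. ?T U)"
  proof
    fix H assume H: "H \<in> overlapping_copies r ?C G"
    then have HC: "H i \<in> copies ?C G" if "i < r" for i using that by (auto simp: overlapping_copies_def)
    have ext: "H \<in> extensional {..<r}" and inj: "inj_on H {..<r}" using H by (auto simp: overlapping_copies_def PiE_def)
    obtain i j where ij: "i < r" "j < r" "i \<noteq> j" "mverts (H i) \<inter> mverts (H j) \<noteq> {}"
      using H by (auto simp: overlapping_copies_def tuple_disjoint_def)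
    have Hij: "H i \<noteq> H j" using ij inj by (auto dest: inj_onD)
    define V where "V = (\<Union>K\<in>H ` {..<r}. mverts K)"
    define E where "E = (\<Union>K\<in>H ` {..<r}. medges K)"
    define U where "U = \<lparr>mverts = V, medges = E\<rparr>"
    have less: "card V < card E"
      unfolding V_def E_def
      by (rule overlapping_cycles_dense[OF l, where G = G and ?H1.0 = "H i" and ?H2.0 = "H j"])
        (use ij Hij HC G in auto)
    have "card E \<le> (\<Sum>k<r. card (medges (H k)))"
      unfolding E_def by (simp add: card_UN_le)
    also have "\<dots> = r * l" using cycle_copy(4)[OF l HC] by simp
    finally have bl: "card E \<le> r * l" .
    have sub: "submultigraph U G"
      unfolding U_def
    proof (rule submultigraphI[OF G])
      show "V \<subseteq> mverts G" "E \<subseteq> medges G"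
        using HC by (auto simp: V_def E_def copies_def submultigraph_def)
      fix x assume "x \<in> E"
      then obtain k where "k < r" "x \<in> medges (H k)" by (auto simp: E_def)
      then show "edge_ends x \<subseteq> V" using copies_wf[OF HC[of k]] by (auto simp: V_def wf_multigraph_def)
    qed
    then have "U \<in> dense_subgraphs (card V) (card E) G" by (simp add: dense_subgraphs_def U_def)
    moreover have "H \<in> ?T U"
    proof (rule PiE_I)
      fix k assume "k \<in> {..<r}"
      then show "H k \<in> {K. submultigraph K U}"
        using copies_wf[OF HC[of k]] by (auto simp: submultigraph_def U_def V_def E_def)
    qed (use ext in \<open>auto simp: extensional_def\<close>)
    ultimately show "H \<in> (\<Union>(a, b)\<in>?I. \<Union>U\<in>dense_subgraphs a b G. ?T U)"
      using less bl by blast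
  qed
  then have "card (overlapping_copies r ?C G) \<le> card (\<Union>(a, b)\<in>?I. \<Union>U\<in>dense_subgraphs a b G. ?T U)"
    using finI finD finT by (intro card_mono) auto
  also have "\<dots> \<le> (\<Sum>(a, b)\<in>?I. card (\<Union>U\<in>dense_subgraphs a b G. ?T U))"
    using card_UN_le[OF finI, of "\<lambda>(a, b). \<Union>U\<in>dense_subgraphs a b G. ?T U"] by (simp add: case_prod_beta')
  also have "\<dots> \<le> (\<Sum>(a, b)\<in>?I. (2 ^ a * 2 ^ b) ^ r * card (dense_subgraphs a b G))"
  proof (intro sum_mono, clarify)
    fix a b
    have "card (\<Union>U\<in>dense_subgraphs a b G. ?T U) \<le> (\<Sum>U\<in>dense_subgraphs a b G. card (?T U))"
      by (rule card_UN_le[OF finD])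
    also have "\<dots> \<le> (\<Sum>U\<in>dense_subgraphs a b G. (2 ^ a * 2 ^ b) ^ r)" by (intro sum_mono cT)
    finally show "card (\<Union>U\<in>dense_subgraphs a b G. ?T U) \<le> (2 ^ a * 2 ^ b) ^ r * card (dense_subgraphs a b G)"
      by (simp add: mult.commute)
  qed
  finally show ?thesis .
qed

section \<open>Disjoint tuples of copies\<close>

lemma restrict_eq_extensional:
  assumes "f \<in> extensional A" "\<And>x. x \<in> A \<Longrightarrow> g x = f x"
  shows "restrict g A = f"
  using assms by (intro extensionalityI[where A = A]) auto

text \<open>Incidence in the disjoint union of \<open>r\<close> copies of a pattern; the first
  component is the number of the copy.\<close>

definition fold_source :: "nat \<times> edge \<Rightarrow> nat \<times> int" where
  "fold_source x = (fst x, edge_source (snd x))"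

definition fold_target :: "nat \<times> edge \<Rightarrow> nat \<times> int" where
  "fold_target x = (fst x, edge_target (snd x))"

abbreviation fold_emb :: "nat \<Rightarrow> multigraph \<Rightarrow> multigraph \<Rightarrow> ((nat \<times> int \<Rightarrow> int) \<times> (nat \<times> edge \<Rightarrow> edge \<times> bool)) set" where
  "fold_emb r F G \<equiv> embeddings ({..<r} \<times> mverts F) ({..<r} \<times> medges F) fold_source fold_target G"

lemma fold_pattern_degree:
  assumes "finite (medges F)" "k < r"
  shows "pattern_degree ({..<r} \<times> medges F) fold_source fold_target (k, v) = mdegree F v"
proof -
  have "{z \<in> ({..<r} \<times> medges F) \<times> UNIV. pattern_end fold_source fold_target z = (k, v)}
    = (\<lambda>z. ((k, fst z), snd z)) ` {z \<in> medges F \<times> UNIV. pattern_end edge_source edge_target z = v}" (is "?L = ?f ` ?R")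
  proof (intro equalityI subsetI)
    fix z assume z: "z \<in> ?L"
    obtain i x b where zz: "z = ((i, x), b)" by (metis prod.exhaust)
    have "i = k" "x \<in> medges F" "(if b then edge_target x else edge_source x) = v"
      using z by (auto simp: zz pattern_end_def fold_source_def fold_target_def split: if_splits)
    then have "(x, b) \<in> ?R" "z = ?f (x, b)" by (cases b; simp add: zz pattern_end_def)+
    then show "z \<in> ?f ` ?R" by (rule rev_image_eqI)
  next
    fix z assume "z \<in> ?f ` ?R"
    then obtain w where w: "z = ?f w" "w \<in> ?R" by (rule imageE)
    then show "z \<in> ?L" using assms(2)
      by (cases w) (auto simp: pattern_end_def fold_source_def fold_target_def)
  qed
  then have "pattern_degree ({..<r} \<times> medges F) fold_source fold_target (k, v) = card (?f ` ?R)"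
    by (simp add: pattern_degree_def)
  also have "\<dots> = card ?R" by (intro card_image inj_onI) (simp add: prod_eq_iff)
  finally show ?thesis using mdegree_eq_pattern_degree[OF assms(1)] by (simp add: pattern_degree_def)
qed

text \<open>Currying: an embedding of the \<open>r\<close>-fold disjoint union is a tuple of
  embeddings of \<open>F\<close> with vertex-disjoint images. Each disjoint tuple of copies is the
  image of \<open>card (emb F F) ^ r\<close> of them.\<close>

lemma card_fold_emb:
  assumes F: "wf_multigraph F" and G: "wf_multigraph G"
  shows "card (fold_emb r F G) = card (emb F F) ^ r * card (disjoint_copies r F G)"
proof -
  let ?V = "{..<r} \<times> mverts F" and ?E = "{..<r} \<times> medges F"
  let ?T = "\<Union>H\<in>disjoint_copies r F G. PiE {..<r} (\<lambda>k. emb F (H k))"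
  define \<Theta> where "\<Theta> p = (\<lambda>k\<in>{..<r}. (\<lambda>v\<in>mverts F. fst p (k, v), \<lambda>x\<in>medges F. snd p (k, x)))"
    for p :: "(nat \<times> int \<Rightarrow> int) \<times> (nat \<times> edge \<Rightarrow> edge \<times> bool)"
  define \<Xi> where "\<Xi> q = (\<lambda>z\<in>?V. fst (q (fst z)) (snd z), \<lambda>z\<in>?E. snd (q (fst z)) (snd z))"
    for q :: "nat \<Rightarrow> (int \<Rightarrow> int) \<times> (edge \<Rightarrow> edge \<times> bool)"
  note endsF = wf_multigraph_ends[OF F]
  have src: "edge_source x \<in> mverts F" "edge_target x \<in> mverts F" if "x \<in> medges F" for x
    using that endsF by auto
  have "bij_betw \<Theta> (fold_emb r F G) ?T"
  proof (rule bij_betw_byWitness[where f' = \<Xi>])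
    show "\<forall>p\<in>fold_emb r F G. \<Xi> (\<Theta> p) = p"
    proof
      fix p assume p: "p \<in> fold_emb r F G"
      obtain f g where fg: "p = (f, g)" by (rule prod.exhaust)
      have ext: "f \<in> extensional ?V" "g \<in> extensional ?E" using p by (simp_all add: fg embeddings_def PiE_def)
      have "(\<lambda>z\<in>?V. fst (\<Theta> (f, g) (fst z)) (snd z)) = f"
        by (rule restrict_eq_extensional[OF ext(1)]) (auto simp: \<Theta>_def)
      moreover have "(\<lambda>z\<in>?E. snd (\<Theta> (f, g) (fst z)) (snd z)) = g"
        by (rule restrict_eq_extensional[OF ext(2)]) (auto simp: \<Theta>_def)
      ultimately show "\<Xi> (\<Theta> p) = p" by (simp add: \<Xi>_def fg)
    qed
    show "\<forall>q\<in>?T. \<Theta> (\<Xi> q) = q"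
    proof
      fix q assume "q \<in> ?T"
      then obtain H where H: "H \<in> disjoint_copies r F G" and q: "q \<in> PiE {..<r} (\<lambda>k. emb F (H k))" by (rule UN_E)
      show "\<Theta> (\<Xi> q) = q"
      proof (rule extensionalityI[where A = "{..<r}"])
        show "q \<in> extensional {..<r}" using q by (simp add: PiE_def)
        fix k assume k: "k \<in> {..<r}"
        obtain f g where fg: "q k = (f, g)" by (rule prod.exhaust)
        have ext: "f \<in> extensional (mverts F)" "g \<in> extensional (medges F)"
          using PiE_mem[OF q k] by (simp_all add: fg embeddings_def PiE_def)
        have "(\<lambda>v\<in>mverts F. fst (\<Xi> q) (k, v)) = f"
          by (rule restrict_eq_extensional[OF ext(1)]) (use k fg in \<open>auto simp: \<Xi>_def\<close>)
        moreover have "(\<lambda>x\<in>medges F. snd (\<Xi> q) (k, x)) = g"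
          by (rule restrict_eq_extensional[OF ext(2)]) (use k fg in \<open>auto simp: \<Xi>_def\<close>)
        ultimately show "\<Theta> (\<Xi> q) k = q k" using k by (simp add: \<Theta>_def fg)
      qed (simp add: \<Theta>_def)
    qed
    show "\<Theta> ` fold_emb r F G \<subseteq> ?T"
    proof
      fix q assume "q \<in> \<Theta> ` fold_emb r F G"
      then obtain p where q: "q = \<Theta> p" and p: "p \<in> fold_emb r F G" by (rule imageE)
      obtain f g where fg: "p = (f, g)" by (rule prod.exhaust)
      have f: "f \<in> ?V \<rightarrow>\<^sub>E mverts G" "inj_on f ?V"
        and g: "g \<in> ?E \<rightarrow>\<^sub>E medges G \<times> UNIV" "inj_on (\<lambda>x. fst (g x)) ?E"
        and e: "\<And>z. z \<in> ?E \<Longrightarrow> dart_tail (g z) = f (fold_source z) \<and> dart_head (g z) = f (fold_target z)"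
        using p unfolding fg embeddings_def by blast+
      have qk: "q k = (\<lambda>v\<in>mverts F. f (k, v), \<lambda>x\<in>medges F. g (k, x))" if "k < r" for k
        using that by (simp add: q \<Theta>_def fg)
      have qe: "q k \<in> emb F G" if k: "k < r" for k
        unfolding qk[OF k] embeddings_def mem_Collect_eq prod.case
      proof (intro conjI ballI)
        show "(\<lambda>v\<in>mverts F. f (k, v)) \<in> mverts F \<rightarrow>\<^sub>E mverts G"
          unfolding restrict_PiE_iff using k by (intro ballI PiE_mem[OF f(1)]) simp
        show "inj_on (\<lambda>v\<in>mverts F. f (k, v)) (mverts F)"
        proof (rule inj_onI)
          fix v w assume "v \<in> mverts F" "w \<in> mverts F" "(\<lambda>v\<in>mverts F. f (k, v)) v = (\<lambda>v\<in>mverts F. f (k, v)) w"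
          then have "(k, v) = (k, w)" using k by (intro inj_onD[OF f(2)]) simp_all
          then show "v = w" by simp
        qed
        show "(\<lambda>x\<in>medges F. g (k, x)) \<in> medges F \<rightarrow>\<^sub>E medges G \<times> UNIV"
          unfolding restrict_PiE_iff using k by (intro ballI PiE_mem[OF g(1)]) simp
        show "inj_on (\<lambda>x. fst ((\<lambda>x\<in>medges F. g (k, x)) x)) (medges F)"
        proof (rule inj_onI)
          fix x y assume "x \<in> medges F" "y \<in> medges F"
            "fst ((\<lambda>x\<in>medges F. g (k, x)) x) = fst ((\<lambda>x\<in>medges F. g (k, x)) y)"
          then have "(k, x) = (k, y)" using k by (intro inj_onD[OF g(2)]) simp_all
          then show "x = y" by simp
        qed
        fix x assume x: "x \<in> medges F"
        show "dart_tail ((\<lambda>x\<in>medges F. g (k, x)) x) = (\<lambda>v\<in>mverts F. f (k, v)) (edge_source x)"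
          "dart_head ((\<lambda>x\<in>medges F. g (k, x)) x) = (\<lambda>v\<in>mverts F. f (k, v)) (edge_target x)"
          using e[of "(k, x)"] k x src[OF x] by (simp_all add: fold_source_def fold_target_def)
      qed
      define H where "H = (\<lambda>k\<in>{..<r}. emb_image F (q k))"
      have "q \<in> PiE {..<r} (\<lambda>k. emb F (H k))"
      proof (rule PiE_I)
        fix k assume "k \<in> {..<r}"
        then show "q k \<in> emb F (H k)" using emb_in_own_image[OF qe] by (simp add: H_def)
      qed (simp add: q \<Theta>_def)
      moreover have "H \<in> disjoint_copies r F G"
        unfolding disjoint_copies_def tuple_disjoint_def mem_Collect_eq
      proof (intro conjI allI impI)
        show "H \<in> {..<r} \<rightarrow>\<^sub>E copies F G"
          unfolding H_def restrict_PiE_iff using emb_image_copies[OF F G qe] by simp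
        fix i j assume ij: "i < r" "j < r" "i \<noteq> j"
        have Hi: "mverts (H k) = (\<lambda>v. f (k, v)) ` mverts F" if "k < r" for k
          using that by (simp add: H_def emb_image_def qk)
        show "mverts (H i) \<inter> mverts (H j) = {}"
          unfolding Hi[OF ij(1)] Hi[OF ij(2)]
        proof (rule equals0I)
          fix w assume "w \<in> (\<lambda>v. f (i, v)) ` mverts F \<inter> (\<lambda>v. f (j, v)) ` mverts F"
          then obtain v v' where "v \<in> mverts F" "v' \<in> mverts F" "f (i, v) = f (j, v')" by auto
          then have "(i, v) = (j, v')" using ij by (intro inj_onD[OF f(2)]) auto
          then show False using ij by simp
        qed
      qed
      ultimately show "q \<in> ?T" by (rule UN_I[rotated])
    qed
    show "\<Xi> ` ?T \<subseteq> fold_emb r F G"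
    proof
      fix p assume "p \<in> \<Xi> ` ?T"
      then obtain q where p: "p = \<Xi> q" and "q \<in> ?T" by (rule imageE)
      then obtain H where H: "H \<in> disjoint_copies r F G" and q: "q \<in> PiE {..<r} (\<lambda>k. emb F (H k))" by (elim UN_E)
      have HC: "H k \<in> copies F G" if "k < r" for k using H that by (auto simp: disjoint_copies_def)
      have dis: "mverts (H i) \<inter> mverts (H j) = {}" if "i < r" "j < r" "i \<noteq> j" for i j
        using H that by (simp add: disjoint_copies_def tuple_disjoint_def)
      define f where "f k = fst (q k)" for k
      define g where "g k = snd (q k)" for k
      have fk: "f k \<in> mverts F \<rightarrow>\<^sub>E mverts (H k)" "inj_on (f k) (mverts F)"
        and gk: "g k \<in> medges F \<rightarrow>\<^sub>E medges (H k) \<times> UNIV" "inj_on (\<lambda>x. fst (g k x)) (medges F)"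
        and ek: "\<And>x. x \<in> medges F \<Longrightarrow> dart_tail (g k x) = f k (edge_source x) \<and> dart_head (g k x) = f k (edge_target x)"
        if "k < r" for k
        using PiE_mem[OF q, of k] that by (simp_all add: embeddings_def f_def g_def case_prod_beta)
      have HG: "mverts (H k) \<subseteq> mverts G" "medges (H k) \<subseteq> medges G" if "k < r" for k
        using HC[OF that] by (auto simp: copies_def submultigraph_def)
      have fH: "f k v \<in> mverts (H k)" if "k < r" "v \<in> mverts F" for k v by (rule PiE_mem[OF fk(1)[OF that(1)] that(2)])
      have gH: "fst (g k x) \<in> medges (H k)" if "k < r" "x \<in> medges F" for k x
        using PiE_mem[OF gk(1)[OF that(1)] that(2)] by (simp add: mem_Times_iff)
      have p': "p = (\<lambda>z\<in>?V. f (fst z) (snd z), \<lambda>z\<in>?E. g (fst z) (snd z))"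
        by (simp add: p \<Xi>_def f_def g_def)
      show "p \<in> fold_emb r F G"
        unfolding p' embeddings_def mem_Collect_eq prod.case
      proof (intro conjI ballI)
        show "(\<lambda>z\<in>?V. f (fst z) (snd z)) \<in> ?V \<rightarrow>\<^sub>E mverts G"
          unfolding restrict_PiE_iff using fH HG(1) by (auto simp: subset_iff)
        show "inj_on (\<lambda>z\<in>?V. f (fst z) (snd z)) ?V"
        proof (rule inj_onI)
          fix z w assume z: "z \<in> ?V" and w: "w \<in> ?V" and "(\<lambda>z\<in>?V. f (fst z) (snd z)) z = (\<lambda>z\<in>?V. f (fst z) (snd z)) w"
          then have eq: "f (fst z) (snd z) = f (fst w) (snd w)" by simp
          have m: "fst z < r" "snd z \<in> mverts F" "fst w < r" "snd w \<in> mverts F" using z w by (auto simp: mem_Times_iff)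
          have "fst z = fst w"
            using dis[OF m(1,3)] fH[OF m(1,2)] fH[OF m(3,4)] eq by auto
          then show "z = w" using eq inj_onD[OF fk(2)[OF m(1)] _ m(2,4)] by (simp add: prod_eq_iff)
        qed
        show "(\<lambda>z\<in>?E. g (fst z) (snd z)) \<in> ?E \<rightarrow>\<^sub>E medges G \<times> UNIV"
          unfolding restrict_PiE_iff
        proof
          fix z assume "z \<in> ?E"
          then have m: "fst z < r" "snd z \<in> medges F" by (auto simp: mem_Times_iff)
          show "g (fst z) (snd z) \<in> medges G \<times> UNIV"
            using gH[OF m] HG(2)[OF m(1)] by (auto simp: mem_Times_iff)
        qed
        show "inj_on (\<lambda>x. fst ((\<lambda>z\<in>?E. g (fst z) (snd z)) x)) ?E"
        proof (rule inj_onI)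
          fix z w assume z: "z \<in> ?E" and w: "w \<in> ?E"
            and "fst ((\<lambda>z\<in>?E. g (fst z) (snd z)) z) = fst ((\<lambda>z\<in>?E. g (fst z) (snd z)) w)"
          then have eq: "fst (g (fst z) (snd z)) = fst (g (fst w) (snd w))" by simp
          have m: "fst z < r" "snd z \<in> medges F" "fst w < r" "snd w \<in> medges F" using z w by (auto simp: mem_Times_iff)
          let ?x = "fst (g (fst z) (snd z))"
          \<comment> \<open>Copies in the tuple are disjoint by their vertices; a common edge would
            give them a common end.\<close>
          have "?x \<in> medges (H (fst z))" "?x \<in> medges (H (fst w))"
            using gH[OF m(1,2)] gH[OF m(3,4)] eq by simp_all
          then have "edge_source ?x \<in> mverts (H (fst z))" "edge_source ?x \<in> mverts (H (fst w))"
            using wf_multigraph_ends(3)[OF copies_wf[OF HC[OF m(1)]]] wf_multigraph_ends(3)[OF copies_wf[OF HC[OF m(3)]]]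
            by blast+
          then have "fst z = fst w" using dis[OF m(1,3)] by blast
          then show "z = w" using eq inj_onD[OF gk(2)[OF m(1)] _ m(2,4)] by (simp add: prod_eq_iff)
        qed
        fix z assume z: "z \<in> ?E"
        then have m: "fst z < r" "snd z \<in> medges F" by (auto simp: mem_Times_iff)
        show "dart_tail ((\<lambda>z\<in>?E. g (fst z) (snd z)) z) = (\<lambda>z\<in>?V. f (fst z) (snd z)) (fold_source z)"
          "dart_head ((\<lambda>z\<in>?E. g (fst z) (snd z)) z) = (\<lambda>z\<in>?V. f (fst z) (snd z)) (fold_target z)"
          using z m ek[OF m] src[OF m(2)] by (simp_all add: fold_source_def fold_target_def)
      qed
    qed
  qed
  from bij_betw_same_card[OF this] have "card (fold_emb r F G) = card ?T" .
  also have "\<dots> = (\<Sum>H\<in>disjoint_copies r F G. card (PiE {..<r} (\<lambda>k. emb F (H k))))"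
  proof (rule card_UN_disjoint)
    show "finite (disjoint_copies r F G)"
      by (rule finite_subset[of _ "{..<r} \<rightarrow>\<^sub>E copies F G"])
        (auto simp: disjoint_copies_def intro!: finite_PiE finite_copies[OF G])
    show "\<forall>H\<in>disjoint_copies r F G. finite (PiE {..<r} (\<lambda>k. emb F (H k)))"
    proof (intro ballI finite_PiE finite_embeddings endsF)
      fix H k assume "H \<in> disjoint_copies r F G" "k \<in> {..<r}"
      then show "wf_multigraph (H k)" by (intro copies_wf[of _ F G]) (auto simp: disjoint_copies_def)
    qed simp
    show "\<forall>H\<in>disjoint_copies r F G. \<forall>H'\<in>disjoint_copies r F G. H \<noteq> H' \<longrightarrow>
      PiE {..<r} (\<lambda>k. emb F (H k)) \<inter> PiE {..<r} (\<lambda>k. emb F (H' k)) = {}"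
    proof (intro ballI impI equals0I)
      fix H H' q assume H: "H \<in> disjoint_copies r F G" and H': "H' \<in> disjoint_copies r F G" and ne: "H \<noteq> H'"
        and q: "q \<in> PiE {..<r} (\<lambda>k. emb F (H k)) \<inter> PiE {..<r} (\<lambda>k. emb F (H' k))"
      have m: "H \<in> {..<r} \<rightarrow>\<^sub>E copies F G" "H' \<in> {..<r} \<rightarrow>\<^sub>E copies F G"
        using H H' by (simp_all add: disjoint_copies_def)
      have q': "q \<in> PiE {..<r} (\<lambda>k. emb F (H k))" "q \<in> PiE {..<r} (\<lambda>k. emb F (H' k))" using q by auto
      have "H = H'"
      proof (rule PiE_ext[OF m])
        fix k assume k: "k \<in> {..<r}"
        show "H k = H' k"
          using emb_image_copy[OF PiE_mem[OF m(1) k] PiE_mem[OF q'(1) k]]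
            emb_image_copy[OF PiE_mem[OF m(2) k] PiE_mem[OF q'(2) k]] by simp
      qed
      then show False using ne by simp
    qed
  qed
  also have "\<dots> = (\<Sum>H\<in>disjoint_copies r F G. card (emb F F) ^ r)"
  proof (intro sum.cong refl)
    fix H assume H: "H \<in> disjoint_copies r F G"
    have "card (PiE {..<r} (\<lambda>k. emb F (H k))) = (\<Prod>k<r. card (emb F (H k)))" by (simp add: card_PiE)
    also have "\<dots> = (\<Prod>k<r. card (emb F F))"
    proof (intro prod.cong refl card_emb_copy[OF F])
      fix k assume "k \<in> {..<r}"
      then show "H k \<in> copies F G" using H by (auto simp: disjoint_copies_def)
    qed
    finally show "card (PiE {..<r} (\<lambda>k. emb F (H k))) = card (emb F F) ^ r" by simp
  qed
  finally show ?thesis by simp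
qed

section \<open>The limit theorems\<close>

lemma wf_graph_of:
  assumes "h \<in> halves m \<rightarrow>\<^sub>E {1..int n}"
  shows "wf_multigraph (graph_of n m h)"
proof -
  have "graph_of n m h \<in> nm_multigraphs n m"
    using bij_betw_graph_of[of n m] assms by (auto simp: bij_betw_def)
  then show ?thesis by (simp add: nm_multigraphs_def)
qed

lemma alternating_choose_sum:
  "(\<Sum>i\<le>R. (- 1) ^ i * real (Suc y choose i)) = (- 1) ^ R * real (y choose R)"
  by (induction R) (simp_all add: algebra_simps)

text \<open>The summands are \<open>x choose j\<close> times \<open>(x - j) choose i\<close>. A
  truncated alternating sum over a row of Pascal's triangle is up to sign an entry of the row above,
  which the first omitted term dominates. The row of \<open>x = j\<close> has the single entry 1, so
  there the sum is exact.\<close>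

lemma bonferroni:
  "\<bar>(if x = j then 1 else 0) - (\<Sum>i\<le>R. (- 1) ^ i * real (ffac x (j + i)) / (fact j * fact i))\<bar>
    \<le> real (ffac x (j + Suc R)) / (fact j * fact (Suc R))"
proof -
  have tm: "real (ffac x (j + i)) / (fact j * fact i) = real (x choose j) * real ((x - j) choose i)" for i
  proof (cases "j + i \<le> x")
    case True
    have "real (ffac x (j + i)) / (fact j * fact i) = real (x choose (j + i)) * real ((j + i) choose j)"
      by (simp add: ffac_eq_fact_binomial binomial_fact)
    also have "\<dots> = real ((x choose (j + i)) * ((j + i) choose j))" by simp
    also have "(x choose (j + i)) * ((j + i) choose j) = (x choose j) * ((x - j) choose i)"
      using choose_mult[of j "j + i" x] True by simp
    finally show ?thesis by simp
  next
    case False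
    then show ?thesis by (cases "j \<le> x") (simp_all add: ffac_eq_0 binomial_eq_0)
  qed
  have s: "(\<Sum>i\<le>R. (- 1) ^ i * real (ffac x (j + i)) / (fact j * fact i))
    = real (x choose j) * (\<Sum>i\<le>R. (- 1) ^ i * real ((x - j) choose i))"
    unfolding sum_distrib_left times_divide_eq_right[symmetric] tm by (intro sum.cong) auto
  consider "x < j" | "x = j" | y where "x = j + Suc y"
    by (metis add_Suc_right less_imp_Suc_add linorder_neqE_nat)
  then show ?thesis
  proof cases
    case 1
    then show ?thesis unfolding s tm by (simp add: binomial_eq_0)
  next
    case 2
    have "(\<Sum>i\<le>R. (- 1) ^ i * real (0 choose i)) = 1"
      by (induction R) simp_all
    then show ?thesis unfolding s tm using 2 by simp
  next
    case 3
    have "real (y choose R) \<le> real (Suc y choose Suc R)" by simp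
    then show ?thesis unfolding s tm using 3
      by (simp add: alternating_choose_sum abs_mult power_abs mult_left_mono del: binomial_Suc_Suc)
  qed
qed

section \<open>Expectations over the random multigraph and the three limits\<close>

context tilted
begin

text \<open>Collects what holds for all large \<open>n\<close>. There \<open>expec\<close> is the
  finite sum \<open>hexp\<close> over well-formed graphs, from which it inherits linearity and
  monotonicity; elsewhere the distribution may be unspecified.\<close>

definition regular :: "nat \<Rightarrow> bool" where
  "regular n \<longleftrightarrow> (\<forall>X. expec n X = hexp pgf m n (\<lambda>h. X (graph_of n (m n) h))) \<and>
     wsum pgf (halves (m n)) {1..int n} (\<lambda>_. 1) > 0 \<and> n > 0 \<and> m n > 0"

lemma eventually_regular: "eventually regular sequentially"
proof -
  have "eventually (\<lambda>n. Suc 0 \<le> m n) sequentially" using m_top unfolding filterlim_at_top by blast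
  then show ?thesis
    using expec_eq_hexp admissible_wsum_pos[OF admissible_pgf] eventually_gt_at_top[of 0]
    by eventually_elim (simp add: regular_def)
qed

lemma expec_mono:
  assumes "regular n" "\<And>G. wf_multigraph G \<Longrightarrow> X G \<le> Y G"
  shows "expec n X \<le> expec n Y"
  using assms(1) unfolding regular_def
  by (auto intro!: hexp_mono[OF admissible_pgf] assms(2) wf_graph_of)

lemma expec_cong:
  assumes "regular n" "\<And>G. wf_multigraph G \<Longrightarrow> X G = Y G"
  shows "expec n X = expec n Y"
  using assms by (intro antisym expec_mono) auto

lemma expec_add: "regular n \<Longrightarrow> expec n (\<lambda>G. X G + Y G) = expec n X + expec n Y"
  by (simp add: regular_def hexp_add)

lemma expec_cmult: "regular n \<Longrightarrow> expec n (\<lambda>G. c * X G) = c * expec n X"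
  by (simp add: regular_def hexp_cmult)

lemma expec_sum: "regular n \<Longrightarrow> expec n (\<lambda>G. \<Sum>i\<in>I. X i G) = (\<Sum>i\<in>I. expec n (X i))"
  by (simp add: regular_def hexp_sum)

lemma expec_const: "regular n \<Longrightarrow> expec n (\<lambda>_. c) = c"
  by (simp add: regular_def hexp_const)

lemma expec_diff: "regular n \<Longrightarrow> expec n (\<lambda>G. X G - Y G) = expec n X - expec n Y"
  using expec_add[of n X "\<lambda>G. (- 1) * Y G"] expec_cmult[of n "- 1" Y] by simp

lemma expec_nonneg:
  assumes "regular n" "\<And>G. wf_multigraph G \<Longrightarrow> X G \<ge> 0"
  shows "expec n X \<ge> 0"
  using expec_mono[of n "\<lambda>_. 0" X] assms expec_const[of n 0] by simp

lemma expec_indicator: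
  "measure_pmf.prob (random_multigraph \<delta> n (m n)) {G. Q G} = expec n (\<lambda>G. if Q G then 1 else 0)"
proof -
  have "(\<lambda>G. if Q G then 1 else 0) = indicat_real {G. Q G}" by (auto simp: indicator_def)
  then show ?thesis by (simp add: expec_def)
qed

lemma ratio_tendsto: "(\<lambda>n. real n / (2 * real (m n))) \<longlonglongrightarrow> 1 / L"
  using tendsto_inverse[OF L_lim] L_pos by (simp add: inverse_eq_divide)

text \<open>The expectation is a convergent factor times
  \<open>n ^ card V / (2 * m n) ^ card E\<close>. As \<open>n / (2 * m n)\<close> converges, each
  edge in excess of the vertices leaves a factor tending to 0.\<close>

lemma expec_embeddings_tendsto_0:
  assumes "finite V" "finite E" "s ` E \<subseteq> V" "t ` E \<subseteq> V" and less: "card V < card E"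
  shows "(\<lambda>n. expec n (\<lambda>G. real (card (embeddings V E s t G)))) \<longlonglongrightarrow> 0"
proof -
  let ?e = "\<lambda>n. expec n (\<lambda>G. real (card (embeddings V E s t G)))"
  let ?k = "card E - card V"
  have inv: "(\<lambda>n. 1 / (2 * real (m n))) \<longlonglongrightarrow> 0"
  proof -
    have "filterlim (\<lambda>n. 2 * real (m n)) at_top sequentially"
      by (intro filterlim_tendsto_pos_mult_at_top[OF tendsto_const]
          filterlim_compose[OF filterlim_real_sequentially m_top]) simp
    then show ?thesis by (rule tendsto_divide_0[OF tendsto_const filterlim_at_top_imp_at_infinity])
  qed
  have "(\<lambda>n. ?e n * (2 * real (m n)) ^ card E / real n ^ card V *
      ((real n / (2 * real (m n))) ^ card V * (1 / (2 * real (m n))) ^ ?k))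
    \<longlonglongrightarrow> (\<Prod>u\<in>V. \<mu> (pattern_degree E s t u)) * ((1 / L) ^ card V * 0 ^ ?k)"
    by (intro tendsto_mult tendsto_power expec_embeddings assms ratio_tendsto inv)
  moreover have "eventually (\<lambda>n. ?e n * (2 * real (m n)) ^ card E / real n ^ card V *
      ((real n / (2 * real (m n))) ^ card V * (1 / (2 * real (m n))) ^ ?k) = ?e n) sequentially"
    using eventually_regular
  proof eventually_elim
    case (elim n)
    have E: "card E = card V + ?k" using less by simp
    have nz: "real n ^ card V \<noteq> 0" "(2 * real (m n)) ^ card E \<noteq> 0" using elim by (auto simp: regular_def)
    have "(real n / (2 * real (m n))) ^ card V * (1 / (2 * real (m n))) ^ ?k
      = real n ^ card V / ((2 * real (m n)) ^ card V * (2 * real (m n)) ^ ?k)"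
      by (simp only: power_divide power_one times_divide_times_eq mult_1_right)
    also have "(2 * real (m n)) ^ card V * (2 * real (m n)) ^ ?k = (2 * real (m n)) ^ card E"
      using E by (metis power_add)
    finally have "(real n / (2 * real (m n))) ^ card V * (1 / (2 * real (m n))) ^ ?k
      = real n ^ card V / (2 * real (m n)) ^ card E" .
    then show ?case using nz by simp
  qed
  ultimately have "?e \<longlonglongrightarrow> (\<Prod>u\<in>V. \<mu> (pattern_degree E s t u)) * ((1 / L) ^ card V * 0 ^ ?k)"
    by (rule Lim_transform_eventually)
  moreover have "(0 :: real) ^ ?k = 0" using less by simp
  ultimately show ?thesis by simp
qed

lemma expec_dense_tendsto_0:
  assumes "a < b"
  shows "(\<lambda>n. expec n (\<lambda>G. real (card (dense_subgraphs a b G)))) \<longlonglongrightarrow> 0"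
proof -
  let ?I = "({..<b} \<rightarrow>\<^sub>E {..<a}) \<times> ({..<b} \<rightarrow>\<^sub>E {..<a})"
  let ?e = "\<lambda>st n. expec n (\<lambda>G. real (card (embeddings {..<a} {..<b} (fst st) (snd st) G)))"
  show ?thesis
  proof (rule tendsto_sandwich[OF _ _ tendsto_const])
    show "eventually (\<lambda>n. 0 \<le> expec n (\<lambda>G. real (card (dense_subgraphs a b G)))) sequentially"
      using eventually_regular by eventually_elim (rule expec_nonneg, auto)
    show "eventually (\<lambda>n. expec n (\<lambda>G. real (card (dense_subgraphs a b G))) \<le> (\<Sum>st\<in>?I. ?e st n)) sequentially"
      using eventually_regular
    proof eventually_elim
      case (elim n)
      show ?case unfolding expec_sum[OF elim, symmetric]
      proof (rule expec_mono[OF elim])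
        fix G assume "wf_multigraph G"
        from of_nat_mono[OF card_dense_subgraphs_le[OF this, of a b], where 'a = real]
        show "real (card (dense_subgraphs a b G)) \<le> (\<Sum>st\<in>?I. real (card (embeddings {..<a} {..<b} (fst st) (snd st) G)))"
          by (simp only: of_nat_sum)
      qed
    qed
    have "(\<lambda>n. \<Sum>st\<in>?I. ?e st n) \<longlonglongrightarrow> (\<Sum>st\<in>?I. 0)"
    proof (rule tendsto_sum)
      fix st assume "st \<in> ?I"
      then have st: "fst st \<in> {..<b} \<rightarrow>\<^sub>E {..<a}" "snd st \<in> {..<b} \<rightarrow>\<^sub>E {..<a}"
        by (simp_all only: mem_Times_iff)
      show "?e st \<longlonglongrightarrow> 0"
      proof (rule expec_embeddings_tendsto_0)
        show "fst st ` {..<b} \<subseteq> {..<a}" by (intro image_subsetI PiE_mem[OF st(1)])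
        show "snd st ` {..<b} \<subseteq> {..<a}" by (intro image_subsetI PiE_mem[OF st(2)])
      qed (use assms in simp_all)
    qed
    then show "(\<lambda>n. \<Sum>st\<in>?I. ?e st n) \<longlonglongrightarrow> 0" by simp
  qed
qed

text \<open>First moment method: a copy of \<open>F\<close> is a subgraph with more edges than
  vertices, and the expected number of subgraphs with these two sizes vanishes in the limit.\<close>

theorem dense_not_subgraph:
  assumes F: "connected_multigraph F" "\<not> tree_multigraph F" "\<not> unicycle F"
  shows "(\<lambda>n. measure_pmf.prob (random_multigraph \<delta> n (m n))
    {G. \<not> (\<exists>H. submultigraph H G \<and> isomorphic F H)}) \<longlonglongrightarrow> 1"
proof -
  let ?a = "card (mverts F)" and ?b = "card (medges F)"
  let ?d = "\<lambda>n. expec n (\<lambda>G. real (card (dense_subgraphs ?a ?b G)))"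
  let ?Q = "\<lambda>G. \<not> (\<exists>H. submultigraph H G \<and> isomorphic F H)"
  have lim: "(\<lambda>n. 1 - ?d n) \<longlonglongrightarrow> 1 - 0"
    by (intro tendsto_diff tendsto_const expec_dense_tendsto_0 connected_not_tree_not_unicycle F)
  show ?thesis
    unfolding expec_indicator
  proof (rule tendsto_sandwich[OF _ _ _ tendsto_const])
    show "(\<lambda>n. 1 - ?d n) \<longlonglongrightarrow> 1" using lim by simp
    show "eventually (\<lambda>n. expec n (\<lambda>G. if ?Q G then 1 else 0) \<le> 1) sequentially"
      using eventually_regular
    proof eventually_elim
      case (elim n)
      have "expec n (\<lambda>G. if ?Q G then 1 else 0) \<le> expec n (\<lambda>_. 1)"
        by (rule expec_mono[OF elim]) auto
      then show ?case by (simp add: expec_const[OF elim])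
    qed
    show "eventually (\<lambda>n. 1 - ?d n \<le> expec n (\<lambda>G. if ?Q G then 1 else 0)) sequentially"
      using eventually_regular
    proof eventually_elim
      case (elim n)
      have "expec n (\<lambda>G. 1 - real (card (dense_subgraphs ?a ?b G))) \<le> expec n (\<lambda>G. if ?Q G then 1 else 0)"
      proof (rule expec_mono[OF elim])
        fix G assume G: "wf_multigraph G"
        show "1 - real (card (dense_subgraphs ?a ?b G)) \<le> (if ?Q G then 1 else 0)"
        proof (cases "?Q G")
          case False
          then obtain H where H: "H \<in> copies F G" by (auto simp: copies_def)
          then have "H \<in> dense_subgraphs ?a ?b G"
            using copies_iso_card[OF H] by (simp add: dense_subgraphs_def copies_def)
          moreover have "finite (dense_subgraphs ?a ?b G)"
            by (rule finite_subset[OF _ finite_submultigraphs(1)[OF G]]) (auto simp: dense_subgraphs_def)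
          ultimately have "card (dense_subgraphs ?a ?b G) \<ge> 1"
            by (metis One_nat_def Suc_leI card_gt_0_iff empty_iff)
          then show ?thesis using False by simp
        qed simp
      qed
      then show ?case by (simp add: expec_diff[OF elim] expec_const[OF elim])
    qed
  qed
qed

lemma card_emb_self_pos:
  assumes F: "wf_multigraph F"
  shows "card (emb F F) > 0"
proof -
  have "(restrict id (mverts F), \<lambda>x\<in>medges F. (x, False)) \<in> emb F F"
    using wf_multigraph_ends(3,4)[OF F]
    by (auto simp: embeddings_def dart_tail_def dart_head_def inj_on_def image_subset_iff)
  then show ?thesis
    using finite_embeddings[OF wf_multigraph_ends(1,2)[OF F] F] by (metis card_gt_0_iff empty_iff)
qed

theorem tree_count_asymptotics:
  assumes T: "tree_multigraph T" and k: "card (mverts T) = k"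
  shows "(\<lambda>n. measure_pmf.expectation (random_multigraph \<delta> n (m n)) (\<lambda>G. real (subgraph_count T G)))
    \<sim>[sequentially] (\<lambda>n. 1 / real (aut T) * (real n ^ k / (2 * real (m n)) ^ (k - 1)) * (\<Prod>v\<in>mverts T. \<mu> (mdegree T v)))"
    (is "?f \<sim>[sequentially] ?g")
proof -
  have conn: "connected_multigraph T" using T by (simp add: tree_multigraph_def)
  then have wf: "wf_multigraph T" by (simp add: connected_multigraph_def)
  note ends = wf_multigraph_ends[OF wf]
  have E: "card (medges T) = k - 1" using tree_card[OF T] k by simp
  have a: "card (emb T T) = aut T" by (rule card_emb_loopless[OF wf tree_loopless[OF T]])
  have a0: "aut T > 0" using card_emb_self_pos[OF wf] a by simp
  let ?M = "\<Prod>v\<in>mverts T. \<mu> (mdegree T v)"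
  let ?e = "\<lambda>n. expec n (\<lambda>G. real (card (emb T G)))"
  have M: "(\<Prod>u\<in>mverts T. \<mu> (pattern_degree (medges T) edge_source edge_target u)) = ?M"
    by (simp add: mdegree_eq_pattern_degree[OF ends(2)])
  have ef: "eventually (\<lambda>n. ?e n = real (aut T) * ?f n) sequentially"
    using eventually_regular
  proof eventually_elim
    case (elim n)
    have "?e n = expec n (\<lambda>G. real (aut T) * real (subgraph_count T G))"
      by (rule expec_cong[OF elim]) (simp add: card_emb[OF wf] a)
    then show ?case by (simp add: expec_cmult[OF elim] expec_def)
  qed
  show ?thesis
  proof (cases "?M = 0")
    \<comment> \<open>Quotients are of no use here: the claim is that the expected count is 0 for
      all large \<open>n\<close>.\<close>
    case True
    have "eventually (\<lambda>n. ?e n = 0) sequentially"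
      by (rule expec_embeddings_eq_0[OF ends]) (simp add: M True)
    with ef have "eventually (\<lambda>n. ?f n = ?g n) sequentially"
      by eventually_elim (use a0 True in simp)
    then show ?thesis by (rule asymp_equiv_refl_ev)
  next
    case False
    have "(\<lambda>n. (?e n * (2 * real (m n)) ^ (k - 1) / real n ^ k) / ?M) \<longlonglongrightarrow> ?M / ?M"
      using expec_embeddings[OF ends] False unfolding M E k by (intro tendsto_divide tendsto_const)
    moreover have "eventually (\<lambda>n. (?e n * (2 * real (m n)) ^ (k - 1) / real n ^ k) / ?M = ?f n / ?g n) sequentially"
      using ef
    proof eventually_elim
      case (elim n)
      show ?case unfolding elim using a0 False by simp
    qed
    ultimately have "(\<lambda>n. ?f n / ?g n) \<longlonglongrightarrow> ?M / ?M" by (rule Lim_transform_eventually)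
    moreover have "?M / ?M = 1" using False by simp
    ultimately have "(\<lambda>n. ?f n / ?g n) \<longlonglongrightarrow> 1" by (simp only:)
    then show ?thesis by (rule asymp_equivI')
  qed
qed

text \<open>The embedding asymptotics for \<open>r\<close> disjoint cycles: all pattern degrees are
  2, there are as many edges as vertices, which leaves powers of \<open>n / (2 * m n)\<close>, and
  each cycle has \<open>2 * l\<close> embeddings into itself.\<close>

lemma expec_disjoint_cycles:
  assumes l: "l \<ge> 1"
  shows "(\<lambda>n. expec n (\<lambda>G. real (card (disjoint_copies r (cycle_multigraph l) G))))
    \<longlonglongrightarrow> (1 / (2 * real l) * (1 / L * \<mu> 2) ^ l) ^ r"
proof -
  let ?C = "cycle_multigraph l"
  let ?V = "{..<r} \<times> mverts ?C" and ?E = "{..<r} \<times> medges ?C"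
  let ?e = "\<lambda>n. expec n (\<lambda>G. real (card (fold_emb r ?C G)))"
  let ?x = "\<lambda>n. expec n (\<lambda>G. real (card (disjoint_copies r ?C G)))"
  have wf: "wf_multigraph ?C" by (rule wf_cycle[OF l])
  note ends = wf_multigraph_ends[OF wf]
  have c: "card ?V = r * l" "card ?E = r * l"
    by (simp_all add: card_cartesian_product card_medges_cycle mverts_cycle)
  have P: "(\<Prod>u\<in>?V. \<mu> (pattern_degree ?E fold_source fold_target u)) = \<mu> 2 ^ (r * l)"
  proof -
    have "(\<Prod>u\<in>?V. \<mu> (pattern_degree ?E fold_source fold_target u)) = (\<Prod>u\<in>?V. \<mu> 2)"
    proof (intro prod.cong refl)
      fix u assume "u \<in> ?V"
      then obtain k v where u: "u = (k, v)" "k < r" "v \<in> mverts ?C" by auto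
      then show "\<mu> (pattern_degree ?E fold_source fold_target u) = \<mu> 2"
        using fold_pattern_degree[OF ends(2) u(2)] mdegree_cycle[OF l u(3)] by simp
    qed
    then show ?thesis using c by simp
  qed
  have fe: "fold_source ` ?E \<subseteq> ?V" "fold_target ` ?E \<subseteq> ?V"
    using ends(3,4) by (auto simp: fold_source_def fold_target_def)
  have "(\<lambda>n. ?e n * (2 * real (m n)) ^ card ?E / real n ^ card ?V * (real n / (2 * real (m n))) ^ (r * l) / (2 * real l) ^ r)
    \<longlonglongrightarrow> (\<Prod>u\<in>?V. \<mu> (pattern_degree ?E fold_source fold_target u)) * (1 / L) ^ (r * l) / (2 * real l) ^ r"
    using l ends fe by (intro tendsto_mult tendsto_divide tendsto_power tendsto_const expec_embeddings ratio_tendsto) auto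
  moreover have "eventually (\<lambda>n. ?e n * (2 * real (m n)) ^ card ?E / real n ^ card ?V *
      (real n / (2 * real (m n))) ^ (r * l) / (2 * real l) ^ r = ?x n) sequentially"
    using eventually_regular
  proof eventually_elim
    case (elim n)
    have "?e n = expec n (\<lambda>G. (2 * real l) ^ r * real (card (disjoint_copies r ?C G)))"
      by (rule expec_cong[OF elim]) (simp add: card_fold_emb[OF wf] card_emb_cycle[OF l])
    then have e: "?e n = (2 * real l) ^ r * ?x n" by (simp only: expec_cmult[OF elim])
    have nz: "(real n) ^ (r * l) \<noteq> 0" "(2 * real (m n)) ^ (r * l) \<noteq> 0" "(2 * real l) ^ r \<noteq> 0"
      using elim l by (auto simp: regular_def)
    have "a * x * N / D * (D / N) / a = x" if "D \<noteq> 0" "N \<noteq> 0" "a \<noteq> 0" for a x N D :: real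
      using that by simp
    from this[OF nz] show ?case unfolding e c power_divide[of "real n" "2 * real (m n)"] .
  qed
  ultimately have "?x \<longlonglongrightarrow> \<mu> 2 ^ (r * l) * (1 / L) ^ (r * l) / (2 * real l) ^ r"
    unfolding P by (rule Lim_transform_eventually)
  also have "\<mu> 2 ^ (r * l) * (1 / L) ^ (r * l) / (2 * real l) ^ r = (1 / (2 * real l) * (1 / L * \<mu> 2) ^ l) ^ r"
  proof -
    have "(1 / (2 * real l) * (1 / L * \<mu> 2) ^ l) ^ r = (1 / (2 * real l)) ^ r * (1 / L * \<mu> 2) ^ (r * l)"
      by (simp only: power_mult_distrib power_mult[symmetric] mult.commute[of l r])
    then show ?thesis by (simp add: power_mult_distrib power_divide)
  qed
  finally show ?thesis .
qed

lemma expec_overlapping_cycles: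
  assumes l: "l \<ge> 1"
  shows "(\<lambda>n. expec n (\<lambda>G. real (card (overlapping_copies r (cycle_multigraph l) G)))) \<longlonglongrightarrow> 0"
proof -
  let ?C = "cycle_multigraph l"
  let ?I = "{(a, b). a < b \<and> b \<le> r * l}"
  let ?K = "\<lambda>p. (2 ^ fst p * 2 ^ snd p) ^ r :: real"
  let ?d = "\<lambda>p n. expec n (\<lambda>G. real (card (dense_subgraphs (fst p) (snd p) G)))"
  show ?thesis
  proof (rule tendsto_sandwich[OF _ _ tendsto_const])
    show "eventually (\<lambda>n. 0 \<le> expec n (\<lambda>G. real (card (overlapping_copies r ?C G)))) sequentially"
      using eventually_regular by eventually_elim (rule expec_nonneg, auto)
    show "eventually (\<lambda>n. expec n (\<lambda>G. real (card (overlapping_copies r ?C G))) \<le> (\<Sum>p\<in>?I. ?K p * ?d p n)) sequentially"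
      using eventually_regular
    proof eventually_elim
      case (elim n)
      show ?case unfolding expec_cmult[OF elim, symmetric] expec_sum[OF elim, symmetric]
      proof (rule expec_mono[OF elim])
        fix G assume "wf_multigraph G"
        from card_overlapping_cycles_le[OF l this, of r]
        have "real (card (overlapping_copies r ?C G))
          \<le> real (\<Sum>(a, b)\<in>?I. (2 ^ a * 2 ^ b) ^ r * card (dense_subgraphs a b G))" by (rule of_nat_mono)
        also have "\<dots> = (\<Sum>p\<in>?I. ?K p * real (card (dense_subgraphs (fst p) (snd p) G)))"
          by (simp add: case_prod_beta)
        finally show "real (card (overlapping_copies r ?C G))
          \<le> (\<Sum>p\<in>?I. ?K p * real (card (dense_subgraphs (fst p) (snd p) G)))" .
      qed
    qed
    have "(\<lambda>n. \<Sum>p\<in>?I. ?K p * ?d p n) \<longlonglongrightarrow> (\<Sum>p\<in>?I. ?K p * 0)"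
      by (intro tendsto_sum tendsto_mult tendsto_const expec_dense_tendsto_0) auto
    then show "(\<lambda>n. \<Sum>p\<in>?I. ?K p * ?d p n) \<longlonglongrightarrow> 0" by simp
  qed
qed

lemma expec_cycle_factorial_moment:
  assumes l: "l \<ge> 1"
  shows "(\<lambda>n. expec n (\<lambda>G. real (ffac (subgraph_count (cycle_multigraph l) G) r)))
    \<longlonglongrightarrow> (1 / (2 * real l) * (1 / L * \<mu> 2) ^ l) ^ r"
proof -
  let ?C = "cycle_multigraph l"
  have ne: "mverts ?C \<noteq> {}" "finite (mverts ?C)" using l by (auto simp: mverts_cycle)
  have "(\<lambda>n. expec n (\<lambda>G. real (card (disjoint_copies r ?C G))) + expec n (\<lambda>G. real (card (overlapping_copies r ?C G))))
    \<longlonglongrightarrow> (1 / (2 * real l) * (1 / L * \<mu> 2) ^ l) ^ r + 0"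
    by (intro tendsto_add expec_disjoint_cycles expec_overlapping_cycles l)
  moreover have "eventually (\<lambda>n. expec n (\<lambda>G. real (card (disjoint_copies r ?C G))) + expec n (\<lambda>G. real (card (overlapping_copies r ?C G)))
    = expec n (\<lambda>G. real (ffac (subgraph_count ?C G) r))) sequentially"
    using eventually_regular
  proof eventually_elim
    case (elim n)
    show ?case unfolding expec_add[OF elim, symmetric]
      by (rule expec_cong[OF elim]) (simp add: ffac_subgraph_count[OF _ ne])
  qed
  ultimately have "(\<lambda>n. expec n (\<lambda>G. real (ffac (subgraph_count ?C G) r))) \<longlonglongrightarrow> (1 / (2 * real l) * (1 / L * \<mu> 2) ^ l) ^ r + 0"
    by (rule Lim_transform_eventually)
  then show ?thesis by (simp only: add_0_right)
qed

text \<open>The Bonferroni sum of length \<open>R\<close> and its error bound converge to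
  \<open>s R\<close> and \<open>t R\<close> as \<open>n\<close> grows. The \<open>s R\<close> are
  partial sums of the exponential series of the Poisson mass and \<open>t R\<close> tends to 0, so
  \<open>R\<close> is fixed first and \<open>n\<close> grows afterwards.\<close>

lemma poisson_from_factorial_moments:
  fixes X :: "multigraph \<Rightarrow> nat"
  assumes r0: "\<rho> \<ge> 0" and mom: "\<And>r. (\<lambda>n. expec n (\<lambda>G. real (ffac (X G) r))) \<longlonglongrightarrow> \<rho> ^ r"
  shows "(\<lambda>n. expec n (\<lambda>G. if X G = j then 1 else 0)) \<longlonglongrightarrow> poisson_mass \<rho> j"
proof (rule tendstoI)
  fix \<epsilon> :: real assume \<epsilon>: "\<epsilon> > 0"
  let ?p = "\<lambda>n. expec n (\<lambda>G. if X G = j then 1 else 0)"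
  let ?M = "\<lambda>n r. expec n (\<lambda>G. real (ffac (X G) r))"
  define s where "s R = (\<Sum>i\<le>R. (- 1) ^ i / (fact j * fact i) * \<rho> ^ (j + i))" for R
  define t where "t R = 1 / (fact j * fact (Suc R)) * \<rho> ^ (j + Suc R)" for R
  have s: "s \<longlonglongrightarrow> poisson_mass \<rho> j"
  proof -
    have "(\<lambda>R. \<Sum>i\<le>R. (- \<rho>) ^ i /\<^sub>R fact i) \<longlonglongrightarrow> exp (- \<rho>)"
      using exp_converges[of "- \<rho>"] by (simp add: sums_def_le)
    then have "(\<lambda>R. \<rho> ^ j / fact j * (\<Sum>i\<le>R. (- \<rho>) ^ i /\<^sub>R fact i)) \<longlonglongrightarrow> \<rho> ^ j / fact j * exp (- \<rho>)"
      by (intro tendsto_mult tendsto_const)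
    moreover have "\<rho> ^ j / fact j * (\<Sum>i\<le>R. (- \<rho>) ^ i /\<^sub>R fact i) = s R" for R
      unfolding s_def sum_distrib_left
      by (intro sum.cong refl) (simp add: power_minus[of \<rho>] power_add divide_inverse)
    ultimately show ?thesis by (simp add: poisson_mass_def)
  qed
  have t: "t \<longlonglongrightarrow> 0"
  proof -
    have "(\<lambda>i. inverse (fact i) * \<rho> ^ i) \<longlonglongrightarrow> 0" by (rule summable_LIMSEQ_zero[OF summable_exp])
    then have "(\<lambda>R. \<rho> ^ j / fact j * (inverse (fact (Suc R)) * \<rho> ^ Suc R)) \<longlonglongrightarrow> \<rho> ^ j / fact j * 0"
      by (intro tendsto_mult tendsto_const LIMSEQ_Suc)
    moreover have "\<rho> ^ j / fact j * (inverse (fact (Suc R)) * \<rho> ^ Suc R) = t R" for R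
      unfolding t_def power_add by (simp add: divide_inverse del: fact_Suc)
    ultimately show ?thesis by (simp only: mult_zero_right)
  qed
  have "eventually (\<lambda>R. dist (s R) (poisson_mass \<rho> j) < \<epsilon> / 4 \<and> dist (t R) 0 < \<epsilon> / 4) sequentially"
    using \<epsilon> by (intro eventually_conj tendstoD[OF s] tendstoD[OF t]) auto
  then obtain R where R: "\<bar>s R - poisson_mass \<rho> j\<bar> < \<epsilon> / 4" "\<bar>t R\<bar> < \<epsilon> / 4"
    by (auto simp: eventually_sequentially dist_real_def)
  let ?S = "\<lambda>n. \<Sum>i\<le>R. (- 1) ^ i / (fact j * fact i) * ?M n (j + i)"
  let ?T = "\<lambda>n. 1 / (fact j * fact (Suc R)) * ?M n (j + Suc R)"
  have S: "?S \<longlonglongrightarrow> s R" unfolding s_def by (intro tendsto_sum tendsto_mult tendsto_const mom)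
  have T: "?T \<longlonglongrightarrow> t R" unfolding t_def by (intro tendsto_mult tendsto_const mom)
  have "eventually (\<lambda>n. dist (?S n) (s R) < \<epsilon> / 4) sequentially" "eventually (\<lambda>n. dist (?T n) (t R) < \<epsilon> / 4) sequentially"
    using \<epsilon> by (intro tendstoD[OF S] tendstoD[OF T]; simp)+
  then show "eventually (\<lambda>n. dist (?p n) (poisson_mass \<rho> j) < \<epsilon>) sequentially"
    using eventually_regular
  proof eventually_elim
    case (elim n)
    let ?a = "\<lambda>G. if X G = j then 1 else 0 :: real"
    let ?b = "\<lambda>G. \<Sum>i\<le>R. (- 1) ^ i / (fact j * fact i) * real (ffac (X G) (j + i))"
    let ?c = "\<lambda>G. 1 / (fact j * fact (Suc R)) * real (ffac (X G) (j + Suc R))"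
    have bon: "\<bar>?a G - ?b G\<bar> \<le> ?c G" for G
      using bonferroni[of "X G" j R] by (simp del: fact_Suc)
    have eb: "expec n ?b = ?S n" by (simp only: expec_sum[OF elim(3)] expec_cmult[OF elim(3)])
    have ec: "expec n ?c = ?T n" by (rule expec_cmult[OF elim(3)])
    have "expec n (\<lambda>G. ?a G - ?b G) \<le> expec n ?c"
      by (rule expec_mono[OF elim(3)]) (use bon in \<open>simp only: abs_le_iff\<close>)
    moreover have "expec n (\<lambda>G. ?b G - ?a G) \<le> expec n ?c"
    proof (rule expec_mono[OF elim(3)])
      fix G
      show "?b G - ?a G \<le> ?c G" using bon[of G] by linarith
    qed
    ultimately have "\<bar>?p n - ?S n\<bar> \<le> ?T n"
      unfolding expec_diff[OF elim(3)] eb ec by linarith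
    then show ?case using elim(1,2) R unfolding dist_real_def by linarith
  qed
qed

text \<open>The factorial moments determine a limit with \<open>1 / L\<close> in the rate. Since
  \<open>poisson_mass\<close> is continuous in its rate, \<open>1 / L\<close> may be replaced by
  \<open>n / (2 * m n)\<close>, at the price of stating the limit as a difference.\<close>

theorem cycle_count_poisson:
  assumes l: "l \<ge> 1"
  shows "(\<lambda>n. measure_pmf.prob (random_multigraph \<delta> n (m n)) {G. subgraph_count (cycle_multigraph l) G = j}
    - poisson_mass (1 / (2 * real l) * (real n / (2 * real (m n)) * \<mu> 2) ^ l) j) \<longlonglongrightarrow> 0"
proof -
  let ?\<rho> = "1 / (2 * real l) * (1 / L * \<mu> 2) ^ l"
  have "\<mu> 2 \<ge> 0"
    unfolding mean_pgf[symmetric] mean_def by (intro sum_nonneg mult_nonneg_nonneg coeff_pgf_nonneg) simp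
  then have "?\<rho> \<ge> 0" using L_pos by (intro mult_nonneg_nonneg zero_le_power) auto
  then have "(\<lambda>n. expec n (\<lambda>G. if subgraph_count (cycle_multigraph l) G = j then 1 else 0)) \<longlonglongrightarrow> poisson_mass ?\<rho> j"
    by (rule poisson_from_factorial_moments) (rule expec_cycle_factorial_moment[OF l])
  moreover have "(\<lambda>n. poisson_mass (1 / (2 * real l) * (real n / (2 * real (m n)) * \<mu> 2) ^ l) j) \<longlonglongrightarrow> poisson_mass ?\<rho> j"
    unfolding poisson_mass_def by (intro tendsto_intros ratio_tendsto) auto
  ultimately have "(\<lambda>n. expec n (\<lambda>G. if subgraph_count (cycle_multigraph l) G = j then 1 else 0)
    - poisson_mass (1 / (2 * real l) * (real n / (2 * real (m n)) * \<mu> 2) ^ l) j) \<longlonglongrightarrow> poisson_mass ?\<rho> j - poisson_mass ?\<rho> j"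
    by (rule tendsto_diff)
  then show ?thesis unfolding expec_indicator by simp
qed

end

theorem theorem6p7:
  fixes \<delta> :: "nat \<Rightarrow> real" and \<Delta> :: "real poly"
    and m :: "nat \<Rightarrow> nat" and L chi :: real
  assumes "\<And>d. \<delta> d \<ge> 0"
    and "\<And>d. coeff \<Delta> d = \<delta> d / fact d"
    and "aperiodic \<delta>"
    and "filterlim m at_top sequentially"
    and "(\<lambda>n. 2 * real (m n) / real n) \<longlonglongrightarrow> L"
    and "real (Min (support \<delta>)) < L" and "L < real (Max (support \<delta>))"
    and "chi > 0" and "chi * poly (pderiv \<Delta>) chi / poly \<Delta> chi = L"
  shows
    "(\<forall>F. connected_multigraph F \<and> \<not> tree_multigraph F \<and> \<not> unicycle F \<longrightarrow>
        (\<lambda>n. measure_pmf.prob (random_multigraph \<delta> n (m n))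
               {G. \<not> (\<exists>H. submultigraph H G \<and> isomorphic F H)}) \<longlonglongrightarrow> 1)
     \<and> (\<forall>T k. tree_multigraph T \<and> card (mverts T) = k \<longrightarrow>
        (\<lambda>n. measure_pmf.expectation (random_multigraph \<delta> n (m n))
               (\<lambda>G. real (subgraph_count T G)))
        \<sim>[sequentially]
        (\<lambda>n. 1 / real (aut T) * (real n ^ k / (2 * real (m n)) ^ (k - 1)) *
             (\<Prod>v\<in>mverts T. chi ^ mdegree T v * poly ((pderiv ^^ mdegree T v) \<Delta>) chi / poly \<Delta> chi)))
     \<and> (\<forall>l\<ge>1. \<forall>j.
        (\<lambda>n. measure_pmf.prob (random_multigraph \<delta> n (m n))
               {G. subgraph_count (cycle_multigraph l) G = j}
             - poisson_mass
                 (1 / (2 * real l) *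
                  (real n / (2 * real (m n)) *
                   (chi\<^sup>2 * poly ((pderiv ^^ 2) \<Delta>) chi / poly \<Delta> chi)) ^ l) j)
        \<longlonglongrightarrow> 0)"
proof -
  interpret tilted \<delta> \<Delta> m L chi
    by (rule tilted.intro) (fact assms)+
  show ?thesis
    using dense_not_subgraph tree_count_asymptotics cycle_count_poisson unfolding \<mu>_def by blast
qed

end
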